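(* Let $d\in\{1,2\}$, let $\mathbb{B}_1$ be the unit ball of $\mathbb{R}^d$, let $\lambda>0$, $B>0$, $T\ge0$, and let $(u^0,u^1)\in H^4(\mathbb{B}_1)\times H^2(\mathbb{B}_1)$ be such that $u^0>-1$ in $\mathbb{B}_1$ and both $u^0$ and $u^1$ satisfy $v=\partial_\nu v=0$ on $\partial\mathbb{B}_1$. Let $u$ be the maximal solution either to the hyperbolic problem $(H)$ (with $\gamma>0$) with initial condition $(u^0,u^1)$, or to the parabolic problem $(Q)$ with initial condition $u^0$, and let $\tau_m\in(0,\infty]$ be its maximal existence time. If $\lambda$ is sufficiently large, namely if $$\lambda>\frac{4m_1}{27},$$ then $\tau_m<\infty$.
   Context: The two problems are, with $\nu$ the outward unit normal: $(H)$: $\gamma^2\partial_t^2u+\partial_tu+B\Delta^2u-T\Delta u=-\lambda(1+u)^{-2}$ for $t>0$, $x\in\mathbb{B}_1$; $u=\partial_\nu u=0$ on $\partial\mathbb{B}_1$ for $t>0$; $u(0,\cdot)=u^0$, $\partial_tu(0,\cdot)=u^1$. $(Q)$: $\partial_tu+B\Delta^2u-T\Delta u=-\lambda(1+u)^{-2}$ for $t>0$, $x\in\mathbb{B}_1$; $u=\partial_\nu u=0$ on $\partial\mathbb{B}_1$ for $t>0$; $u(0,\cdot)=u^0$. The maximal solution to $(H)$ is the unique solution $u$ on a maximal time interval $[0,\tau_m)$ with $u(t)>-1$ in $\bar{\mathbb{B}}_1$ for all $t\in[0,\tau_m)$, $u\in C([0,\tau_m),H^2(\mathbb{B}_1))\cap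 C^1([0,\tau_m),L_2(\mathbb{B}_1))$ and $\partial_t^ku\in L_1(0,\tau;H^{4-2k}(\mathbb{B}_1))$ for $k=0,1,2$, $\tau\in(0,\tau_m)$, the equation holding in $L_2(\mathbb{B}_1)$ for a.e. $t$. The maximal solution to $(Q)$ is the unique solution $u$ on a maximal time interval $[0,\tau_m)$ with $u(t)>-1$ in $\bar{\mathbb{B}}_1$ for all $t\in[0,\tau_m)$ and $u\in C([0,\tau_m),H^2(\mathbb{B}_1))\cap C((0,\tau_m),H^4(\mathbb{B}_1))\cap C^1((0,\tau_m),L_2(\mathbb{B}_1))$. The number $m_1>0$ is the eigenvalue of $B\Delta^2-T\Delta$ in $\mathbb{B}_1$ with boundary conditions $v=\partial_\nu v=0$ on $\partial\mathbb{B}_1$ that admits a radially symmetric eigenfunction $\phi_1\in C^4(\bar{\mathbb{B}}_1)$, $B\Delta^2\phi_1-T\Delta\phi_1=m_1\phi_1$, with $\phi_1>0$ in $\mathbb{B}_1$ and $\|\phi_1\|_{L_1}=1$ (such $m_1$ and $\phi_1$ are known to exist). *)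

theory Defs
  imports "HOL-Analysis.Analysis"
begin

section \<open>Classical derivatives\<close>

text \<open>Directions of partial derivatives are elements of \<^term>\<open>Basis\<close>; multi-indices are lists
  over \<^term>\<open>Basis\<close>, the head being the outermost derivative.\<close>

definition partial_at :: "'a::euclidean_space \<Rightarrow> ('a \<Rightarrow> real) \<Rightarrow> 'a \<Rightarrow> real" where
  "partial_at b f x = frechet_derivative f (at x) b"

definition partials :: "'a::euclidean_space list \<Rightarrow> ('a \<Rightarrow> real) \<Rightarrow> 'a \<Rightarrow> real" where
  "partials bs f = foldr partial_at bs f"

definition multi_indices :: "nat \<Rightarrow> 'a::euclidean_space list set" where
  "multi_indices k = {bs. set bs \<subseteq> Basis \<and> length bs \<le> k}"

text \<open>Intended for open \<open>S\<close>.\<close>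

primrec Ck_on :: "nat \<Rightarrow> 'a::euclidean_space set \<Rightarrow> ('a \<Rightarrow> real) \<Rightarrow> bool" where
  "Ck_on 0 S f \<longleftrightarrow> continuous_on S f"
| "Ck_on (Suc k) S f \<longleftrightarrow>
     (\<forall>x\<in>S. f differentiable (at x)) \<and> (\<forall>b\<in>Basis. Ck_on k S (partial_at b f))"

text \<open>Functions in \<open>C\<^sup>k\<close> of the closure of an open set \<open>S\<close>: all derivatives up to order \<open>k\<close> extend
  continuously to the boundary.\<close>

definition Ck_closure :: "nat \<Rightarrow> 'a::euclidean_space set \<Rightarrow> ('a \<Rightarrow> real) \<Rightarrow> bool" where
  "Ck_closure k S f \<longleftrightarrow>
     continuous_on (closure S) f \<and> Ck_on k S f \<and>
     (\<forall>bs\<in>multi_indices k. \<exists>g. continuous_on (closure S) g \<and> (\<forall>x\<in>S. g x = partials bs f x))"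

definition laplacian :: "('a::euclidean_space \<Rightarrow> real) \<Rightarrow> 'a \<Rightarrow> real" where
  "laplacian f x = (\<Sum>b\<in>Basis. partials [b, b] f x)"

definition bilaplacian :: "('a::euclidean_space \<Rightarrow> real) \<Rightarrow> 'a \<Rightarrow> real" where
  "bilaplacian f x = (\<Sum>b\<in>Basis. \<Sum>c\<in>Basis. partials [b, b, c, c] f x)"

definition smooth :: "('a::euclidean_space \<Rightarrow> real) \<Rightarrow> bool" where
  "smooth f \<longleftrightarrow> (\<forall>k. Ck_on k UNIV f)"

definition test_function :: "'a::euclidean_space set \<Rightarrow> ('a \<Rightarrow> real) \<Rightarrow> bool" where
  "test_function S f \<longleftrightarrow>
     smooth f \<and> compact (closure {x. f x \<noteq> 0}) \<and> closure {x. f x \<noteq> 0} \<subseteq> S"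


section \<open>Sobolev spaces \<open>H\<^sup>k = W\<^sup>k\<^sup>,\<^sup>2\<close>\<close>

text \<open>Elements are functions rather than equivalence classes; all notions below depend only on
  the almost-everywhere class of the restriction to the domain \<open>S\<close>.\<close>

definition L2_space :: "'a::euclidean_space set \<Rightarrow> ('a \<Rightarrow> real) set" where
  "L2_space S = {f \<in> borel_measurable (lebesgue_on S). integrable (lebesgue_on S) (\<lambda>x. (f x)\<^sup>2)}"

definition L2_norm :: "'a::euclidean_space set \<Rightarrow> ('a \<Rightarrow> real) \<Rightarrow> real" where
  "L2_norm S f = sqrt (LINT x|lebesgue_on S. (f x)\<^sup>2)"

definition has_weak_deriv ::
    "'a::euclidean_space set \<Rightarrow> 'a list \<Rightarrow> ('a \<Rightarrow> real) \<Rightarrow> ('a \<Rightarrow> real) \<Rightarrow> bool" where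
  "has_weak_deriv S bs f g \<longleftrightarrow>
     (\<forall>\<phi>. test_function S \<phi> \<longrightarrow>
        (LINT x|lebesgue_on S. f x * partials bs \<phi> x) =
        (- 1) ^ length bs * (LINT x|lebesgue_on S. g x * \<phi> x))"

definition sobolev :: "nat \<Rightarrow> 'a::euclidean_space set \<Rightarrow> ('a \<Rightarrow> real) set" where
  "sobolev k S =
     {f \<in> L2_space S. \<forall>bs\<in>multi_indices k. \<exists>g\<in>L2_space S. has_weak_deriv S bs f g}"

text \<open>A representative of the weak derivative, which is unique up to null sets.\<close>

definition weak_deriv :: "'a::euclidean_space set \<Rightarrow> 'a list \<Rightarrow> ('a \<Rightarrow> real) \<Rightarrow> 'a \<Rightarrow> real" where
  "weak_deriv S bs f = (SOME g. g \<in> L2_space S \<and> has_weak_deriv S bs f g)"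

text \<open>Summing over lists of directions counts mixed derivatives with multiplicity, i.e. the
  derivative of order \<open>j\<close> is measured in the Euclidean norm of \<open>j\<close>-tensors.\<close>

definition sobolev_norm :: "nat \<Rightarrow> 'a::euclidean_space set \<Rightarrow> ('a \<Rightarrow> real) \<Rightarrow> real" where
  "sobolev_norm k S f = sqrt (\<Sum>bs\<in>multi_indices k. (L2_norm S (weak_deriv S bs f))\<^sup>2)"

definition weak_laplacian :: "'a::euclidean_space set \<Rightarrow> ('a \<Rightarrow> real) \<Rightarrow> 'a \<Rightarrow> real" where
  "weak_laplacian S f x = (\<Sum>b\<in>Basis. weak_deriv S [b, b] f x)"

definition weak_bilaplacian :: "'a::euclidean_space set \<Rightarrow> ('a \<Rightarrow> real) \<Rightarrow> 'a \<Rightarrow> real" where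
  "weak_bilaplacian S f x = (\<Sum>b\<in>Basis. \<Sum>c\<in>Basis. weak_deriv S [b, b, c, c] f x)"


section \<open>Traces on the unit sphere\<close>

text \<open>Surface measure: \<open>\<sigma>(A) = d \<cdot> |{r x. x \<in> A, 0 < r < 1}|\<close>. In dimension one this is the counting
  measure on \<open>{-1, 1}\<close>.\<close>

definition sphere_measure :: "'a::euclidean_space measure" where
  "sphere_measure = scale_measure (of_nat DIM('a)) (distr (lebesgue_on (ball 0 1)) borel sgn)"

text \<open>The trace operator is the continuous extension of the restriction \<open>f \<mapsto> f|\<^sub>\<partial>\<^sub>B\<close> from smooth
  functions to \<open>H\<^sup>1\<close>, with values in \<open>L\<^sub>2\<close> of the sphere.\<close>

definition has_trace :: "('a::euclidean_space \<Rightarrow> real) \<Rightarrow> ('a \<Rightarrow> real) \<Rightarrow> bool" where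
  "has_trace f g \<longleftrightarrow>
     f \<in> sobolev 1 (ball 0 1) \<and>
     g \<in> borel_measurable sphere_measure \<and> integrable sphere_measure (\<lambda>x. (g x)\<^sup>2) \<and>
     (\<exists>\<phi>. (\<forall>n. smooth (\<phi> n)) \<and>
        (\<lambda>n. sobolev_norm 1 (ball 0 1) (\<lambda>x. \<phi> n x - f x)) \<longlonglongrightarrow> 0 \<and>
        (\<lambda>n. LINT x|sphere_measure. (\<phi> n x - g x)\<^sup>2) \<longlonglongrightarrow> 0)"

text \<open>\<open>v = \<partial>\<^sub>\<nu>v = 0\<close> on the boundary of the unit ball, where \<open>\<nu>(x) = x\<close>, for \<open>v \<in> H\<^sup>2\<close>.\<close>

definition clamped :: "('a::euclidean_space \<Rightarrow> real) \<Rightarrow> bool" where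
  "clamped v \<longleftrightarrow>
     has_trace v (\<lambda>x. 0) \<and>
     (\<exists>g. (\<forall>b\<in>Basis. has_trace (weak_deriv (ball 0 1) [b] v) (g b)) \<and>
          (AE x in sphere_measure. (\<Sum>b\<in>Basis. (x \<bullet> b) * g b x) = 0))"


section \<open>Functions of time with values in \<open>H\<^sup>k\<close> of the unit ball\<close>

text \<open>Note that \<open>H\<^sup>0 = L\<^sub>2\<close>.\<close>

definition cont_in_sobolev ::
    "real set \<Rightarrow> nat \<Rightarrow> (real \<Rightarrow> 'a::euclidean_space \<Rightarrow> real) \<Rightarrow> bool" where
  "cont_in_sobolev I k u \<longleftrightarrow>
     (\<forall>t\<in>I. u t \<in> sobolev k (ball 0 1)) \<and>
     (\<forall>t\<in>I. ((\<lambda>s. sobolev_norm k (ball 0 1) (\<lambda>x. u s x - u t x)) \<longlongrightarrow> 0) (at t within I))"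

text \<open>\<open>u \<in> C\<^sup>1(I; L\<^sub>2)\<close> with time derivative \<open>u'\<close>.\<close>

definition C1_in_L2 ::
    "real set \<Rightarrow> (real \<Rightarrow> 'a::euclidean_space \<Rightarrow> real) \<Rightarrow> (real \<Rightarrow> 'a \<Rightarrow> real) \<Rightarrow> bool" where
  "C1_in_L2 I u u' \<longleftrightarrow>
     (\<forall>t\<in>I. u t \<in> L2_space (ball 0 1)) \<and> cont_in_sobolev I 0 u' \<and>
     (\<forall>t\<in>I. ((\<lambda>s. L2_norm (ball 0 1) (\<lambda>x. (u s x - u t x) / (s - t) - u' t x)) \<longlongrightarrow> 0)
        (at t within I))"

text \<open>Bochner integrability on \<open>(0, r)\<close>, i.e. membership in \<open>L\<^sub>1(0, r; H\<^sup>k)\<close>, by approximation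
  with simple functions as in \<^const>\<open>has_bochner_integral\<close>. The latter is not applicable since
  \<open>H\<^sup>k\<close> is not a type here.\<close>

definition bochner_approx ::
    "nat \<Rightarrow> real \<Rightarrow> (real \<Rightarrow> 'a::euclidean_space \<Rightarrow> real) \<Rightarrow> (nat \<Rightarrow> real \<Rightarrow> 'a \<Rightarrow> real) \<Rightarrow> bool" where
  "bochner_approx k r f s \<longleftrightarrow>
     (AE t in lebesgue_on {0<..<r}. f t \<in> sobolev k (ball 0 1)) \<and>
     (\<forall>n. simple_function (lebesgue_on {0<..<r}) (s n) \<and>
          (\<forall>t\<in>{0<..<r}. s n t \<in> sobolev k (ball 0 1)) \<and>
          (\<lambda>t. sobolev_norm k (ball 0 1) (\<lambda>x. f t x - s n t x))
             \<in> borel_measurable (lebesgue_on {0<..<r})) \<and>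
     (\<lambda>n. \<integral>\<^sup>+t. ennreal (sobolev_norm k (ball 0 1) (\<lambda>x. f t x - s n t x))
             \<partial>lebesgue_on {0<..<r}) \<longlonglongrightarrow> 0"

definition L1_in_sobolev ::
    "real \<Rightarrow> nat \<Rightarrow> (real \<Rightarrow> 'a::euclidean_space \<Rightarrow> real) \<Rightarrow> bool" where
  "L1_in_sobolev r k f \<longleftrightarrow> (\<exists>s. bochner_approx k r f s)"

definition has_L2_bochner_integral ::
    "real \<Rightarrow> (real \<Rightarrow> 'a::euclidean_space \<Rightarrow> real) \<Rightarrow> ('a \<Rightarrow> real) \<Rightarrow> bool" where
  "has_L2_bochner_integral r f F \<longleftrightarrow>
     F \<in> L2_space (ball 0 1) \<and>
     (\<exists>s. bochner_approx 0 r f s \<and>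
        (\<lambda>n. L2_norm (ball 0 1)
           (\<lambda>x. (\<Sum>h\<in>s n ` {0<..<r}. measure lebesgue {t \<in> {0<..<r}. s n t = h} * h x) - F x))
          \<longlonglongrightarrow> 0)"

text \<open>\<open>w\<close> is the derivative of \<open>v\<close> in the sense of \<open>L\<^sub>2\<close>-valued distributions on \<open>(0, r)\<close>:
  \<open>\<integral> \<psi>' v dt = - \<integral> \<psi> w dt\<close>.\<close>

definition weak_time_deriv ::
    "real \<Rightarrow> (real \<Rightarrow> 'a::euclidean_space \<Rightarrow> real) \<Rightarrow> (real \<Rightarrow> 'a \<Rightarrow> real) \<Rightarrow> bool" where
  "weak_time_deriv r v w \<longleftrightarrow>
     (\<forall>\<psi>. test_function {0<..<r} \<psi> \<longrightarrow>
        (\<exists>F. has_L2_bochner_integral r (\<lambda>t x. deriv \<psi> t * v t x) F \<and>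
             has_L2_bochner_integral r (\<lambda>t x. - (\<psi> t * w t x)) F))"


section \<open>The evolution problems\<close>

definition time_ivl :: "ereal \<Rightarrow> real set" where
  "time_ivl \<tau> = {t. 0 \<le> t \<and> ereal t < \<tau>}"

text \<open>As \<open>H\<^sup>2\<close> embeds into the continuous functions on the closed ball in dimension at most two,
  \<open>u(t)\<close> is taken to be its continuous representative, which gives a meaning to \<open>u(t) > -1\<close> on the
  closed ball.\<close>

definition above_minus_one :: "real set \<Rightarrow> (real \<Rightarrow> 'a::euclidean_space \<Rightarrow> real) \<Rightarrow> bool" where
  "above_minus_one I u \<longleftrightarrow>
     (\<forall>t\<in>I. continuous_on (cball 0 1) (u t) \<and> (\<forall>x\<in>cball 0 1. u t x > - 1))"

definition hyperbolic_solution ::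
    "real \<Rightarrow> real \<Rightarrow> real \<Rightarrow> real \<Rightarrow> ('a::euclidean_space \<Rightarrow> real) \<Rightarrow> ('a \<Rightarrow> real) \<Rightarrow>
     ereal \<Rightarrow> (real \<Rightarrow> 'a \<Rightarrow> real) \<Rightarrow> bool" where
  "hyperbolic_solution \<gamma> B T lam u0 u1 \<tau> u \<longleftrightarrow>
     0 < \<tau> \<and> above_minus_one (time_ivl \<tau>) u \<and> cont_in_sobolev (time_ivl \<tau>) 2 u \<and>
     (\<exists>ut utt. C1_in_L2 (time_ivl \<tau>) u ut \<and>
        (\<forall>r. 0 < r \<and> ereal r < \<tau> \<longrightarrow>
           L1_in_sobolev r 4 u \<and> L1_in_sobolev r 2 ut \<and> L1_in_sobolev r 0 utt \<and>
           weak_time_deriv r ut utt) \<and>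
        (AE t in lebesgue_on (time_ivl \<tau>). AE x in lebesgue_on (ball 0 1).
           \<gamma>\<^sup>2 * utt t x + ut t x + B * weak_bilaplacian (ball 0 1) (u t) x
             - T * weak_laplacian (ball 0 1) (u t) x = - lam / (1 + u t x)\<^sup>2) \<and>
        (\<forall>t\<in>time_ivl \<tau>. 0 < t \<longrightarrow> clamped (u t)) \<and>
        (AE x in lebesgue_on (ball 0 1). u 0 x = u0 x) \<and>
        (AE x in lebesgue_on (ball 0 1). ut 0 x = u1 x))"

definition parabolic_solution ::
    "real \<Rightarrow> real \<Rightarrow> real \<Rightarrow> ('a::euclidean_space \<Rightarrow> real) \<Rightarrow>
     ereal \<Rightarrow> (real \<Rightarrow> 'a \<Rightarrow> real) \<Rightarrow> bool" where
  "parabolic_solution B T lam u0 \<tau> u \<longleftrightarrow>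
     0 < \<tau> \<and> above_minus_one (time_ivl \<tau>) u \<and> cont_in_sobolev (time_ivl \<tau>) 2 u \<and>
     cont_in_sobolev (time_ivl \<tau> - {0}) 4 u \<and>
     (\<exists>ut. C1_in_L2 (time_ivl \<tau> - {0}) u ut \<and>
        (\<forall>t\<in>time_ivl \<tau> - {0}. AE x in lebesgue_on (ball 0 1).
           ut t x + B * weak_bilaplacian (ball 0 1) (u t) x
             - T * weak_laplacian (ball 0 1) (u t) x = - lam / (1 + u t x)\<^sup>2) \<and>
        (\<forall>t\<in>time_ivl \<tau>. 0 < t \<longrightarrow> clamped (u t)) \<and>
        (AE x in lebesgue_on (ball 0 1). u 0 x = u0 x))"

text \<open>A solution, with respect to a solution concept \<open>sol\<close>, that has no proper extension.\<close>

definition maximal_solution ::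
    "(ereal \<Rightarrow> (real \<Rightarrow> 'a::euclidean_space \<Rightarrow> real) \<Rightarrow> bool) \<Rightarrow>
     ereal \<Rightarrow> (real \<Rightarrow> 'a \<Rightarrow> real) \<Rightarrow> bool" where
  "maximal_solution sol \<tau> u \<longleftrightarrow>
     sol \<tau> u \<and>
     (\<nexists>\<tau>' v. \<tau> < \<tau>' \<and> sol \<tau>' v \<and> (\<forall>t\<in>time_ivl \<tau>. \<forall>x\<in>cball 0 1. v t x = u t x))"


section \<open>The first eigenvalue of the clamped operator\<close>

definition first_eigenpair ::
    "real \<Rightarrow> real \<Rightarrow> real \<Rightarrow> ('a::euclidean_space \<Rightarrow> real) \<Rightarrow> bool" where
  "first_eigenpair B T m \<phi> \<longleftrightarrow>
     0 < m \<and> Ck_closure 4 (ball 0 1) \<phi> \<and>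
     (\<forall>x\<in>ball 0 1. B * bilaplacian \<phi> x - T * laplacian \<phi> x = m * \<phi> x) \<and>
     (\<forall>x\<in>sphere 0 1. \<phi> x = 0 \<and>
        (\<exists>D. (\<phi> has_derivative D) (at x within cball 0 1) \<and> D x = 0)) \<and>
     (\<forall>x\<in>cball 0 1. \<forall>y\<in>cball 0 1. norm x = norm y \<longrightarrow> \<phi> x = \<phi> y) \<and>
     (\<forall>x\<in>ball 0 1. \<phi> x > 0) \<and>
     (LINT x|lebesgue_on (ball 0 1). \<bar>\<phi> x\<bar>) = 1"

end

theory Submission
  imports Defs
begin

text \<open>
  Pair the solution with the first eigenfunction: let \<open>E(t) = \<integral> u(t) \<phi> dx\<close>. Green's formula moves the
  operator from \<open>u\<close> to \<open>\<phi>\<close>, so the equation becomes, with \<open>\<gamma> = 0\<close> in the parabolic case,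
  \<open>\<gamma>\<^sup>2 E'' + E' = - \<integral> (m u + \<lambda> / (1 + u)\<^sup>2) \<phi> dx\<close>.
  The bracket is bounded below by some \<open>c > 0\<close> as soon as \<open>u > - 1\<close>: with \<open>y = 1 + u\<close> its positivity
  reads \<open>\<lambda> > m y\<^sup>2 (1 - y)\<close>, and the right hand side is at most \<open>4 m / 27\<close>, its value at \<open>y = 2 / 3\<close>
  (\<open>touchdown_source_bound\<close>). If \<open>u\<close> existed for all times, \<open>E\<close> would decrease at least linearly in
  the parabolic case, and \<open>\<gamma>\<^sup>2 E' + E + c t\<close> would be nonincreasing in the hyperbolic case; either way
  \<open>E\<close> tends to \<open>- \<infinity>\<close>. But \<open>u > - 1\<close>, \<open>\<phi> \<ge> 0\<close> and \<open>\<integral> \<phi> dx = 1\<close> force \<open>E \<ge> - 1\<close>.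

  Most of the work goes into Green's formula (\<open>integral_weak_laplacian\<close>, \<open>integral_weak_bilaplacian\<close>).
  Weak derivatives are defined by smooth functions of compact support, while \<open>\<phi>\<close> is of class
  \<open>C\<^sup>4\<close> up to the boundary. Two of the four derivatives of \<open>u\<close> are moved to \<open>\<phi>\<close> because \<open>\<phi>\<close> and
  \<open>\<nabla>\<phi>\<close> vanish on the sphere: such a function is a limit of test functions whose gradients stay bounded
  (\<open>weak_partial_integral_by_parts\<close>; the approximation is by cutoff and mollification). The other two
  are moved by means of the boundary conditions of \<open>u\<close>, which are conditions on traces. Here the
  divergence theorem on the ball is applied to the smooth approximations in the definition
  of a trace (\<open>divergence_theorem_ball\<close>, \<open>trace_integral_by_parts\<close>).

  In the hyperbolic case \<open>E''\<close> exists only in the sense of distributions, by way of Bochner integrals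
  in \<open>L\<^sub>2\<close>. Lower bounds for pairings survive Bochner integration (\<open>bochner_integral_pairing_ge\<close>), and
  a continuous function whose distributional derivative is nonpositive is nonincreasing
  (\<open>nonincreasing_if_weakly\<close>).
\<close>

section \<open>Calculus of classical partial derivatives\<close>

lemma partial_at_eq: "(f has_derivative D) (at x) \<Longrightarrow> partial_at b f x = D b"
  unfolding partial_at_def using frechet_derivative_at by metis

lemma differentiable_frechet: "f differentiable (at x) \<Longrightarrow> (f has_derivative frechet_derivative f (at x)) (at x)"
  using frechet_derivative_works by blast

lemma has_derivative_partials:
  fixes f :: "'a::euclidean_space \<Rightarrow> real"
  assumes "f differentiable (at x)"
  shows "(f has_derivative (\<lambda>h. \<Sum>b\<in>Basis. (h \<bullet> b) * partial_at b f x)) (at x)"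
proof -
  let ?D = "frechet_derivative f (at x)"
  have D: "(f has_derivative ?D) (at x)"
    using assms by (rule differentiable_frechet)
  then interpret bounded_linear ?D by (rule has_derivative_bounded_linear)
  have "?D h = (\<Sum>b\<in>Basis. (h \<bullet> b) * partial_at b f x)" for h
  proof -
    have "?D (\<Sum>b\<in>Basis. (h \<bullet> b) *\<^sub>R b) = (\<Sum>b\<in>Basis. (h \<bullet> b) * partial_at b f x)"
      by (simp add: sum scaleR partial_at_def)
    then show ?thesis by (simp add: euclidean_representation)
  qed
  with D show ?thesis by (metis (no_types, lifting) has_derivative_transform UNIV_I ext)
qed

lemma partials_Nil [simp]: "partials [] f = f"
  and partials_Cons: "partials (b # bs) f = partial_at b (partials bs f)"
  and partials_append: "partials (bs @ cs) f = partials bs (partials cs f)"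
  by (simp_all add: partials_def)

lemma partial_at_const [simp]: "partial_at b (\<lambda>x. c) = (\<lambda>x. 0)"
  by (rule ext, rule partial_at_eq) (rule has_derivative_const)

lemma Ck_on_const: "Ck_on k S (\<lambda>x. c)"
  by (induction k arbitrary: c) (auto)

lemma partial_at_add:
  assumes "f differentiable (at x)" "g differentiable (at x)"
  shows "partial_at b (\<lambda>x. f x + g x) x = partial_at b f x + partial_at b g x"
  using assms[THEN differentiable_frechet]
  by (subst partial_at_eq[OF has_derivative_add]) (auto simp: partial_at_def)

lemma partial_at_mult:
  assumes "f differentiable (at x)" "g differentiable (at x)"
  shows "partial_at b (\<lambda>x. f x * g x) x = partial_at b f x * g x + f x * partial_at b g x"
  using assms[THEN differentiable_frechet]
  by (subst partial_at_eq[OF has_derivative_mult]) (auto simp: partial_at_def)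

lemma Ck_on_imp_continuous: "Ck_on k S f \<Longrightarrow> continuous_on S f"
  by (cases k) (auto intro!: continuous_at_imp_continuous_on differentiable_imp_continuous_within)

lemma Ck_on_Suc_imp: "Ck_on (Suc k) S f \<Longrightarrow> Ck_on k S f"
proof (induction k arbitrary: f)
  case 0
  then show ?case using Ck_on_imp_continuous[of "Suc 0"] by simp
qed auto

lemma Ck_on_add:
  "Ck_on k UNIV f \<Longrightarrow> Ck_on k UNIV g \<Longrightarrow> Ck_on k UNIV (\<lambda>x. f x + g x)"
proof (induction k arbitrary: f g)
  case (Suc k)
  then have "partial_at b (\<lambda>x. f x + g x) = (\<lambda>x. partial_at b f x + partial_at b g x)" for b
    by (intro ext partial_at_add) auto
  with Suc show ?case by (auto simp del: UNIV_I intro: UNIV_I)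
qed (auto intro: continuous_intros)

lemma Ck_on_mult:
  "Ck_on k UNIV f \<Longrightarrow> Ck_on k UNIV g \<Longrightarrow> Ck_on k UNIV (\<lambda>x. f x * g x)"
proof (induction k arbitrary: f g)
  case (Suc k)
  then have "partial_at b (\<lambda>x. f x * g x) = (\<lambda>x. partial_at b f x * g x + f x * partial_at b g x)" for b
    by (intro ext partial_at_mult) auto
  moreover have "Ck_on k UNIV f" "Ck_on k UNIV g" using Suc.prems Ck_on_Suc_imp by blast+
  ultimately show ?case using Suc by (auto intro!: Ck_on_add)
qed (auto intro: continuous_intros)

lemma Ck_on_inner: "Ck_on k UNIV (\<lambda>x. x \<bullet> b)"
proof (cases k)
  case (Suc k)
  have "partial_at c (\<lambda>x. x \<bullet> b) = (\<lambda>x. c \<bullet> b)" for c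
    by (rule ext, rule partial_at_eq) (auto intro!: derivative_eq_intros)
  with Suc show ?thesis by (auto simp: Ck_on_const)
qed (auto intro: continuous_intros)

lemma smooth_partial_at: "smooth f \<Longrightarrow> b \<in> Basis \<Longrightarrow> smooth (partial_at b f)"
  unfolding smooth_def by (meson Ck_on.simps(2))

lemma smooth_differentiable: "smooth f \<Longrightarrow> f differentiable (at x)"
  unfolding smooth_def by (meson Ck_on.simps(2) UNIV_I)

lemma smooth_continuous: "smooth f \<Longrightarrow> continuous_on S f"
  unfolding smooth_def by (metis Ck_on_imp_continuous continuous_on_subset top_greatest)

section \<open>A smooth bump\<close>

text \<open>The case \<open>k = 0\<close> is the usual smooth function that is flat at the origin. The powers of \<open>t\<close> are
  there because the whole family, unlike its first member, is closed under differentiation up to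
  linear combinations.\<close>

definition flat_exp :: "nat \<Rightarrow> real \<Rightarrow> real" where
  "flat_exp k t = (if t > 0 then exp (- 1 / t) / t ^ k else 0)"

lemma flat_exp_tendsto_0: "(flat_exp k \<longlongrightarrow> 0) (at 0)"
proof -
  have "((\<lambda>t::real. inverse t ^ k / exp (inverse t)) \<longlongrightarrow> 0) (at_right 0)"
    by (rule filterlim_compose[OF tendsto_power_div_exp_0 filterlim_inverse_at_top_right])
  then have "(flat_exp k \<longlongrightarrow> 0) (at_right 0)"
    by (rule Lim_transform_eventually, intro eventually_at_rightI[of 0 1])
       (auto simp: flat_exp_def field_simps exp_minus)
  moreover have "(flat_exp k \<longlongrightarrow> 0) (at_left 0)"
    by (rule tendsto_eventually, intro eventually_at_leftI[of "-1" 0]) (auto simp: flat_exp_def)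
  ultimately show ?thesis by (simp add: filterlim_split_at)
qed

lemma has_derivative_flat_exp:
  "(flat_exp k has_real_derivative flat_exp (k + 2) t - real k * flat_exp (k + 1) t) (at t)"
proof (cases t "0::real" rule: linorder_cases)
  case equal
  have "((\<lambda>h. flat_exp k h / h) \<longlongrightarrow> 0) (at 0)"
    by (rule Lim_transform_eventually[OF flat_exp_tendsto_0[of "k+1"]])
       (auto simp: flat_exp_def eventually_at_filter mult.commute)
  then show ?thesis using equal by (simp add: DERIV_def) (simp add: flat_exp_def)
next
  case less
  have "((\<lambda>t. 0) has_real_derivative 0) (at t)" by simp
  then have "(flat_exp k has_real_derivative 0) (at t)"
    by (rule has_field_derivative_transform_within_open[of _ _ _ "{..<0}"])
       (use less in \<open>auto simp: flat_exp_def\<close>)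
  with less show ?thesis by (simp add: flat_exp_def)
next
  case greater
  have "((\<lambda>t. exp (- 1 / t) / t ^ k) has_real_derivative
      exp (- 1 / t) / t ^ (k + 2) - real k * (exp (- 1 / t) / t ^ (k + 1))) (at t)"
    using greater
    by (cases "k = 0")
       (auto intro!: derivative_eq_intros simp: field_simps power2_eq_square power_eq_if[of t k])
  then have "(flat_exp k has_real_derivative
      exp (- 1 / t) / t ^ (k + 2) - real k * (exp (- 1 / t) / t ^ (k + 1))) (at t)"
    by (rule has_field_derivative_transform_within_open[of _ _ _ "{0<..}"])
       (use greater in \<open>auto simp: flat_exp_def\<close>)
  with greater show ?thesis by (simp add: flat_exp_def)
qed

lemma continuous_flat_exp: "continuous_on S (flat_exp k)"
  using has_derivative_flat_exp DERIV_isCont continuous_at_imp_continuous_on by blast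

text \<open>By the chain rule the partial derivatives of \<open>flat_exp k (c - |x|\<^sup>2)\<close> are again built from members of
  the family and linear functions, so the induction over the order has to treat all \<open>k\<close> at once.\<close>

lemma smooth_flat_exp_bump: "smooth (\<lambda>x::'a::euclidean_space. flat_exp 0 (c - x \<bullet> x))"
proof -
  have "Ck_on n UNIV (\<lambda>x::'a. flat_exp k (c - x \<bullet> x))" for n k
  proof (induction n arbitrary: k)
    case 0
    show ?case
      by (auto intro!: continuous_intros continuous_on_compose2[OF continuous_flat_exp[of UNIV k]])
  next
    case (Suc n)
    have D: "((\<lambda>x::'a. flat_exp k (c - x \<bullet> x)) has_derivative
        (\<lambda>h. (flat_exp (k + 2) (c - x \<bullet> x) - real k * flat_exp (k + 1) (c - x \<bullet> x)) * (- 2 * (x \<bullet> h)))) (at x)" for x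
      by (rule has_derivative_eq_rhs, rule has_derivative_compose[where f="\<lambda>x. c - x \<bullet> x"],
          (auto intro!: derivative_eq_intros)[1],
          rule has_derivative_flat_exp[unfolded has_field_derivative_def])
         (auto simp: inner_commute)
    have "partial_at b (\<lambda>x::'a. flat_exp k (c - x \<bullet> x)) =
        (\<lambda>x. (flat_exp (k + 2) (c - x \<bullet> x) + - real k * flat_exp (k + 1) (c - x \<bullet> x)) * (- 2 * (x \<bullet> b)))" for b
      by (rule ext) (simp add: partial_at_eq[OF D])
    moreover have "Ck_on n UNIV (\<lambda>x::'a. (flat_exp (k + 2) (c - x \<bullet> x)
        + - real k * flat_exp (k + 1) (c - x \<bullet> x)) * (- 2 * (x \<bullet> b)))" for b
      by (intro Ck_on_mult Ck_on_add Ck_on_const Ck_on_inner Suc)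
    ultimately have "\<forall>b\<in>Basis. Ck_on n UNIV (partial_at b (\<lambda>x::'a. flat_exp k (c - x \<bullet> x)))"
      by (simp only:) blast
    moreover have "\<forall>x\<in>UNIV. (\<lambda>x::'a. flat_exp k (c - x \<bullet> x)) differentiable (at x)"
      using D unfolding differentiable_def by blast
    ultimately show ?case unfolding Ck_on.simps by (rule conjI[rotated])
  qed
  then show ?thesis by (simp add: smooth_def)
qed

section \<open>Convolution with a smooth kernel\<close>

text \<open>The integral is over a compact box, so differentiation under the integral sign only asks for a
  jointly continuous derivative. All derivatives fall on the kernel; \<open>f\<close> is merely continuous.\<close>

lemma has_derivative_convolution:
  fixes K :: "'a::euclidean_space \<Rightarrow> real"
  assumes K: "Ck_on 1 UNIV K" and f: "continuous_on (cbox p q) f"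
  shows "((\<lambda>x. integral (cbox p q) (\<lambda>y. f y * K (x - y))) has_derivative
      (\<lambda>h. \<Sum>b\<in>Basis. (h \<bullet> b) * integral (cbox p q) (\<lambda>y. f y * partial_at b K (x - y)))) (at x)"
proof -
  have cont: "continuous_on S (\<lambda>z. partial_at b K (g z))" if "b \<in> Basis" "continuous_on S g" for b S and g :: "'c::topological_space \<Rightarrow> 'a"
    using K that by (intro continuous_on_compose2[of UNIV "partial_at b K" S g]) auto
  have contK: "continuous_on S (\<lambda>z. K (g z))" if "continuous_on S g" for S and g :: "'c::topological_space \<Rightarrow> 'a"
    using that by (intro continuous_on_compose2[OF Ck_on_imp_continuous[OF K] that]) auto
  have D: "(K has_derivative (\<lambda>h. \<Sum>b\<in>Basis. (h \<bullet> b) * partial_at b K x)) (at x)" for x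
    using K by (intro has_derivative_partials) auto
  define F where "F x y = (\<Sum>b\<in>Basis. (f y * partial_at b K (x - y)) *\<^sub>R blinfun_inner_left b)" for x y
  have F: "blinfun_apply (F x y) h = f y * (\<Sum>b\<in>Basis. (h \<bullet> b) * partial_at b K (x - y))" for x y h
    by (simp add: F_def blinfun.sum_left blinfun.scaleR_left sum_distrib_left algebra_simps)
  have cF: "continuous_on (UNIV \<times> cbox p q) (\<lambda>(x, y). F x y)"
    unfolding F_def split_def
    by (intro continuous_intros cont continuous_on_compose2[OF f]) auto
  have "((\<lambda>x. integral (cbox p q) (\<lambda>y. f y * K (x - y))) has_derivative integral (cbox p q) (F x)) (at x)"
  proof (rule leibniz_rule[where U=UNIV, OF _ _ cF])
    fix x t assume "t \<in> cbox p q"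
    show "((\<lambda>x. f t * K (x - t)) has_derivative blinfun_apply (F x t)) (at x)"
      unfolding F
      by (rule has_derivative_mult_right, rule has_derivative_compose[of "\<lambda>x. x - t" "\<lambda>h. h" _ _ K, simplified])
         (auto intro!: derivative_eq_intros D)
  next
    fix x
    show "(\<lambda>y. f y * K (x - y)) integrable_on cbox p q"
      by (intro integrable_continuous continuous_intros f contK)
  qed auto
  moreover have "blinfun_apply (integral (cbox p q) (F x)) h =
      (\<Sum>b\<in>Basis. (h \<bullet> b) * integral (cbox p q) (\<lambda>y. f y * partial_at b K (x - y)))" for h
  proof -
    have i: "(\<lambda>y. f y * partial_at b K (x - y)) integrable_on cbox p q" if "b \<in> Basis" for b
      by (intro integrable_continuous continuous_intros f cont that)
    have "F x integrable_on cbox p q"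
    proof (rule integrable_continuous)
      show "continuous_on (cbox p q) (F x)"
        unfolding F_def by (intro continuous_intros cont f) auto
    qed
    then have "blinfun_apply (integral (cbox p q) (F x)) h = integral (cbox p q) (\<lambda>y. blinfun_apply (F x y) h)"
      by (rule blinfun_apply_integral)
    also have "\<dots> = integral (cbox p q) (\<lambda>y. \<Sum>b\<in>Basis. (h \<bullet> b) * (f y * partial_at b K (x - y)))"
      by (simp add: F sum_distrib_left algebra_simps)
    also have "\<dots> = (\<Sum>b\<in>Basis. (h \<bullet> b) * integral (cbox p q) (\<lambda>y. f y * partial_at b K (x - y)))"
      by (subst integral_sum) (auto intro!: integrable_on_mult_right i)
    finally show ?thesis .
  qed
  ultimately show ?thesis by (metis (no_types, lifting) has_derivative_transform UNIV_I ext)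
qed

lemma partial_at_convolution:
  assumes "Ck_on 1 UNIV K" "continuous_on (cbox p q) f" "b \<in> Basis"
  shows "partial_at b (\<lambda>x. integral (cbox p q) (\<lambda>y. f y * K (x - y))) =
    (\<lambda>x. integral (cbox p q) (\<lambda>y. f y * partial_at b K (x - y)))"
proof
  fix x
  have "(\<Sum>c\<in>Basis. (b \<bullet> c) * g c) = g b" for g :: "'a \<Rightarrow> real"
    using assms(3) by (simp add: inner_Basis if_distrib[of "\<lambda>x. x * _"] cong: if_cong)
  then show "partial_at b (\<lambda>x. integral (cbox p q) (\<lambda>y. f y * K (x - y))) x =
      integral (cbox p q) (\<lambda>y. f y * partial_at b K (x - y))"
    by (simp add: partial_at_eq[OF has_derivative_convolution[OF assms(1,2)]])
qed

lemma smooth_convolution: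
  assumes "smooth K" "continuous_on (cbox p q) f"
  shows "smooth (\<lambda>x. integral (cbox p q) (\<lambda>y. f y * K (x - y)))"
proof -
  have "Ck_on k UNIV (\<lambda>x. integral (cbox p q) (\<lambda>y. f y * K (x - y)))" for k
    using assms(1)
  proof (induction k arbitrary: K)
    case 0
    then have "Ck_on 1 UNIV K" by (simp add: smooth_def)
    from has_derivative_convolution[OF this assms(2)] show ?case
      unfolding Ck_on.simps by (blast intro: has_derivative_continuous continuous_at_imp_continuous_on)
  next
    case (Suc k)
    then have K: "Ck_on 1 UNIV K" by (simp add: smooth_def)
    show ?case
      using has_derivative_convolution[OF K assms(2)] Suc.IH[OF smooth_partial_at[OF Suc.prems]]
      by (auto simp: partial_at_convolution[OF K assms(2)] differentiable_def)
  qed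
  then show ?thesis by (simp add: smooth_def)
qed

section \<open>Mollification\<close>

lemma lborel_integral_affine:
  fixes f :: "'a::euclidean_space \<Rightarrow> real"
  assumes [measurable]: "f \<in> borel_measurable borel" and "c \<noteq> 0"
  shows "(LINT x|lborel. f x) = \<bar>c\<bar> ^ DIM('a) * (LINT x|lborel. f (t + c *\<^sub>R x))"
  by (subst lborel_affine[OF assms(2), of t]) (simp add: integral_density integral_distr)

text \<open>The type argument names the space over which the bump is integrated.\<close>

definition bump_mass :: "'a::euclidean_space itself \<Rightarrow> real \<Rightarrow> real" where
  "bump_mass _ \<epsilon> = (LINT x::'a|lborel. flat_exp 0 (\<epsilon>\<^sup>2 - x \<bullet> x))"

definition mollifier :: "real \<Rightarrow> 'a::euclidean_space \<Rightarrow> real" where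
  "mollifier \<epsilon> x = flat_exp 0 (\<epsilon>\<^sup>2 - x \<bullet> x) / bump_mass TYPE('a) \<epsilon>"

lemma flat_exp_nonneg: "0 \<le> flat_exp k t"
  by (simp add: flat_exp_def)

lemma flat_exp_bump_eq_0: "0 < \<epsilon> \<Longrightarrow> \<epsilon> \<le> norm x \<Longrightarrow> flat_exp 0 (\<epsilon>\<^sup>2 - x \<bullet> x) = 0"
  by (simp add: flat_exp_def dot_square_norm not_less power_mono)

lemma integrable_compact_support:
  fixes f :: "'a::euclidean_space \<Rightarrow> real"
  assumes "continuous_on UNIV f" "compact S" "\<And>x. x \<notin> S \<Longrightarrow> f x = 0"
  shows "integrable lborel f"
proof -
  have "integrable lborel (\<lambda>x. indicator S x *\<^sub>R f x)"
    using assms by (intro borel_integrable_compact) (auto intro: continuous_on_subset)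
  also have "(\<lambda>x. indicator S x *\<^sub>R f x) = f"
    using assms(3) by (auto simp: indicator_def fun_eq_iff)
  finally show ?thesis .
qed

lemma bump_mass_pos:
  assumes "0 < \<epsilon>"
  shows "0 < bump_mass TYPE('a::euclidean_space) \<epsilon>"
proof -
  let ?f = "\<lambda>x::'a. flat_exp 0 (\<epsilon>\<^sup>2 - x \<bullet> x)"
  have i: "integrable lborel ?f"
    using assms
    by (intro integrable_compact_support[of _ "cball 0 \<epsilon>"] smooth_continuous smooth_flat_exp_bump
          flat_exp_bump_eq_0) auto
  have "\<not> (AE x in lborel. ?f x = 0)"
  proof
    assume "AE x in lborel. ?f x = 0"
    then have "AE x in lborel. x \<notin> ball (0::'a) \<epsilon>"
    proof eventually_elim
      case (elim x)
      show ?case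
      proof
        assume "x \<in> ball 0 \<epsilon>"
        then have "norm x ^ 2 < \<epsilon> ^ 2" using assms by (intro power_strict_mono) auto
        with elim show False by (simp add: flat_exp_def dot_square_norm)
      qed
    qed
    then have "emeasure lborel (ball (0::'a) \<epsilon>) = 0"
      using emeasure_eq_0_AE[of "\<lambda>x. x \<in> ball 0 \<epsilon>" lborel] by (simp del: mem_ball mem_ball_0)
    moreover have "emeasure lborel (ball (0::'a) \<epsilon>) = ennreal (measure lborel (ball (0::'a) \<epsilon>))"
      by (rule emeasure_eq_ennreal_measure) (use emeasure_bounded_finite[of "ball (0::'a) \<epsilon>"] in auto)
    ultimately show False using content_ball_pos[OF assms, of "0::'a"] by simp
  qed
  then have "bump_mass TYPE('a) \<epsilon> \<noteq> 0"
    unfolding bump_mass_def using integral_nonneg_eq_0_iff_AE[OF i] by (auto simp: flat_exp_nonneg)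
  moreover have "bump_mass TYPE('a) \<epsilon> \<ge> 0"
    unfolding bump_mass_def by (intro integral_nonneg_AE) (auto simp: flat_exp_nonneg)
  ultimately show ?thesis by simp
qed

lemma mollifier_nonneg: "0 < \<epsilon> \<Longrightarrow> 0 \<le> mollifier \<epsilon> (x::'a::euclidean_space)"
  using bump_mass_pos[of \<epsilon>, where 'a='a] by (simp add: mollifier_def flat_exp_nonneg)

lemma mollifier_eq_0: "0 < \<epsilon> \<Longrightarrow> \<epsilon> \<le> norm x \<Longrightarrow> mollifier \<epsilon> x = 0"
  by (simp add: mollifier_def flat_exp_bump_eq_0)

lemma smooth_mollifier: "smooth (mollifier \<epsilon> :: 'a::euclidean_space \<Rightarrow> real)"
proof -
  have "mollifier \<epsilon> = (\<lambda>x::'a. flat_exp 0 (\<epsilon>\<^sup>2 - x \<bullet> x) * inverse (bump_mass TYPE('a) \<epsilon>))"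
    by (simp add: mollifier_def fun_eq_iff field_simps)
  with smooth_flat_exp_bump[of "\<epsilon>\<^sup>2", where 'a='a] show ?thesis
    unfolding smooth_def by (simp add: Ck_on_mult Ck_on_const)
qed

lemma continuous_mollifier: "continuous_on S (mollifier \<epsilon>)"
  by (intro smooth_continuous smooth_mollifier)

lemma integrable_mollifier_mult:
  assumes "0 < \<epsilon>" "continuous_on UNIV f"
  shows "integrable lborel (\<lambda>z. f z * mollifier \<epsilon> z)"
  using assms by (intro integrable_compact_support[of _ "cball 0 \<epsilon>"] continuous_intros continuous_mollifier)
     (auto simp: mollifier_eq_0)

lemma integral_mollifier: "0 < \<epsilon> \<Longrightarrow> (LINT x::'a::euclidean_space|lborel. mollifier \<epsilon> x) = 1"
  for \<epsilon> :: real
  using bump_mass_pos[of \<epsilon>, where 'a='a]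
  unfolding mollifier_def by (simp add: bump_mass_def)

definition mollify :: "real \<Rightarrow> ('a::euclidean_space \<Rightarrow> real) \<Rightarrow> 'a \<Rightarrow> real" where
  "mollify \<epsilon> f x = (LINT z|lborel. f (x - z) * mollifier \<epsilon> z)"

text \<open>A mollifier is a probability density supported in a ball of radius \<open>\<epsilon>\<close>, and a mean of values close
  to \<open>c\<close> is close to \<open>c\<close>. All estimates for mollifications are instances of this, applied either to
  values of a function or to its difference quotients.\<close>

lemma mollified_mean_bound:
  fixes f :: "'a::euclidean_space \<Rightarrow> real"
  assumes "0 < \<epsilon>" "continuous_on UNIV f" "\<And>z. norm z < \<epsilon> \<Longrightarrow> \<bar>f z - c\<bar> \<le> e"
  shows "\<bar>(LINT z|lborel. f z * mollifier \<epsilon> z) - c\<bar> \<le> e"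
proof -
  note int = integrable_mollifier_mult[OF assms(1)]
  have "(LINT z|lborel. f z * mollifier \<epsilon> z) - c = (LINT z|lborel. (f z - c) * mollifier \<epsilon> z)"
    using int[OF assms(2)] int[OF continuous_on_const, of c] integral_mollifier[OF assms(1), where 'a='a]
    unfolding left_diff_distrib by (subst Bochner_Integration.integral_diff) auto
  also have "\<bar>\<dots>\<bar> \<le> (LINT z::'a|lborel. e * mollifier \<epsilon> z)"
  proof (rule integral_abs_bound_integral)
    fix z :: 'a show "abs ((f z - c) * mollifier \<epsilon> z) \<le> e * mollifier \<epsilon> z"
      using assms(3)[of z] mollifier_nonneg[OF assms(1), of z]
      by (cases "norm z < \<epsilon>") (auto simp: abs_mult mollifier_eq_0 assms(1) intro: mult_right_mono)
  qed (intro int continuous_intros assms(2))+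
  also have "\<dots> = e" using integral_mollifier[OF assms(1), where 'a='a] by simp
  finally show ?thesis by simp
qed

lemma mollify_bound:
  assumes "0 < \<epsilon>" "continuous_on UNIV f" "\<And>y. dist y x < \<epsilon> \<Longrightarrow> \<bar>f y - c\<bar> \<le> e"
  shows "\<bar>mollify \<epsilon> f x - c\<bar> \<le> e"
  unfolding mollify_def using assms
  by (intro mollified_mean_bound continuous_on_compose2[OF assms(2)] continuous_intros) (auto simp: dist_norm)

text \<open>The definition of \<^const>\<open>mollify\<close> translates \<open>f\<close>, which suits estimates; the form below translates
  the kernel, which gives smoothness.\<close>

lemma mollify_eq_convolution:
  fixes f :: "'a::euclidean_space \<Rightarrow> real"
  assumes "continuous_on UNIV f" "\<And>x. x \<notin> cbox p q \<Longrightarrow> f x = 0"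
  shows "mollify \<epsilon> f x = integral (cbox p q) (\<lambda>y. f y * mollifier \<epsilon> (x - y))"
proof -
  have c: "continuous_on UNIV (\<lambda>y. f y * mollifier \<epsilon> (x - y))"
    by (intro continuous_intros assms continuous_on_compose2[OF continuous_mollifier[of UNIV]]) auto
  have "mollify \<epsilon> f x = (LINT y|lborel. f y * mollifier \<epsilon> (x - y))"
    using lborel_integral_affine[of "\<lambda>y. f y * mollifier \<epsilon> (x - y)" "-1" x] c
    by (simp add: mollify_def borel_measurable_continuous_onI)
  also have "\<dots> = (LINT y:cbox p q|lborel. f y * mollifier \<epsilon> (x - y))"
    unfolding set_lebesgue_integral_def
    by (rule Bochner_Integration.integral_cong) (use assms(2) in \<open>auto simp: indicator_def\<close>)
  also have "\<dots> = integral (cbox p q) (\<lambda>y. f y * mollifier \<epsilon> (x - y))"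
    by (rule set_borel_integral_eq_integral, unfold set_integrable_def)
       (intro borel_integrable_compact continuous_on_subset[OF c] compact_cbox, auto)
  finally show ?thesis .
qed

lemma
  fixes f :: "'a::euclidean_space \<Rightarrow> real"
  assumes f: "continuous_on UNIV f" and s: "\<And>x. r \<le> norm x \<Longrightarrow> f x = 0" and e: "0 < \<epsilon>"
  shows smooth_mollify: "smooth (mollify \<epsilon> f)"
    and mollify_eq_0: "\<And>x. r + \<epsilon> \<le> norm x \<Longrightarrow> mollify \<epsilon> f x = 0"
proof -
  obtain p q where pq: "cball (0::'a) r \<subseteq> cbox p q"
    using bounded_subset_cbox_symmetric[OF bounded_cball[of "0::'a" r]] by blast
  then have "f x = 0" if "x \<notin> cbox p q" for x using s[of x] that by force
  from mollify_eq_convolution[OF f this] have "mollify \<epsilon> f = (\<lambda>x. integral (cbox p q) (\<lambda>y. f y * mollifier \<epsilon> (x - y)))"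
    by blast
  moreover have "continuous_on (cbox p q) f" using f continuous_on_subset by blast
  ultimately show "smooth (mollify \<epsilon> f)" using smooth_convolution[OF smooth_mollifier] by metis
  fix x :: 'a assume x: "r + \<epsilon> \<le> norm x"
  have "\<bar>mollify \<epsilon> f x - 0\<bar> \<le> 0"
  proof (rule mollify_bound[OF e f])
    fix y assume "dist y x < \<epsilon>"
    then have "r \<le> norm y" using x norm_triangle_ineq2[of x y] by (simp add: dist_norm norm_minus_commute)
    then show "\<bar>f y - 0\<bar> \<le> 0" using s by simp
  qed
  then show "mollify \<epsilon> f x = 0" by simp
qed

lemma has_derivative_along_line:
  assumes "f differentiable (at (y + t *\<^sub>R b))"
  shows "((\<lambda>t. f (y + t *\<^sub>R b)) has_real_derivative partial_at b f (y + t *\<^sub>R b)) (at t)"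
proof -
  have D: "(f has_derivative frechet_derivative f (at (y + t *\<^sub>R b))) (at (y + t *\<^sub>R b))"
    using assms by (rule differentiable_frechet)
  then interpret bounded_linear "frechet_derivative f (at (y + t *\<^sub>R b))" by (rule has_derivative_bounded_linear)
  have "((\<lambda>t. y + t *\<^sub>R b) has_derivative (\<lambda>h. h *\<^sub>R b)) (at t)"
    by (auto intro!: derivative_eq_intros)
  from has_derivative_compose[OF this D]
  have "((\<lambda>t. f (y + t *\<^sub>R b)) has_derivative (\<lambda>h. h * partial_at b f (y + t *\<^sub>R b))) (at t)"
    by (simp add: scaleR partial_at_def)
  then show ?thesis by (simp add: has_field_derivative_def mult_commute_abs)
qed

text \<open>The difference quotients of a mollification are means of the difference quotients of \<open>f\<close>. With
  \<open>a = 0\<close> this turns a Lipschitz constant into a bound on the gradient, and with \<open>a\<close> the derivative at \<open>x\<close>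
  of a function that is \<open>C\<^sup>1\<close> near \<open>x\<close> it gives convergence of derivatives.\<close>

lemma partial_at_mollify_bound:
  fixes f :: "'a::euclidean_space \<Rightarrow> real"
  assumes f: "continuous_on UNIV f" and s: "\<And>x. r \<le> norm x \<Longrightarrow> f x = 0" and e: "0 < \<epsilon>"
    and d: "0 < d"
    and B: "\<And>y h. dist y x < \<epsilon> \<Longrightarrow> \<bar>h\<bar> < d \<Longrightarrow> \<bar>f (y + h *\<^sub>R b) - f y - h * a\<bar> \<le> C * \<bar>h\<bar>"
  shows "\<bar>partial_at b (mollify \<epsilon> f) x - a\<bar> \<le> C"
proof -
  let ?m = "mollify \<epsilon> f"
  have "?m differentiable (at x)" using smooth_mollify[OF f s e] smooth_differentiable by blast
  then have "((\<lambda>h. ?m (x + h *\<^sub>R b)) has_real_derivative partial_at b ?m x) (at 0)"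
    using has_derivative_along_line[of ?m x 0 b] by simp
  then have lim: "((\<lambda>h. \<bar>(?m (x + h *\<^sub>R b) - ?m x) / h - a\<bar>) \<longlongrightarrow> \<bar>partial_at b ?m x - a\<bar>) (at 0)"
    by (intro tendsto_intros) (simp add: DERIV_def)
  show ?thesis
  proof (rule tendsto_upperbound[OF lim])
    have "\<bar>(?m (x + h *\<^sub>R b) - ?m x) / h - a\<bar> \<le> C" if h: "h \<noteq> 0" "\<bar>h\<bar> < d" for h
    proof -
      have c: "continuous_on UNIV (\<lambda>z. f (y - z))" for y
        by (intro continuous_on_compose2[OF f] continuous_intros) auto
      have "?m (x + h *\<^sub>R b) - ?m x = (LINT z|lborel. (f (x + h *\<^sub>R b - z) - f (x - z)) * mollifier \<epsilon> z)"
        unfolding mollify_def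
        by (simp add: left_diff_distrib integrable_mollifier_mult[OF e c])
      also have "\<bar>\<dots> - h * a\<bar> \<le> C * \<bar>h\<bar>"
      proof (rule mollified_mean_bound[OF e])
        fix z :: 'a assume "norm z < \<epsilon>"
        then show "\<bar>f (x + h *\<^sub>R b - z) - f (x - z) - h * a\<bar> \<le> C * \<bar>h\<bar>"
          using B[of "x - z" h] h by (simp add: dist_norm algebra_simps)
      qed (intro continuous_intros c)
      finally have "\<bar>?m (x + h *\<^sub>R b) - ?m x - h * a\<bar> / \<bar>h\<bar> \<le> C" using h by (simp add: field_simps)
      also have "\<bar>?m (x + h *\<^sub>R b) - ?m x - h * a\<bar> / \<bar>h\<bar> = \<bar>(?m (x + h *\<^sub>R b) - ?m x) / h - a\<bar>"
      proof -
        have "(?m (x + h *\<^sub>R b) - ?m x) / h - a = (?m (x + h *\<^sub>R b) - ?m x - h * a) / h"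
          using h by (simp add: field_simps)
        then show ?thesis by simp
      qed
      finally show ?thesis .
    qed
    then show "\<forall>\<^sub>F h in at 0. \<bar>(?m (x + h *\<^sub>R b) - ?m x) / h - a\<bar> \<le> C"
      unfolding eventually_at using d by (auto intro!: exI[of _ d])
  qed simp
qed

section \<open>Approximation by test functions of the unit ball\<close>

text \<open>Piecewise linear in \<open>|x|\<close>: equal to 1 up to radius \<open>1 - 2 \<delta>\<close> and 0 from radius \<open>1 - \<delta>\<close> on.\<close>

definition cutoff :: "real \<Rightarrow> 'a::euclidean_space \<Rightarrow> real" where
  "cutoff \<delta> x = max 0 (min 1 ((1 - norm x) / \<delta> - 1))"

lemma cutoff_range: "0 \<le> cutoff \<delta> x" "cutoff \<delta> x \<le> 1" "\<bar>cutoff \<delta> x\<bar> \<le> 1"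
  by (auto simp: cutoff_def)

lemma cutoff_eq_0: "0 < \<delta> \<Longrightarrow> 1 - \<delta> \<le> norm x \<Longrightarrow> cutoff \<delta> x = 0"
  by (auto simp: cutoff_def field_simps)

lemma cutoff_eq_1: "0 < \<delta> \<Longrightarrow> norm x \<le> 1 - 2 * \<delta> \<Longrightarrow> cutoff \<delta> x = 1"
  by (auto simp: cutoff_def field_simps)

lemma cutoff_lipschitz:
  assumes "0 < \<delta>" shows "\<bar>cutoff \<delta> x - cutoff \<delta> y\<bar> \<le> norm (x - y) / \<delta>"
proof -
  have "\<bar>cutoff \<delta> x - cutoff \<delta> y\<bar> \<le> \<bar>(1 - norm x) / \<delta> - (1 - norm y) / \<delta>\<bar>"
    by (auto simp: cutoff_def)
  also have "\<dots> = \<bar>norm y - norm x\<bar> / \<delta>"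
    using assms unfolding diff_divide_distrib[symmetric] abs_divide by simp
  also have "\<dots> \<le> norm (x - y) / \<delta>"
    using assms norm_triangle_ineq3[of y x] by (intro divide_right_mono) (auto simp: norm_minus_commute)
  finally show ?thesis .
qed

text \<open>Beyond the closed ball nothing is known about \<open>g\<close>. There the cutoff vanishes, and \<open>g\<close> may be replaced
  by its composition with the radial retraction onto the ball.\<close>

lemma continuous_cutoff_mult:
  assumes "continuous_on (cball 0 1) g" "0 < \<delta>"
  shows "continuous_on UNIV (\<lambda>x::'a::euclidean_space. g x * cutoff \<delta> x)"
proof -
  have "continuous_on UNIV (\<lambda>x. g (x /\<^sub>R max 1 (norm x)) * cutoff \<delta> x)"
    unfolding cutoff_def using assms(2)
    by (intro continuous_intros continuous_on_compose2[OF assms(1)]) (auto simp: field_simps max_def)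
  also have "(\<lambda>x. g (x /\<^sub>R max 1 (norm x)) * cutoff \<delta> x) = (\<lambda>x. g x * cutoff \<delta> x)"
  proof
    fix x :: 'a
    show "g (x /\<^sub>R max 1 (norm x)) * cutoff \<delta> x = g x * cutoff \<delta> x"
      using assms(2) cutoff_eq_0[of \<delta> x] by (cases "norm x \<le> 1") (auto simp: max_def)
  qed
  finally show ?thesis .
qed

text \<open>The radius of the mollifier is half of the margin that the cutoff leaves, so that the support
  stays in the open ball.\<close>

definition test_approx :: "('a::euclidean_space \<Rightarrow> real) \<Rightarrow> nat \<Rightarrow> 'a \<Rightarrow> real" where
  "test_approx g n = mollify (inverse (real (n + 4)) / 2) (\<lambda>x. g x * cutoff (inverse (real (n + 4))) x)"

lemma test_function_test_approx:
  fixes g :: "'a::euclidean_space \<Rightarrow> real"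
  assumes g: "continuous_on (cball 0 1) g"
  shows "test_function (ball 0 1) (test_approx g n)"
proof -
  define \<delta> where "\<delta> = inverse (real (n + 4))"
  have d: "0 < \<delta>" "0 < \<delta> / 2" by (simp_all add: \<delta>_def)
  have s: "1 - \<delta> \<le> norm x \<Longrightarrow> g x * cutoff \<delta> x = 0" for x using cutoff_eq_0[OF d(1), of x] by simp
  note c = continuous_cutoff_mult[OF g d(1)]
  have "{x. test_approx g n x \<noteq> 0} \<subseteq> cball 0 (1 - \<delta> / 2)"
    using mollify_eq_0[OF c s d(2)] unfolding test_approx_def \<delta>_def[symmetric] by force
  then have "closure {x. test_approx g n x \<noteq> 0} \<subseteq> cball 0 (1 - \<delta> / 2)"
    by (intro closure_minimal) auto
  moreover have "cball 0 (1 - \<delta> / 2) \<subseteq> ball (0::'a) 1" using d by auto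
  moreover have "smooth (test_approx g n)" unfolding test_approx_def \<delta>_def[symmetric] by (rule smooth_mollify[OF c s d(2)])
  ultimately show ?thesis unfolding test_function_def
    by (meson bounded_cball bounded_subset closed_closure compact_eq_bounded_closed subset_trans)
qed

lemma test_approx_bounded:
  fixes g :: "'a::euclidean_space \<Rightarrow> real"
  assumes g: "continuous_on (cball 0 1) g" and M: "\<And>x. x \<in> cball 0 1 \<Longrightarrow> \<bar>g x\<bar> \<le> M"
  shows "\<bar>test_approx g n x\<bar> \<le> M"
proof -
  define \<delta> where "\<delta> = inverse (real (n + 4))"
  have d: "0 < \<delta>" "0 < \<delta> / 2" by (simp_all add: \<delta>_def)
  have "0 \<le> M" using M[of 0] by simp
  have "\<bar>g y * cutoff \<delta> y\<bar> \<le> M" for y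
  proof (cases "norm y \<le> 1")
    case True
    then have "\<bar>g y\<bar> * \<bar>cutoff \<delta> y\<bar> \<le> M * 1" using M[of y] cutoff_range(3) \<open>0 \<le> M\<close> by (intro mult_mono) auto
    then show ?thesis by (simp add: abs_mult)
  next
    case False
    then show ?thesis using cutoff_eq_0[OF d(1), of y] d \<open>0 \<le> M\<close> by (simp add: algebra_simps)
  qed
  then show ?thesis
    using mollify_bound[OF d(2) continuous_cutoff_mult[OF g d(1)], of x 0 M] by (simp add: test_approx_def \<delta>_def)
qed

lemma eventually_inverse_nat_less:
  assumes "0 < r" shows "\<forall>\<^sub>F n in sequentially. inverse (real (n + 4)) < r"
proof -
  obtain N where "inverse (real (Suc N)) < r" using reals_Archimedean[OF assms] by blast
  then have "inverse (real (n + 4)) < r" if "n \<ge> N" for n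
    using that by (auto intro: le_less_trans[of _ "inverse (real (Suc N))"] le_imp_inverse_le)
  then show ?thesis unfolding eventually_sequentially by blast
qed

lemma test_approx_tendsto:
  fixes g :: "'a::euclidean_space \<Rightarrow> real"
  assumes g: "continuous_on (cball 0 1) g" and x: "x \<in> ball 0 1"
  shows "(\<lambda>n. test_approx g n x) \<longlonglongrightarrow> g x"
proof (rule tendstoI)
  fix e :: real assume e: "0 < e"
  have "isCont g x" using continuous_on_interior[OF g, of x] x by (simp add: interior_cball)
  then obtain r where r: "0 < r" "\<And>y. dist y x < r \<Longrightarrow> \<bar>g y - g x\<bar> < e / 2"
    using e unfolding continuous_at_eps_delta dist_real_def half_gt_zero_iff[of e, symmetric] by blast
  define s where "s = min r ((1 - norm x) / 3)"
  have "0 < s" using x r by (simp add: s_def)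
  have "dist (test_approx g n x) (g x) < e" if n: "inverse (real (n + 4)) < s" for n
  proof -
    define \<delta> where "\<delta> = inverse (real (n + 4))"
    have d: "0 < \<delta>" "0 < \<delta> / 2" by (simp_all add: \<delta>_def)
    have "\<bar>mollify (\<delta> / 2) (\<lambda>x. g x * cutoff \<delta> x) x - g x\<bar> \<le> e / 2"
    proof (rule mollify_bound[OF d(2) continuous_cutoff_mult[OF g d(1)]])
      fix y assume y: "dist y x < \<delta> / 2"
      have "norm y \<le> norm x + dist y x" using norm_triangle_ineq2[of y x] by (simp add: dist_norm)
      then have "cutoff \<delta> y = 1" using n y d unfolding \<delta>_def[symmetric] by (intro cutoff_eq_1) (auto simp: s_def)
      then show "\<bar>g y * cutoff \<delta> y - g x\<bar> \<le> e / 2" using r(2)[of y] y n d unfolding \<delta>_def[symmetric] by (simp add: s_def)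
    qed
    then show ?thesis using e unfolding test_approx_def \<delta>_def[symmetric] dist_real_def by simp
  qed
  with eventually_inverse_nat_less[OF \<open>0 < s\<close>] show "\<forall>\<^sub>F n in sequentially. dist (test_approx g n x) (g x) < e"
    by (simp add: eventually_mono)
qed

lemma Ck_closure_continuous: "Ck_closure k (ball 0 1) f \<Longrightarrow> continuous_on (cball 0 1) f"
  by (simp add: Ck_closure_def)

lemma Ck_closure_extension:
  assumes "Ck_closure k (ball 0 1) f" "bs \<in> multi_indices k"
  obtains g where "continuous_on (cball 0 1) g" "\<And>x. x \<in> ball 0 1 \<Longrightarrow> g x = partials bs f x"
  using assms unfolding Ck_closure_def by (auto simp: closure_ball)

lemma multi_indices_single [simp]: "b \<in> Basis \<Longrightarrow> [b] \<in> multi_indices (Suc k)"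
  by (simp add: multi_indices_def)

lemma continuous_on_cball_bounded:
  fixes g :: "'a::euclidean_space \<Rightarrow> real"
  assumes "continuous_on (cball 0 1) g"
  obtains M where "0 < M" "\<And>x. x \<in> cball 0 1 \<Longrightarrow> \<bar>g x\<bar> \<le> M"
proof -
  have "bounded (g ` cball 0 1)" using assms by (simp add: compact_continuous_image compact_imp_bounded)
  then show ?thesis using that unfolding bounded_pos by auto
qed

lemma Ck_closure_partial_bounded:
  fixes f :: "'a::euclidean_space \<Rightarrow> real"
  assumes "Ck_closure k (ball 0 1) f" "bs \<in> multi_indices k"
  obtains M where "0 < M" "\<And>x. x \<in> ball 0 1 \<Longrightarrow> \<bar>partials bs f x\<bar> \<le> M"
proof -
  obtain g where g: "continuous_on (cball 0 1) g" "\<And>x. x \<in> ball 0 1 \<Longrightarrow> g x = partials bs f x"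
    using Ck_closure_extension[OF assms] by blast
  obtain M where "0 < M" "\<And>x. x \<in> cball 0 1 \<Longrightarrow> \<bar>g x\<bar> \<le> M"
    using continuous_on_cball_bounded[OF g(1)] by blast
  with g(2) that show ?thesis by (metis ball_subset_cball subsetD)
qed

lemma Ck_closure_lipschitz:
  fixes f :: "'a::euclidean_space \<Rightarrow> real"
  assumes f: "Ck_closure (Suc k) (ball 0 1) f"
  obtains L where "0 < L" "\<And>x y. x \<in> cball 0 1 \<Longrightarrow> y \<in> cball 0 1 \<Longrightarrow> \<bar>f x - f y\<bar> \<le> L * norm (x - y)"
proof -
  have "\<exists>M. 0 < M \<and> (\<forall>x\<in>ball 0 1. \<bar>partial_at b f x\<bar> \<le> M)" if "b \<in> Basis" for b
    using Ck_closure_partial_bounded[OF f multi_indices_single[OF that]] by (metis partials_Cons partials_Nil)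
  then obtain M where M: "\<And>b. b \<in> Basis \<Longrightarrow> 0 < M b"
      "\<And>b x. b \<in> Basis \<Longrightarrow> x \<in> ball 0 1 \<Longrightarrow> \<bar>partial_at b f x\<bar> \<le> M b" by metis
  let ?L = "\<Sum>b\<in>Basis. M b"
  have "0 < ?L" using M(1) by (intro sum_pos) auto
  have "?L-lipschitz_on (ball 0 1) f"
  proof (rule bounded_derivative_imp_lipschitz)
    fix x :: 'a assume x: "x \<in> ball 0 1"
    then have "f differentiable (at x)" using f by (auto simp: Ck_closure_def)
    then show "(f has_derivative (\<lambda>h. \<Sum>b\<in>Basis. (h \<bullet> b) * partial_at b f x)) (at x within ball 0 1)"
      by (rule has_derivative_at_withinI[OF has_derivative_partials])
    show "onorm (\<lambda>h. \<Sum>b\<in>Basis. (h \<bullet> b) * partial_at b f x) \<le> ?L"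
    proof (rule onorm_le)
      fix h :: 'a
      have "norm (\<Sum>b\<in>Basis. (h \<bullet> b) * partial_at b f x) \<le> (\<Sum>b\<in>Basis. norm h * M b)"
        using x by (intro sum_norm_le) (auto simp: abs_mult intro!: mult_mono M Basis_le_norm)
      then show "norm (\<Sum>b\<in>Basis. (h \<bullet> b) * partial_at b f x) \<le> ?L * norm h"
        unfolding sum_distrib_left[symmetric] by (simp only: mult.commute)
    qed
  qed (use \<open>0 < ?L\<close> in auto)
  then have "?L-lipschitz_on (closure (ball 0 1)) f"
    by (rule lipschitz_on_closure) (use f in \<open>auto simp: Ck_closure_def\<close>)
  with \<open>0 < ?L\<close> that show ?thesis by (auto simp: lipschitz_on_def dist_norm closure_ball)
qed

text \<open>Compare with the nearest point of the sphere.\<close>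

lemma lipschitz_vanishing_bound:
  fixes f :: "'a::euclidean_space \<Rightarrow> real"
  assumes L: "\<And>x y. x \<in> cball 0 1 \<Longrightarrow> y \<in> cball 0 1 \<Longrightarrow> \<bar>f x - f y\<bar> \<le> L * norm (x - y)"
    and 0: "\<And>x. x \<in> sphere 0 1 \<Longrightarrow> f x = 0" and x: "x \<in> cball 0 1"
  shows "\<bar>f x\<bar> \<le> L * (1 - norm x)"
proof -
  obtain b :: 'a where b: "b \<in> Basis" using nonempty_Basis by blast
  define w where "w = (if x = 0 then b else x /\<^sub>R norm x)"
  have w: "norm w = 1" using b by (simp add: w_def)
  have "x = norm x *\<^sub>R w" by (auto simp: w_def)
  then have "x - w = (norm x - 1) *\<^sub>R w" by (metis scaleR_left_diff_distrib scaleR_one)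
  then have "norm (x - w) = 1 - norm x" using x w by simp
  then show ?thesis using L[of x w] 0[of w] w x by simp
qed

text \<open>The Lipschitz constant does not depend on \<open>\<delta>\<close>: the cutoff has slope \<open>1 / \<delta>\<close>, but only within
  distance \<open>2 \<delta>\<close> of the sphere, where \<open>f\<close> is at most \<open>2 L \<delta>\<close>.\<close>

lemma lipschitz_cutoff_mult:
  fixes f :: "'a::euclidean_space \<Rightarrow> real"
  assumes L: "0 < L" "\<And>x y. x \<in> cball 0 1 \<Longrightarrow> y \<in> cball 0 1 \<Longrightarrow> \<bar>f x - f y\<bar> \<le> L * norm (x - y)"
    and 0: "\<And>x. x \<in> sphere 0 1 \<Longrightarrow> f x = 0" and d: "0 < \<delta>"
  shows "\<bar>f x * cutoff \<delta> x - f y * cutoff \<delta> y\<bar> \<le> 3 * L * norm (x - y)"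
proof -
  have bd: "\<bar>f x\<bar> \<le> L * (1 - norm x)" if "x \<in> cball 0 1" for x
    using lipschitz_vanishing_bound[OF L(2) 0 that] by blast
  have *: "\<bar>f x * cutoff \<delta> x - f y * cutoff \<delta> y\<bar> \<le> 3 * L * norm (x - y)" if le: "norm x \<le> norm y" for x y
  proof -
    consider "norm x \<ge> 1" | "norm x < 1" "norm y \<ge> 1" | "norm x < 1" "norm y < 1" "norm y \<ge> 1 - 2 * \<delta>"
      | "norm x < 1" "norm y < 1" "norm y \<le> 1 - 2 * \<delta>" by linarith
    then show ?thesis
    proof cases
      case 1
      then show ?thesis using le cutoff_eq_0[OF d, of x] cutoff_eq_0[OF d, of y] d L(1) by simp
    next
      case 2
      then have "\<bar>f x * cutoff \<delta> x - f y * cutoff \<delta> y\<bar> = \<bar>f x\<bar> * \<bar>cutoff \<delta> x\<bar>"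
        using cutoff_eq_0[OF d, of y] d by (simp add: abs_mult)
      also have "\<dots> \<le> (L * (1 - norm x)) * 1"
        using 2 L(1) by (intro mult_mono bd cutoff_range) auto
      also have "\<dots> \<le> L * norm (x - y)"
        using 2 L(1) norm_triangle_ineq2[of y x] by (simp add: norm_minus_commute)
      also have "\<dots> \<le> 3 * L * norm (x - y)" using L(1) by simp
      finally show ?thesis .
    next
      case 3
      have "f x * cutoff \<delta> x - f y * cutoff \<delta> y = (f x - f y) * cutoff \<delta> x + f y * (cutoff \<delta> x - cutoff \<delta> y)"
        by (simp add: algebra_simps)
      also have "\<bar>\<dots>\<bar> \<le> \<bar>f x - f y\<bar> * \<bar>cutoff \<delta> x\<bar> + \<bar>f y\<bar> * \<bar>cutoff \<delta> x - cutoff \<delta> y\<bar>"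
        unfolding abs_mult[symmetric] by (rule abs_triangle_ineq)
      also have "\<dots> \<le> (L * norm (x - y)) * 1 + (L * (2 * \<delta>)) * (norm (x - y) / \<delta>)"
      proof (intro add_mono mult_mono cutoff_range cutoff_lipschitz d)
        have "\<bar>f y\<bar> \<le> L * (1 - norm y)" using 3 by (intro bd) auto
        also have "\<dots> \<le> L * (2 * \<delta>)" using 3 L(1) by (intro mult_left_mono) auto
        finally show "\<bar>f y\<bar> \<le> L * (2 * \<delta>)" .
      qed (use 3 L d in auto)
      also have "\<dots> = 3 * L * norm (x - y)" using d by (simp add: field_simps)
      finally show ?thesis .
    next
      case 4
      then have "\<bar>f x * cutoff \<delta> x - f y * cutoff \<delta> y\<bar> \<le> L * norm (x - y)"
        using le cutoff_eq_1[OF d, of x] cutoff_eq_1[OF d, of y] L(2)[of x y] by simp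
      also have "\<dots> \<le> 3 * L * norm (x - y)" using L(1) by simp
      finally show ?thesis .
    qed
  qed
  show ?thesis using *[of x y] *[of y x] by (cases "norm x \<le> norm y") (auto simp: abs_minus_commute norm_minus_commute)
qed

text \<open>Together with the next lemma this allows dominated convergence for the gradients of the
  approximations. The uniform bound relies on \<open>f\<close> vanishing on the sphere.\<close>

lemma test_approx_partial_bounded:
  fixes f :: "'a::euclidean_space \<Rightarrow> real"
  assumes f: "Ck_closure (Suc k) (ball 0 1) f" and 0: "\<And>x. x \<in> sphere 0 1 \<Longrightarrow> f x = 0"
  obtains M where "\<And>n b x. b \<in> Basis \<Longrightarrow> \<bar>partial_at b (test_approx f n) x\<bar> \<le> M"
proof -
  obtain L where L: "0 < L" "\<And>x y. x \<in> cball 0 1 \<Longrightarrow> y \<in> cball 0 1 \<Longrightarrow> \<bar>f x - f y\<bar> \<le> L * norm (x - y)"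
    using Ck_closure_lipschitz[OF f] by blast
  have "\<bar>partial_at b (test_approx f n) x\<bar> \<le> 3 * L" if b: "b \<in> Basis" for n b x
  proof -
    define \<delta> where "\<delta> = inverse (real (n + 4))"
    have d: "0 < \<delta>" "0 < \<delta> / 2" by (simp_all add: \<delta>_def)
    have "\<bar>partial_at b (mollify (\<delta> / 2) (\<lambda>x. f x * cutoff \<delta> x)) x - 0\<bar> \<le> 3 * L"
    proof (rule partial_at_mollify_bound[OF continuous_cutoff_mult[OF Ck_closure_continuous[OF f] d(1)] _ d(2), of "1 - \<delta>" 1])
      fix y h
      show "\<bar>f (y + h *\<^sub>R b) * cutoff \<delta> (y + h *\<^sub>R b) - f y * cutoff \<delta> y - h * 0\<bar> \<le> 3 * L * \<bar>h\<bar>"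
        using lipschitz_cutoff_mult[OF L 0 d(1), of "y + h *\<^sub>R b" y] b by simp
    qed (use cutoff_eq_0[OF d(1)] in auto)
    then show ?thesis by (simp add: test_approx_def \<delta>_def)
  qed
  with that show ?thesis by blast
qed

lemma test_approx_partial_tendsto:
  fixes f :: "'a::euclidean_space \<Rightarrow> real"
  assumes f: "Ck_closure (Suc k) (ball 0 1) f" and x: "x \<in> ball 0 1" and b: "b \<in> Basis"
  shows "(\<lambda>n. partial_at b (test_approx f n) x) \<longlonglongrightarrow> partial_at b f x"
proof (rule tendstoI)
  fix e :: real assume e: "0 < e"
  have diff: "f differentiable (at y)" if "y \<in> ball 0 1" for y
    using f that by (auto simp: Ck_closure_def)
  have "continuous_on (ball 0 1) (partial_at b f)"
    using f b by (auto simp: Ck_closure_def intro: Ck_on_imp_continuous[of k])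
  then have "isCont (partial_at b f) x" using x by (simp add: continuous_on_eq_continuous_at)
  then obtain r where r: "0 < r" "\<And>y. dist y x < r \<Longrightarrow> \<bar>partial_at b f y - partial_at b f x\<bar> < e / 2"
    using e unfolding continuous_at_eps_delta dist_real_def half_gt_zero_iff[of e, symmetric] by blast
  define s where "s = min (r / 2) ((1 - norm x) / 4)"
  have s: "0 < s" using x r(1) unfolding s_def by simp
  have sr: "s \<le> r / 2" "s \<le> (1 - norm x) / 4" unfolding s_def by (fact min.cobounded1 min.cobounded2)+
  have "dist (partial_at b (test_approx f n) x) (partial_at b f x) < e" if n: "inverse (real (n + 4)) < s" for n
  proof -
    define \<delta> where "\<delta> = inverse (real (n + 4))"
    have d: "0 < \<delta>" "0 < \<delta> / 2" by (simp_all add: \<delta>_def)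
    have "\<bar>partial_at b (mollify (\<delta> / 2) (\<lambda>x. f x * cutoff \<delta> x)) x - partial_at b f x\<bar> \<le> e / 2"
    proof (rule partial_at_mollify_bound[OF continuous_cutoff_mult[OF Ck_closure_continuous[OF f] d(1)] _ d(2) s, of "1 - \<delta>"])
      fix y h assume y: "dist y x < \<delta> / 2" and h: "\<bar>h\<bar> < s"
      have near: "dist (y + t *\<^sub>R b) x < r" "norm (y + t *\<^sub>R b) \<le> 1 - 2 * \<delta>" if "\<bar>t\<bar> \<le> \<bar>h\<bar>" for t
      proof -
        have "dist (y + t *\<^sub>R b) x \<le> dist y x + \<bar>t\<bar>"
          using norm_triangle_ineq[of "y - x" "t *\<^sub>R b"] b by (simp add: dist_norm algebra_simps)
        also have *: "\<dots> < \<delta> / 2 + s" using y h that by simp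
        finally have "dist (y + t *\<^sub>R b) x < \<delta> / 2 + s" .
        moreover have "norm (y + t *\<^sub>R b) \<le> norm x + dist (y + t *\<^sub>R b) x"
          using norm_triangle_ineq2[of "y + t *\<^sub>R b" x] by (simp add: dist_norm)
        moreover note n[folded \<delta>_def] d sr x[unfolded mem_ball_0]
        ultimately show "dist (y + t *\<^sub>R b) x < r" and "norm (y + t *\<^sub>R b) \<le> 1 - 2 * \<delta>"
          by argo+
      qed
      have c1: "cutoff \<delta> (y + t *\<^sub>R b) = 1" if "\<bar>t\<bar> \<le> \<bar>h\<bar>" for t
        using near(2)[OF that] by (rule cutoff_eq_1[OF d(1)])
      have der: "((\<lambda>t. f (y + t *\<^sub>R b) - t * partial_at b f x) has_real_derivative
          partial_at b f (y + t *\<^sub>R b) - partial_at b f x) (at t within {-\<bar>h\<bar>..\<bar>h\<bar>})" if "t \<in> {-\<bar>h\<bar>..\<bar>h\<bar>}" for t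
      proof -
        have "\<bar>t\<bar> \<le> \<bar>h\<bar>" using that by auto
        then have "y + t *\<^sub>R b \<in> ball 0 1" using near(2)[of t] d(1) by simp
        then have "((\<lambda>t. f (y + t *\<^sub>R b)) has_real_derivative partial_at b f (y + t *\<^sub>R b)) (at t)"
          by (intro has_derivative_along_line diff)
        then show ?thesis
          by (auto intro!: derivative_eq_intros intro: has_field_derivative_at_within)
      qed
      have "norm ((f (y + h *\<^sub>R b) - h * partial_at b f x) - (f (y + 0 *\<^sub>R b) - 0 * partial_at b f x)) \<le> e / 2 * norm (h - 0)"
      proof (rule field_differentiable_bound[OF _ der])
        fix t assume "t \<in> {-\<bar>h\<bar>..\<bar>h\<bar>}"
        then have "\<bar>t\<bar> \<le> \<bar>h\<bar>" by auto
        from r(2)[OF near(1)[OF this]] show "norm (partial_at b f (y + t *\<^sub>R b) - partial_at b f x) \<le> e / 2" by simp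
      qed auto
      then show "\<bar>f (y + h *\<^sub>R b) * cutoff \<delta> (y + h *\<^sub>R b) - f y * cutoff \<delta> y - h * partial_at b f x\<bar> \<le> e / 2 * \<bar>h\<bar>"
        using c1[of h] c1[of 0] by (simp add: algebra_simps)
    qed (use cutoff_eq_0[OF d(1)] in auto)
    then show ?thesis using e unfolding test_approx_def \<delta>_def[symmetric] dist_real_def by simp
  qed
  with eventually_inverse_nat_less[OF s] show "\<forall>\<^sub>F n in sequentially. dist (partial_at b (test_approx f n) x) (partial_at b f x) < e"
    by (simp add: eventually_mono)
qed

section \<open>Square integrable functions on the unit ball\<close>

text \<open>The Cauchy-Schwarz inequality against the constant function: with \<open>m = \<integral> |f|\<close> and \<open>\<mu>\<close> the total
  mass, expand \<open>0 \<le> \<integral> (\<mu> |f| - m)\<^sup>2\<close>.\<close>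

lemma integral_abs_square_bound:
  fixes f :: "'a \<Rightarrow> real"
  assumes "finite_measure M" "f \<in> borel_measurable M" "integrable M (\<lambda>x. (f x)\<^sup>2)"
  shows "integrable M f" "(LINT x|M. \<bar>f x\<bar>) \<le> sqrt (measure M (space M)) * sqrt (LINT x|M. (f x)\<^sup>2)"
proof -
  interpret finite_measure M by fact
  have le: "\<bar>f x\<bar> \<le> 1 + (f x)\<^sup>2" for x
    using zero_le_power2[of "\<bar>f x\<bar> - 1"] by (simp add: power2_eq_square algebra_simps)
  show i: "integrable M f"
    by (rule Bochner_Integration.integrable_bound[of M "\<lambda>x. 1 + (f x)\<^sup>2"])
       (use assms le in \<open>auto intro: order_trans[OF le]\<close>)
  define m where "m = (LINT x|M. \<bar>f x\<bar>)"
  define \<mu> where "\<mu> = measure M (space M)"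
  define q where "q = (LINT x|M. (f x)\<^sup>2)"
  have "m\<^sup>2 \<le> \<mu> * q"
  proof (cases "\<mu> = 0")
    case True
    then have "emeasure M (space M) = 0" by (simp add: emeasure_eq_measure \<mu>_def)
    then have "AE x in M. False" by (intro AE_I[of _ _ "space M"]) auto
    then have "m = (LINT x|M. 0)" unfolding m_def using assms(2) by (intro integral_cong_AE) auto
    with True show ?thesis by simp
  next
    case False
    then have pos: "0 < \<mu>" unfolding \<mu>_def using measure_nonneg[of M "space M"] by linarith
    have "0 \<le> (LINT x|M. (\<mu> * \<bar>f x\<bar> - m)\<^sup>2)" by (intro integral_nonneg_AE) auto
    also have "\<dots> = (LINT x|M. \<mu>\<^sup>2 * (f x)\<^sup>2 - (2 * \<mu> * m) * \<bar>f x\<bar> + m\<^sup>2)"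
      by (rule Bochner_Integration.integral_cong) (auto simp: power2_eq_square algebra_simps)
    also have "\<dots> = (LINT x|M. \<mu>\<^sup>2 * (f x)\<^sup>2 - (2 * \<mu> * m) * \<bar>f x\<bar>) + (LINT x|M. m\<^sup>2)"
      by (rule Bochner_Integration.integral_add)
         (intro Bochner_Integration.integrable_diff integrable_mult_right integrable_abs i assms integrable_const)+
    also have "(LINT x|M. \<mu>\<^sup>2 * (f x)\<^sup>2 - (2 * \<mu> * m) * \<bar>f x\<bar>) = \<mu>\<^sup>2 * q - (2 * \<mu> * m) * m"
      unfolding q_def m_def
      by (subst Bochner_Integration.integral_diff) (auto intro!: integrable_mult_right integrable_abs i assms)
    also have "(LINT x|M. m\<^sup>2) = m\<^sup>2 * \<mu>" by (simp add: \<mu>_def)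
    finally have "0 \<le> \<mu> * (\<mu> * q - m\<^sup>2)" by (simp add: power2_eq_square algebra_simps)
    with pos show ?thesis by (simp add: zero_le_mult_iff)
  qed
  then have "m \<le> sqrt (\<mu> * q)" by (rule real_le_rsqrt)
  then show "(LINT x|M. \<bar>f x\<bar>) \<le> sqrt (measure M (space M)) * sqrt (LINT x|M. (f x)\<^sup>2)"
    unfolding m_def \<mu>_def q_def by (simp add: real_sqrt_mult)
qed

lemma finite_measure_lebesgue_on_ball: "finite_measure (lebesgue_on (ball (0::'a::euclidean_space) 1))"
  by (rule finite_measure_lebesgue_on) simp

lemma measurable_continuous_on_cball:
  "continuous_on (cball 0 1) g \<Longrightarrow> g \<in> borel_measurable (lebesgue_on (ball (0::'a::euclidean_space) 1))"
  by (intro continuous_imp_measurable_on_sets_lebesgue)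
     (auto intro: continuous_on_subset ball_subset_cball)

lemma L2_spaceD:
  assumes "f \<in> L2_space S"
  shows "f \<in> borel_measurable (lebesgue_on S)" "integrable (lebesgue_on S) (\<lambda>x. (f x)\<^sup>2)"
  using assms by (auto simp: L2_space_def)

lemma integrable_L2_mult:
  assumes f: "f \<in> L2_space (ball (0::'a::euclidean_space) 1)" and g: "continuous_on (cball 0 1) g"
  shows "integrable (lebesgue_on (ball 0 1)) (\<lambda>x. f x * g x)"
proof -
  obtain M where M: "0 < M" "\<And>x. x \<in> cball 0 1 \<Longrightarrow> \<bar>g x\<bar> \<le> M"
    using continuous_on_cball_bounded[OF g] by blast
  show ?thesis
  proof (rule Bochner_Integration.integrable_bound)
    show "integrable (lebesgue_on (ball 0 1)) (\<lambda>x. M * f x)"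
      using integral_abs_square_bound(1)[OF finite_measure_lebesgue_on_ball L2_spaceD[OF f]] by simp
    show "(\<lambda>x. f x * g x) \<in> borel_measurable (lebesgue_on (ball 0 1))"
      using L2_spaceD(1)[OF f] measurable_continuous_on_cball[OF g] by simp
    show "AE x in lebesgue_on (ball 0 1). norm (f x * g x) \<le> norm (M * f x)"
    proof (rule AE_I2)
      fix x :: 'a assume "x \<in> space (lebesgue_on (ball 0 1))"
      then have "\<bar>g x\<bar> * \<bar>f x\<bar> \<le> M * \<bar>f x\<bar>" using M by (intro mult_right_mono) auto
      then show "norm (f x * g x) \<le> norm (M * f x)" using M(1) by (simp add: abs_mult mult.commute)
    qed
  qed
qed

lemma L2_pairing_bound:
  assumes g: "continuous_on (cball (0::'a::euclidean_space) 1) g"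
  obtains K where "0 \<le> K"
    "\<And>f. f \<in> L2_space (ball 0 1) \<Longrightarrow> \<bar>LINT x|lebesgue_on (ball 0 1). f x * g x\<bar> \<le> K * L2_norm (ball 0 1) f"
proof -
  obtain M where M: "0 < M" "\<And>x. x \<in> cball 0 1 \<Longrightarrow> \<bar>g x\<bar> \<le> M"
    using continuous_on_cball_bounded[OF g] by blast
  let ?L = "lebesgue_on (ball (0::'a) 1)"
  let ?K = "M * sqrt (measure ?L (space ?L))"
  have "\<bar>LINT x|?L. f x * g x\<bar> \<le> ?K * L2_norm (ball 0 1) f" if f: "f \<in> L2_space (ball 0 1)" for f
  proof -
    note b = integral_abs_square_bound[OF finite_measure_lebesgue_on_ball L2_spaceD[OF f]]
    have "\<bar>LINT x|?L. f x * g x\<bar> \<le> (LINT x|?L. M * \<bar>f x\<bar>)"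
    proof (rule integral_abs_bound_integral[OF integrable_L2_mult[OF f g]])
      show "integrable ?L (\<lambda>x. M * \<bar>f x\<bar>)" using b(1) by simp
      fix x assume "x \<in> space ?L"
      then have "\<bar>g x\<bar> * \<bar>f x\<bar> \<le> M * \<bar>f x\<bar>" using M by (intro mult_right_mono) auto
      then show "\<bar>f x * g x\<bar> \<le> M * \<bar>f x\<bar>" by (simp add: abs_mult mult.commute)
    qed
    also have "\<dots> = M * (LINT x|?L. \<bar>f x\<bar>)" by simp
    also have "\<dots> \<le> M * (sqrt (measure ?L (space ?L)) * sqrt (LINT x|?L. (f x)\<^sup>2))"
      using M(1) b(2) by (intro mult_left_mono) auto
    finally show ?thesis by (simp add: L2_norm_def mult.assoc)
  qed
  with M(1) that[of ?K] show ?thesis by (auto intro: mult_nonneg_nonneg)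
qed

lemma L2_space_continuous:
  assumes g: "continuous_on (cball (0::'a::euclidean_space) 1) g"
  shows "g \<in> L2_space (ball 0 1)"
proof -
  obtain M where M: "0 < M" "\<And>x. x \<in> cball 0 1 \<Longrightarrow> \<bar>g x\<bar> \<le> M"
    using continuous_on_cball_bounded[OF g] by blast
  note m = measurable_continuous_on_cball[OF g]
  have "integrable (lebesgue_on (ball 0 1)) (\<lambda>x. (g x)\<^sup>2)"
  proof (rule finite_measure.integrable_const_bound[OF finite_measure_lebesgue_on_ball])
    show "AE x in lebesgue_on (ball 0 1). norm ((g x)\<^sup>2) \<le> M\<^sup>2"
    proof (rule AE_I2)
      fix x :: 'a assume "x \<in> space (lebesgue_on (ball 0 1))"
      then show "norm ((g x)\<^sup>2) \<le> M\<^sup>2" using M(2)[of x] M(1) by (auto simp: abs_le_square_iff[symmetric])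
    qed
  qed (use m in simp)
  with m show ?thesis by (simp add: L2_space_def)
qed

lemma L2_space_lincomb:
  assumes f: "f \<in> L2_space S" and g: "g \<in> L2_space S"
  shows "(\<lambda>x. a * f x + b * g x) \<in> L2_space S"
proof -
  note [measurable] = L2_spaceD(1)[OF f] L2_spaceD(1)[OF g]
  have "integrable (lebesgue_on S) (\<lambda>x. (a * f x + b * g x)\<^sup>2)"
  proof (rule Bochner_Integration.integrable_bound)
    show "integrable (lebesgue_on S) (\<lambda>x. 2 * a\<^sup>2 * (f x)\<^sup>2 + 2 * b\<^sup>2 * (g x)\<^sup>2)"
      by (intro Bochner_Integration.integrable_add integrable_mult_right L2_spaceD f g)
    show "AE x in lebesgue_on S. norm ((a * f x + b * g x)\<^sup>2) \<le> norm (2 * a\<^sup>2 * (f x)\<^sup>2 + 2 * b\<^sup>2 * (g x)\<^sup>2)"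
    proof (rule AE_I2)
      fix x
      have "(a * f x + b * g x)\<^sup>2 \<le> 2 * a\<^sup>2 * (f x)\<^sup>2 + 2 * b\<^sup>2 * (g x)\<^sup>2"
        using zero_le_power2[of "a * f x - b * g x"] by (simp add: power2_eq_square algebra_simps)
      then show "norm ((a * f x + b * g x)\<^sup>2) \<le> norm (2 * a\<^sup>2 * (f x)\<^sup>2 + 2 * b\<^sup>2 * (g x)\<^sup>2)" by simp
    qed
  qed simp
  then show ?thesis by (simp add: L2_space_def)
qed

lemma L2_space_diff: "f \<in> L2_space S \<Longrightarrow> g \<in> L2_space S \<Longrightarrow> (\<lambda>x. f x - g x) \<in> L2_space S"
  using L2_space_lincomb[of f S g 1 "-1"] by simp

lemma L2_space_cmult: "f \<in> L2_space S \<Longrightarrow> (\<lambda>x. c * f x) \<in> L2_space S"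
  using L2_space_lincomb[of f S f c 0] by simp

lemma L2_space_sum:
  "finite I \<Longrightarrow> (\<And>i. i \<in> I \<Longrightarrow> f i \<in> L2_space S) \<Longrightarrow> (\<lambda>x. \<Sum>i\<in>I. f i x) \<in> L2_space S"
proof (induction I rule: finite_induct)
  case empty
  show ?case by (simp add: L2_space_def)
next
  case (insert i I)
  then show ?case using L2_space_lincomb[of "f i" S "\<lambda>x. \<Sum>i\<in>I. f i x" 1 1] by simp
qed

section \<open>Weak derivatives tested against functions that reach the boundary\<close>

lemma test_function_continuous: "test_function S \<theta> \<Longrightarrow> continuous_on X \<theta>"
  by (simp add: test_function_def smooth_continuous)

lemma test_function_partial_at:
  assumes "test_function S \<theta>" "b \<in> Basis"
  shows "test_function S (partial_at b \<theta>)"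
proof -
  have "partial_at b \<theta> x = 0" if "x \<notin> closure {x. \<theta> x \<noteq> 0}" for x
  proof -
    have "((\<lambda>x. 0) has_derivative (\<lambda>h. 0)) (at x)" by (rule has_derivative_const)
    then have "(\<theta> has_derivative (\<lambda>h. 0)) (at x)"
      by (rule has_derivative_transform_within_open[of _ _ _ _ "- closure {x. \<theta> x \<noteq> 0}"])
         (use that closure_subset[of "{x. \<theta> x \<noteq> 0}"] in auto)
    from partial_at_eq[OF this] show ?thesis by simp
  qed
  then have "closure {x. partial_at b \<theta> x \<noteq> 0} \<subseteq> closure {x. \<theta> x \<noteq> 0}"
    by (intro closure_minimal) auto
  with assms show ?thesis unfolding test_function_def
    by (meson bounded_subset closed_closure compact_eq_bounded_closed order_trans smooth_partial_at)
qed

text \<open>Continuous functions on the closed ball are bounded pointwise limits of test functions. Since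
  \<^const>\<open>weak_deriv\<close> is an arbitrary choice among all weak derivatives, this is what makes the pairing
  of a weak derivative with a continuous function independent of that choice.\<close>

lemma weak_integral_eq:
  fixes p q :: "'a::euclidean_space \<Rightarrow> real"
  assumes p: "p \<in> L2_space (ball 0 1)" and q: "q \<in> L2_space (ball 0 1)"
    and t: "\<And>\<theta>. test_function (ball 0 1) \<theta> \<Longrightarrow>
      (LINT x|lebesgue_on (ball 0 1). p x * \<theta> x) = (LINT x|lebesgue_on (ball 0 1). q x * \<theta> x)"
    and g: "continuous_on (cball 0 1) g"
  shows "(LINT x|lebesgue_on (ball 0 1). p x * g x) = (LINT x|lebesgue_on (ball 0 1). q x * g x)"
proof -
  let ?L = "lebesgue_on (ball (0::'a) 1)"
  obtain M where M: "0 < M" "\<And>x. x \<in> cball 0 1 \<Longrightarrow> \<bar>g x\<bar> \<le> M"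
    using continuous_on_cball_bounded[OF g] by blast
  note tf = test_function_test_approx[OF g]
  have lim: "(\<lambda>n. LINT x|?L. r x * test_approx g n x) \<longlonglongrightarrow> (LINT x|?L. r x * g x)"
    if r: "r \<in> L2_space (ball 0 1)" for r
  proof (rule integral_dominated_convergence[where w="\<lambda>x. \<bar>r x\<bar> * M"])
    show "integrable ?L (\<lambda>x. \<bar>r x\<bar> * M)"
      using integral_abs_square_bound(1)[OF finite_measure_lebesgue_on_ball L2_spaceD[OF r]] by simp
    show "AE x in ?L. (\<lambda>n. r x * test_approx g n x) \<longlonglongrightarrow> r x * g x"
      by (rule AE_I2) (auto intro!: tendsto_intros test_approx_tendsto[OF g])
    show "AE x in ?L. norm (r x * test_approx g n x) \<le> \<bar>r x\<bar> * M" for n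
      using test_approx_bounded[OF g M(2)] by (auto simp: abs_mult intro!: mult_left_mono)
  qed (auto intro!: borel_measurable_integrable[OF integrable_L2_mult] r g test_function_continuous[OF tf])
  from LIMSEQ_unique[OF lim[OF p]] lim[OF q] show ?thesis by (simp add: t[OF tf])
qed

text \<open>Both sides are limits along \<^const>\<open>test_approx\<close>. On the left this needs the gradients of the
  approximations to be bounded, hence the boundary condition on \<open>f\<close>.\<close>

lemma weak_partial_integral_by_parts:
  fixes p q :: "'a::euclidean_space \<Rightarrow> real"
  assumes p: "p \<in> L2_space (ball 0 1)" and q: "q \<in> L2_space (ball 0 1)"
    and w: "has_weak_deriv (ball 0 1) [b] p q" and b: "b \<in> Basis"
    and f: "Ck_closure (Suc k) (ball 0 1) f" and 0: "\<And>x. x \<in> sphere 0 1 \<Longrightarrow> f x = 0"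
  shows "(LINT x|lebesgue_on (ball 0 1). p x * partial_at b f x) = - (LINT x|lebesgue_on (ball 0 1). q x * f x)"
proof -
  let ?L = "lebesgue_on (ball (0::'a) 1)"
  note fc = Ck_closure_continuous[OF f]
  obtain M where M: "0 < M" "\<And>x. x \<in> cball 0 1 \<Longrightarrow> \<bar>f x\<bar> \<le> M"
    using continuous_on_cball_bounded[OF fc] by blast
  obtain M' where M': "\<And>n b x. b \<in> Basis \<Longrightarrow> \<bar>partial_at b (test_approx f n) x\<bar> \<le> M'"
    using test_approx_partial_bounded[OF f 0] by blast
  obtain g where g: "continuous_on (cball 0 1) g" "\<And>x. x \<in> ball 0 1 \<Longrightarrow> g x = partial_at b f x"
    using Ck_closure_extension[OF f multi_indices_single[OF b]] by (metis partials_Cons partials_Nil)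
  note tf = test_function_test_approx[OF fc]
  have i: "integrable ?L (\<lambda>x. \<bar>r x\<bar> * c)" if "r \<in> L2_space (ball 0 1)" for r c
    using integral_abs_square_bound(1)[OF finite_measure_lebesgue_on_ball L2_spaceD[OF that]] by simp
  have lq: "(\<lambda>n. LINT x|?L. q x * test_approx f n x) \<longlonglongrightarrow> (LINT x|?L. q x * f x)"
  proof (rule integral_dominated_convergence[where w="\<lambda>x. \<bar>q x\<bar> * M"])
    show "AE x in ?L. (\<lambda>n. q x * test_approx f n x) \<longlonglongrightarrow> q x * f x"
      by (rule AE_I2) (auto intro!: tendsto_intros test_approx_tendsto[OF fc])
    show "AE x in ?L. norm (q x * test_approx f n x) \<le> \<bar>q x\<bar> * M" for n
      using test_approx_bounded[OF fc M(2)] by (auto simp: abs_mult intro!: mult_left_mono)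
  qed (use i[OF q] in \<open>auto intro!: borel_measurable_integrable[OF integrable_L2_mult] q fc
         test_function_continuous[OF tf]\<close>)
  have lp: "(\<lambda>n. LINT x|?L. p x * partial_at b (test_approx f n) x) \<longlonglongrightarrow> (LINT x|?L. p x * g x)"
  proof (rule integral_dominated_convergence[where w="\<lambda>x. \<bar>p x\<bar> * M'"])
    show "AE x in ?L. (\<lambda>n. p x * partial_at b (test_approx f n) x) \<longlonglongrightarrow> p x * g x"
      by (rule AE_I2) (auto intro!: tendsto_intros test_approx_partial_tendsto[OF f] simp: g(2) b)
    show "AE x in ?L. norm (p x * partial_at b (test_approx f n) x) \<le> \<bar>p x\<bar> * M'" for n
      using M'[OF b] by (auto simp: abs_mult intro!: mult_left_mono)
  qed (use i[OF p] in \<open>auto intro!: borel_measurable_integrable[OF integrable_L2_mult] p g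
         test_function_continuous[OF test_function_partial_at[OF tf b]]\<close>)
  have eq: "(LINT x|?L. p x * partial_at b (test_approx f n) x) = - (LINT x|?L. q x * test_approx f n x)" for n
    using w tf unfolding has_weak_deriv_def by (simp add: partials_Cons)
  have "(LINT x|?L. p x * g x) = - (LINT x|?L. q x * f x)"
    by (rule LIMSEQ_unique[OF lp]) (simp add: eq tendsto_minus[OF lq])
  moreover have "(LINT x|?L. p x * g x) = (LINT x|?L. p x * partial_at b f x)"
    by (rule Bochner_Integration.integral_cong) (auto simp: g(2))
  ultimately show ?thesis by simp
qed

lemma weak_deriv_sobolev:
  assumes "f \<in> sobolev k S" "bs \<in> multi_indices k"
  shows "weak_deriv S bs f \<in> L2_space S" "has_weak_deriv S bs f (weak_deriv S bs f)"
proof -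
  have "\<exists>g. g \<in> L2_space S \<and> has_weak_deriv S bs f g"
    using assms by (auto simp: sobolev_def)
  from someI_ex[OF this] show "weak_deriv S bs f \<in> L2_space S" "has_weak_deriv S bs f (weak_deriv S bs f)"
    by (auto simp: weak_deriv_def)
qed

lemma sobolev_L2_space: "f \<in> sobolev k S \<Longrightarrow> f \<in> L2_space S"
  by (simp add: sobolev_def)

text \<open>In \<open>partials (bs @ [c]) \<theta>\<close> the direction \<open>c\<close> acts on the test function first, and \<open>partial_at c \<theta>\<close> is
  again a test function. So a derivative splits off at the end of the multi-index.\<close>

lemma has_weak_deriv_snoc:
  assumes f: "f \<in> sobolev k S" and bs: "bs @ [c] \<in> multi_indices k"
  shows "has_weak_deriv S [c] (weak_deriv S bs f) (weak_deriv S (bs @ [c]) f)"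
  unfolding has_weak_deriv_def
proof safe
  fix \<theta> assume \<theta>: "test_function S \<theta>"
  have c: "c \<in> Basis" and bs': "bs \<in> multi_indices k" using bs by (auto simp: multi_indices_def)
  let ?I = "\<lambda>f. LINT x|lebesgue_on S. f x"
  have 1: "?I (\<lambda>x. f x * partials bs (partial_at c \<theta>) x) = (- 1) ^ length bs * ?I (\<lambda>x. weak_deriv S bs f x * partial_at c \<theta> x)"
    using weak_deriv_sobolev(2)[OF f bs'] test_function_partial_at[OF \<theta> c] unfolding has_weak_deriv_def by blast
  have 2: "?I (\<lambda>x. f x * partials (bs @ [c]) \<theta> x) = (- 1) ^ Suc (length bs) * ?I (\<lambda>x. weak_deriv S (bs @ [c]) f x * \<theta> x)"
    using weak_deriv_sobolev(2)[OF f bs] \<theta> unfolding has_weak_deriv_def by simp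
  have "(- 1) ^ length bs * ?I (\<lambda>x. weak_deriv S bs f x * partial_at c \<theta> x) =
      (- 1) ^ length bs * (- ?I (\<lambda>x. weak_deriv S (bs @ [c]) f x * \<theta> x))"
    using 1 2 by (simp add: partials_append partials_Cons)
  then have "?I (\<lambda>x. weak_deriv S bs f x * partial_at c \<theta> x) = - ?I (\<lambda>x. weak_deriv S (bs @ [c]) f x * \<theta> x)"
    by (simp only: mult_cancel_left) simp
  then show "?I (\<lambda>x. weak_deriv S bs f x * partials [c] \<theta> x) =
      (- 1) ^ length [c] * ?I (\<lambda>x. weak_deriv S (bs @ [c]) f x * \<theta> x)"
    by (simp add: partials_Cons)
qed

section \<open>The divergence theorem on the unit ball\<close>

lemma LIMSEQ_0_abs_le:
  fixes a b :: "nat \<Rightarrow> real"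
  assumes "\<And>n. \<bar>a n\<bar> \<le> b n" "b \<longlonglongrightarrow> 0"
  shows "a \<longlonglongrightarrow> 0"
  by (rule Lim_null_comparison[OF _ assms(2)]) (use assms(1) in simp)

lemma lebesgue_integral_lborel:
  fixes f :: "'a::euclidean_space \<Rightarrow> real"
  shows "f \<in> borel_measurable borel \<Longrightarrow> (LINT x|lebesgue. f x) = (LINT x|lborel. f x)"
  by (rule integral_completion) simp

lemma integrable_lebesgue_indicator_cball [simp]:
  "integrable lebesgue (\<lambda>x::'a::euclidean_space. indicator (cball 0 r) x * c :: real)"
  using fmeasurableD2[OF lmeasurable_cball, of "0::'a" r]
  by (intro integrable_mult_left) (auto simp: integrable_indicator_iff less_top)

text \<open>By translation invariance all difference quotients of \<open>G\<close> have integral zero. They are bounded by the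
  Lipschitz constant and converge almost everywhere.\<close>

lemma integral_directional_derivative_zero:
  fixes G :: "'a::euclidean_space \<Rightarrow> real"
  assumes lip: "\<And>x y. \<bar>G x - G y\<bar> \<le> C * norm (x - y)"
    and supp: "\<And>x. 1 \<le> norm x \<Longrightarrow> G x = 0"
    and b: "norm b = 1" and D: "D \<in> borel_measurable lebesgue"
    and der: "AE x in lebesgue. ((\<lambda>t. G (x + t *\<^sub>R b)) has_real_derivative D x) (at 0)"
  shows "(LINT x|lebesgue. D x) = 0"
proof -
  have C: "0 \<le> C" using lip[of b 0] b by simp
  have "C-lipschitz_on UNIV G"
    using lip C by (intro lipschitz_onI) (auto simp: dist_norm)
  then have c: "continuous_on UNIV G" by (rule lipschitz_on_continuous_on)
  have c': "continuous_on UNIV (\<lambda>x. G (a + x))" for a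
    by (intro continuous_on_compose2[OF c] continuous_intros) auto
  note m = borel_measurable_continuous_onI[OF c] borel_measurable_continuous_onI[OF c']
  have i: "integrable lborel G"
    by (rule integrable_compact_support[OF c compact_cball[of 0 1]]) (use supp in auto)
  have i': "integrable lborel (\<lambda>x. G (a + x))" for a
  proof (rule integrable_compact_support[OF c' compact_cball[of 0 "1 + norm a"]])
    fix x :: 'a assume "x \<notin> cball 0 (1 + norm a)"
    then show "G (a + x) = 0" using norm_triangle_ineq2[of x "-a"] by (intro supp) (auto simp: add.commute)
  qed
  define h :: "nat \<Rightarrow> real" where "h n = inverse (real (Suc n))" for n
  have h: "0 < h n" "h n \<le> 1" for n by (auto simp: h_def field_simps)
  have "h \<longlonglongrightarrow> 0" unfolding h_def by (rule LIMSEQ_inverse_real_of_nat)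
  then have hlim: "filterlim h (at 0) sequentially"
    using h by (auto simp: filterlim_at intro!: always_eventually) (metis less_irrefl)
  define s where "s n x = (G (h n *\<^sub>R b + x) - G x) / h n" for n x
  have "(\<lambda>n. LINT x|lebesgue. s n x) \<longlonglongrightarrow> (LINT x|lebesgue. D x)"
  proof (rule integral_dominated_convergence[OF D _ integrable_lebesgue_indicator_cball[of 2 C]])
    show "s n \<in> borel_measurable lebesgue" for n
      unfolding s_def using m by (intro measurable_completion) simp
    show "AE x in lebesgue. (\<lambda>n. s n x) \<longlonglongrightarrow> D x"
      using der
    proof eventually_elim
      case (elim x)
      from filterlim_compose[OF elim[unfolded DERIV_def] hlim] show ?case
        by (simp add: s_def add.commute)
    qed
    show "AE x in lebesgue. norm (s n x) \<le> indicator (cball 0 2) x * C" for n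
    proof (rule AE_I2)
      fix x
      show "norm (s n x) \<le> indicator (cball 0 2) x * C"
      proof (cases "norm x \<le> 2")
        case True
        have "\<bar>G (h n *\<^sub>R b + x) - G x\<bar> \<le> C * h n" using lip[of "h n *\<^sub>R b + x" x] h[of n] b by simp
        with True h[of n] show ?thesis by (simp add: s_def abs_divide field_simps)
      next
        case False
        then have "1 \<le> norm (h n *\<^sub>R b + x)"
          using norm_triangle_ineq2[of x "- (h n *\<^sub>R b)"] h[of n] b by (simp add: add.commute)
        with False show ?thesis using supp by (simp add: s_def)
      qed
    qed
  qed
  moreover have "(LINT x|lebesgue. s n x) = 0" for n
  proof -
    have "(LINT x|lebesgue. s n x) = (LINT x|lborel. s n x)"
      unfolding s_def using m by (intro lebesgue_integral_lborel) simp
    also have "\<dots> = ((LINT x|lborel. G (h n *\<^sub>R b + x)) - (LINT x|lborel. G x)) / h n"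
      unfolding s_def using i i' by simp
    also have "\<dots> = 0" using lborel_integral_affine[OF m(1), of 1 "h n *\<^sub>R b"] by simp
    finally show ?thesis .
  qed
  ultimately show ?thesis by (simp add: LIMSEQ_const_iff)
qed

lemma zero_extension_lipschitz:
  fixes f :: "'a::euclidean_space \<Rightarrow> real"
  assumes L: "0 \<le> L" "\<And>x y. x \<in> cball 0 1 \<Longrightarrow> y \<in> cball 0 1 \<Longrightarrow> \<bar>f x - f y\<bar> \<le> L * norm (x - y)"
    and 0: "\<And>x. x \<in> sphere 0 1 \<Longrightarrow> f x = 0"
  shows "\<bar>(if norm x < 1 then f x else 0) - (if norm y < 1 then f y else 0)\<bar> \<le> L * norm (x - y)"
proof -
  have *: "\<bar>f x\<bar> \<le> L * norm (x - y)" if "norm x < 1" "\<not> norm y < 1" for x y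
  proof -
    have "\<bar>f x\<bar> \<le> L * (1 - norm x)" using that by (intro lipschitz_vanishing_bound[OF L(2) 0]) auto
    also have "\<dots> \<le> L * norm (x - y)"
      using that L(1) norm_triangle_ineq2[of y x] by (intro mult_left_mono) (auto simp: norm_minus_commute)
    finally show ?thesis .
  qed
  show ?thesis using L(2)[of x y] *[of x y] *[of y x] L(1) by (auto simp: norm_minus_commute)
qed

text \<open>Multiply \<open>F\<close> by a function that falls linearly from 1 to 0 in a collar of width \<open>\<delta>\<close> along the sphere.
  The product, extended by zero, is Lipschitz and differentiable off two spheres, so the
  integral of its derivative vanishes by the previous lemma.\<close>

lemma collar_integral:
  fixes F :: "'a::euclidean_space \<Rightarrow> real"
  assumes F: "Ck_closure (Suc k) (ball 0 1) F" and b: "b \<in> Basis" and \<delta>: "0 < \<delta>" "\<delta> < 1"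
    and g: "continuous_on (cball 0 1) g" "\<And>x. x \<in> ball 0 1 \<Longrightarrow> g x = partial_at b F x"
  shows "(LINT x|lebesgue_on (ball 0 1). g x * min 1 ((1 - norm x) / \<delta>)) =
    (LINT x|lebesgue. indicator (ball 0 1 - ball 0 (1 - \<delta>)) x * (F x * (sgn x \<bullet> b))) / \<delta>"
proof -
  define \<eta> :: "'a \<Rightarrow> real" where "\<eta> x = min 1 ((1 - norm x) / \<delta>)" for x
  note Fc = Ck_closure_continuous[OF F]
  obtain L where L: "0 < L" "\<And>x y. x \<in> cball 0 1 \<Longrightarrow> y \<in> cball 0 1 \<Longrightarrow> \<bar>F x - F y\<bar> \<le> L * norm (x - y)"
    using Ck_closure_lipschitz[OF F] by blast
  obtain M where M: "0 < M" "\<And>x. x \<in> cball 0 1 \<Longrightarrow> \<bar>F x\<bar> \<le> M"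
    using continuous_on_cball_bounded[OF Fc] by blast
  have \<eta>_lip: "\<bar>\<eta> x - \<eta> y\<bar> \<le> norm (x - y) / \<delta>" for x y
  proof -
    have "\<bar>\<eta> x - \<eta> y\<bar> \<le> \<bar>(1 - norm x) / \<delta> - (1 - norm y) / \<delta>\<bar>" by (auto simp: \<eta>_def)
    also have "\<dots> = \<bar>norm y - norm x\<bar> / \<delta>"
      using \<delta> unfolding diff_divide_distrib[symmetric] abs_divide by simp
    also have "\<dots> \<le> norm (x - y) / \<delta>"
      using \<delta> norm_triangle_ineq3[of y x] by (intro divide_right_mono) (auto simp: norm_minus_commute)
    finally show ?thesis .
  qed
  define G where "G x = (if norm x < 1 then F x * \<eta> x else 0)" for x
  have lip: "\<bar>G x - G y\<bar> \<le> (L + M / \<delta>) * norm (x - y)" for x y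
    unfolding G_def
  proof (rule zero_extension_lipschitz)
    fix x y :: 'a assume x: "x \<in> cball 0 1" and y: "y \<in> cball 0 1"
    have "F x * \<eta> x - F y * \<eta> y = (F x - F y) * \<eta> x + F y * (\<eta> x - \<eta> y)" by (simp add: algebra_simps)
    also have "\<bar>\<dots>\<bar> \<le> \<bar>F x - F y\<bar> * \<bar>\<eta> x\<bar> + \<bar>F y\<bar> * \<bar>\<eta> x - \<eta> y\<bar>"
      unfolding abs_mult[symmetric] by (rule abs_triangle_ineq)
    also have "\<dots> \<le> (L * norm (x - y)) * 1 + M * (norm (x - y) / \<delta>)"
      using x y L(1) M(1) \<delta> by (intro add_mono mult_mono L M \<eta>_lip) (auto simp: \<eta>_def min_def)
    also have "\<dots> = (L + M / \<delta>) * norm (x - y)" by (simp add: algebra_simps)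
    finally show "\<bar>F x * \<eta> x - F y * \<eta> y\<bar> \<le> (L + M / \<delta>) * norm (x - y)" .
  qed (use L(1) M(1) \<delta> in \<open>auto simp: \<eta>_def\<close>)
  define A where "A = ball (0::'a) 1 - ball 0 (1 - \<delta>)"
  define D where "D x = indicator (ball 0 1) x * (g x * \<eta> x) - indicator A x * (F x * (sgn x \<bullet> b)) / \<delta>" for x
  have A: "A \<in> sets lebesgue" "A \<in> sets borel" "A \<subseteq> cball 0 1" by (auto simp: A_def)
  have A0: "x \<in> A \<Longrightarrow> x \<noteq> 0" for x using \<delta> by (auto simp: A_def)
  have c\<eta>: "continuous_on S \<eta>" for S unfolding \<eta>_def using \<delta> by (intro continuous_intros) auto
  have cA: "continuous_on A (\<lambda>x. F x * (sgn x \<bullet> b))"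
    unfolding sgn_div_norm using A0 by (intro continuous_intros continuous_on_subset[OF Fc A(3)]) auto
  have i1: "integrable lebesgue (\<lambda>x. indicator (ball 0 1) x * (g x * \<eta> x))"
    using integrable_L2_mult[OF L2_space_continuous[OF g(1)] c\<eta>]
    by (subst (asm) integrable_restrict_space) auto
  have mA: "(\<lambda>x. indicator A x * (F x * (sgn x \<bullet> b))) \<in> borel_measurable borel"
    using borel_measurable_continuous_on_indicator[OF A(2) cA] by simp
  have i2: "integrable lebesgue (\<lambda>x. indicator A x * (F x * (sgn x \<bullet> b)))"
  proof (rule Bochner_Integration.integrable_bound[OF integrable_lebesgue_indicator_cball[of 1 M]])
    show "AE x in lebesgue. norm (indicator A x * (F x * (sgn x \<bullet> b))) \<le> norm (indicator (cball 0 1) x * M)"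
    proof (rule AE_I2)
      fix x :: 'a
      have "\<bar>sgn x \<bullet> b\<bar> \<le> 1" using Basis_le_norm[OF b, of "sgn x"] by (auto simp: norm_sgn split: if_splits)
      then have "\<bar>F x\<bar> * \<bar>sgn x \<bullet> b\<bar> \<le> M * 1" if "x \<in> cball 0 1" using that M by (intro mult_mono) auto
      then show "norm (indicator A x * (F x * (sgn x \<bullet> b))) \<le> norm (indicator (cball 0 1) x * M)"
        using A(3) M(1) by (auto simp: indicator_def abs_mult)
    qed
  qed (intro measurable_completion, use mA in simp)
  have "(LINT x|lebesgue. D x) = 0"
  proof (rule integral_directional_derivative_zero[OF lip])
    show "D \<in> borel_measurable lebesgue"
      unfolding D_def using borel_measurable_integrable[OF i1] borel_measurable_integrable[OF i2] by simp
    have "sphere (0::'a) 1 \<union> sphere 0 (1 - \<delta>) \<in> null_sets lebesgue"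
      by (intro null_sets.Un) (auto simp: negligible_iff_null_sets[symmetric] negligible_sphere)
    then have "AE x in lebesgue. x \<notin> sphere (0::'a) 1 \<union> sphere 0 (1 - \<delta>)" by (rule AE_not_in)
    then show "AE x in lebesgue. ((\<lambda>t. G (x + t *\<^sub>R b)) has_real_derivative D x) (at 0)"
    proof eventually_elim
      case (elim x)
      have opn: "open ((\<lambda>t. x + t *\<^sub>R b) -` S)" if "open S" for S
        by (rule open_vimage[OF that]) (intro continuous_intros)
      have dF: "((\<lambda>t. F (x + t *\<^sub>R b)) has_real_derivative g x) (at 0)" if "norm x < 1"
        using has_derivative_along_line[of F x 0 b] F that g(2)[of x] by (auto simp: Ck_closure_def)
      consider "norm x < 1 - \<delta>" | "1 - \<delta> < norm x" "norm x < 1" | "1 < norm x"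
        using elim by fastforce
      then show ?case
      proof cases
        case 1
        have "D x = g x" using 1 \<delta> by (auto simp: D_def A_def \<eta>_def indicator_def min_def field_simps)
        moreover have "((\<lambda>t. G (x + t *\<^sub>R b)) has_real_derivative g x) (at 0)"
        proof (rule has_field_derivative_transform_within_open[OF dF opn[OF open_ball[of 0 "1 - \<delta>"]]])
          show "\<And>t. t \<in> (\<lambda>t. x + t *\<^sub>R b) -` ball 0 (1 - \<delta>) \<Longrightarrow> F (x + t *\<^sub>R b) = G (x + t *\<^sub>R b)"
            using \<delta> by (auto simp: G_def \<eta>_def min_def field_simps)
        qed (use 1 \<delta> in auto)
        ultimately show ?thesis by simp
      next
        case 2
        have "x \<noteq> 0" using 2 \<delta> by auto
        have "D x = g x * ((1 - norm x) / \<delta>) - F x * (sgn x \<bullet> b) / \<delta>"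
          using 2 \<delta> by (auto simp: D_def A_def \<eta>_def indicator_def min_def field_simps)
        moreover have "((\<lambda>t. G (x + t *\<^sub>R b)) has_real_derivative
            g x * ((1 - norm x) / \<delta>) - F x * (sgn x \<bullet> b) / \<delta>) (at 0)"
        proof (rule has_field_derivative_transform_within_open[OF _ opn[of "ball 0 1 - cball 0 (1 - \<delta>)"]])
          have "((\<lambda>t. norm (x + t *\<^sub>R b)) has_real_derivative (sgn x \<bullet> b)) (at 0)"
            unfolding has_field_derivative_def using \<open>x \<noteq> 0\<close>
            by (intro has_derivative_eq_rhs[OF has_derivative_compose[OF _ has_derivative_norm]])
               (auto intro!: derivative_eq_intros simp: inner_commute fun_eq_iff)
          then show "((\<lambda>t. F (x + t *\<^sub>R b) * ((1 - norm (x + t *\<^sub>R b)) / \<delta>)) has_real_derivative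
              g x * ((1 - norm x) / \<delta>) - F x * (sgn x \<bullet> b) / \<delta>) (at 0)"
            using dF[OF 2(2)] \<delta> by (auto intro!: derivative_eq_intros simp: field_simps)
          show "F (x + t *\<^sub>R b) * ((1 - norm (x + t *\<^sub>R b)) / \<delta>) = G (x + t *\<^sub>R b)"
            if "t \<in> (\<lambda>t. x + t *\<^sub>R b) -` (ball 0 1 - cball 0 (1 - \<delta>))" for t
            using that \<delta> by (auto simp: G_def \<eta>_def min_def field_simps)
        qed (use 2 in auto)
        ultimately show ?thesis by simp
      next
        case 3
        have "D x = 0" using 3 by (auto simp: D_def A_def)
        moreover have "((\<lambda>t. G (x + t *\<^sub>R b)) has_real_derivative 0) (at 0)"
        proof (rule has_field_derivative_transform_within_open[OF _ opn[of "- cball 0 1"], where f="\<lambda>t. 0"])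
          show "\<And>t. t \<in> (\<lambda>t. x + t *\<^sub>R b) -` (- cball 0 1) \<Longrightarrow> 0 = G (x + t *\<^sub>R b)"
            by (auto simp: G_def)
        qed (use 3 in auto)
        ultimately show ?thesis by simp
      qed
    qed
  qed (use b in \<open>auto simp: G_def\<close>)
  then have "(LINT x|lebesgue. indicator (ball 0 1) x * (g x * \<eta> x)) = (LINT x|lebesgue. indicator A x * (F x * (sgn x \<bullet> b))) / \<delta>"
    unfolding D_def using i1 i2 by (simp add: Bochner_Integration.integral_diff)
  then show ?thesis by (simp add: integral_restrict_space \<eta>_def A_def)
qed

text \<open>Substitute \<open>x \<mapsto> r x\<close>.\<close>

lemma integral_ball_homogeneous:
  fixes H :: "'a::euclidean_space \<Rightarrow> real"
  assumes [measurable]: "H \<in> borel_measurable borel" and hom: "\<And>c x. 0 < c \<Longrightarrow> H (c *\<^sub>R x) = H x" and r: "0 < r"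
  shows "(LINT x|lebesgue. indicator (ball 0 r) x * H x) = r ^ DIM('a) * (LINT x|lebesgue. indicator (ball 0 1) x * H x)"
proof -
  have m: "(\<lambda>x. indicator (ball 0 r) x * H x) \<in> borel_measurable borel" for r
    by (intro borel_measurable_times borel_measurable_indicator assms) simp
  have "(LINT x|lebesgue. indicator (ball 0 r) x * H x) = (LINT x|lborel. indicator (ball 0 r) x * H x)"
    by (rule lebesgue_integral_lborel[OF m])
  also have "\<dots> = \<bar>r\<bar> ^ DIM('a) * (LINT x|lborel. indicator (ball 0 r) (0 + r *\<^sub>R x) * H (0 + r *\<^sub>R x))"
    by (rule lborel_integral_affine[OF m]) (use r in simp)
  also have "(\<lambda>x::'a. indicator (ball 0 r) (0 + r *\<^sub>R x) * H (0 + r *\<^sub>R x)) = (\<lambda>x. indicator (ball 0 1) x * H x)"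
    using r by (auto simp: hom indicator_def)
  also have "(LINT x|lborel. indicator (ball 0 1) x * H x) = (LINT x|lebesgue. indicator (ball 0 1) x * H x)"
    by (rule lebesgue_integral_lborel[OF m, symmetric])
  finally show ?thesis using r by simp
qed

text \<open>Let the width \<open>\<delta>\<close> of the collar tend to zero. In the collar \<open>F x\<close> differs from \<open>F (sgn x)\<close> by at most
  \<open>L \<delta>\<close>. The integral over the collar of a function that is homogeneous of degree zero
  is \<open>1 - (1 - \<delta>)\<^sup>d\<close> times its integral over the ball, and \<open>(1 - (1 - \<delta>)\<^sup>d) / \<delta>\<close> tends to the dimension \<open>d\<close>. The
  right hand side below is the surface integral, by the way the surface measure is defined.\<close>

lemma integral_partial_at_ball:
  fixes F :: "'a::euclidean_space \<Rightarrow> real"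
  assumes F: "Ck_closure (Suc k) (ball 0 1) F" and b: "b \<in> Basis"
  shows "(LINT x|lebesgue_on (ball 0 1). partial_at b F x) =
    real DIM('a) * (LINT x|lebesgue_on (ball 0 1). F (sgn x) * (sgn x \<bullet> b))"
proof -
  let ?d = "DIM('a)"
  note Fc = Ck_closure_continuous[OF F]
  obtain g where g: "continuous_on (cball 0 1) g" "\<And>x. x \<in> ball 0 1 \<Longrightarrow> g x = partial_at b F x"
    using Ck_closure_extension[OF F multi_indices_single[OF b]] by (metis partials_Cons partials_Nil)
  obtain L where L: "0 < L" "\<And>x y. x \<in> cball 0 1 \<Longrightarrow> y \<in> cball 0 1 \<Longrightarrow> \<bar>F x - F y\<bar> \<le> L * norm (x - y)"
    using Ck_closure_lipschitz[OF F] by blast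
  obtain M where M: "0 < M" "\<And>x. x \<in> cball 0 1 \<Longrightarrow> \<bar>F x\<bar> \<le> M"
    using continuous_on_cball_bounded[OF Fc] by blast
  obtain Mg where Mg: "0 < Mg" "\<And>x. x \<in> cball 0 1 \<Longrightarrow> \<bar>g x\<bar> \<le> Mg"
    using continuous_on_cball_bounded[OF g(1)] by blast
  define \<delta> :: "nat \<Rightarrow> real" where "\<delta> n = inverse (real (n + 4))" for n
  have \<delta>: "0 < \<delta> n" "\<delta> n < 1" for n by (auto simp: \<delta>_def field_simps)
  have "\<forall>\<^sub>F n in sequentially. \<delta> n < r" if "0 < r" for r
    using eventually_inverse_nat_less[OF that] by (simp add: \<delta>_def)
  then have \<delta>0: "\<delta> \<longlonglongrightarrow> 0" using \<delta>(1) by (intro order_tendstoI) (auto simp: less_trans intro: always_eventually)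
  have sb: "\<bar>sgn x \<bullet> b\<bar> \<le> 1" for x :: 'a
    using Basis_le_norm[OF b, of "sgn x"] by (auto simp: norm_sgn split: if_splits)
  \<comment> \<open>a Borel function that agrees with \<open>F\<close> on the closed ball\<close>
  define Fh where "Fh x = indicator (cball 0 1) x * F x" for x
  have Fh[measurable]: "Fh \<in> borel_measurable borel"
    using borel_measurable_continuous_on_indicator[OF _ Fc] by (simp add: Fh_def[abs_def])
  have Fh_sgn: "Fh (sgn x) = F (sgn x)" for x by (auto simp: Fh_def indicator_def norm_sgn)
  define H where "H x = Fh (sgn x) * (sgn x \<bullet> b)" for x
  have [measurable]: "H \<in> borel_measurable borel" unfolding H_def by measurable
  have hom: "H (c *\<^sub>R x) = H x" if "0 < c" for c x using that by (simp add: H_def sgn_scaleR)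
  have HM: "\<bar>H x\<bar> \<le> M" for x
  proof -
    have "\<bar>Fh (sgn x)\<bar> * \<bar>sgn x \<bullet> b\<bar> \<le> M * 1"
      using M sb[of x] by (intro mult_mono) (auto simp: Fh_sgn norm_sgn)
    then show ?thesis by (simp add: H_def abs_mult)
  qed
  have int: "integrable lebesgue (\<lambda>x. indicator S x * f x)"
    if "S \<subseteq> cball 0 1" "(\<lambda>x. indicator S x * f x) \<in> borel_measurable lebesgue" "\<And>x. x \<in> S \<Longrightarrow> \<bar>f x\<bar> \<le> N" "0 \<le> N"
    for S N and f :: "'a \<Rightarrow> real"
  proof (rule Bochner_Integration.integrable_bound[OF integrable_lebesgue_indicator_cball[of 1 N]])
    show "AE x in lebesgue. norm (indicator S x * f x) \<le> norm (indicator (cball 0 1) x * N)"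
      using that by (intro AE_I2) (auto simp: indicator_def)
  qed (use that in simp)
  define A where "A n = ball (0::'a) 1 - ball 0 (1 - \<delta> n)" for n
  have A_ind: "indicator (A n) x * c = indicator (ball 0 1) x * c - indicator (ball 0 (1 - \<delta> n)) x * c"
    for n x and c :: real
    using \<delta>[of n] by (auto simp: A_def indicator_def)
  have bm: "(\<lambda>x. indicator S x * f x) \<in> borel_measurable lebesgue"
    if "S \<in> sets borel" "f \<in> borel_measurable borel" for S and f :: "'a \<Rightarrow> real"
    using that by (intro measurable_completion) simp
  have collar: "(LINT x|lebesgue. indicator (A n) x * f x) =
      (1 - (1 - \<delta> n) ^ ?d) * (LINT x|lebesgue. indicator (ball 0 1) x * f x)"
    if f: "f \<in> borel_measurable borel" "\<And>c x. 0 < c \<Longrightarrow> f (c *\<^sub>R x) = f x" "\<And>x. \<bar>f x\<bar> \<le> M'" for n f M'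
  proof -
    have "0 \<le> M'" using f(3)[of 0] by simp
    have *: "integrable lebesgue (\<lambda>x. indicator (ball 0 r) x * f x)" if "r \<le> 1" for r
      using \<open>0 \<le> M'\<close> f that by (intro int[of _ _ M'] bm) auto
    have "(LINT x|lebesgue. indicator (A n) x * f x) =
        (LINT x|lebesgue. indicator (ball 0 1) x * f x) - (LINT x|lebesgue. indicator (ball 0 (1 - \<delta> n)) x * f x)"
      unfolding A_ind using \<delta>[of n] by (intro Bochner_Integration.integral_diff *) auto
    also have "(LINT x|lebesgue. indicator (ball 0 (1 - \<delta> n)) x * f x) =
        (1 - \<delta> n) ^ ?d * (LINT x|lebesgue. indicator (ball 0 1) x * f x)"
      using \<delta>[of n] by (intro integral_ball_homogeneous f) auto
    finally show ?thesis by (simp add: algebra_simps)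
  qed
  define J where "J = (LINT x|lebesgue. indicator (ball 0 1) x * H x)"
  define V where "V = (LINT x::'a|lebesgue. indicator (ball 0 1) x * (1::real))"
  define R where "R n = (LINT x|lebesgue. indicator (A n) x * (F x * (sgn x \<bullet> b))) / \<delta> n" for n
  have near: "\<bar>R n - (1 - (1 - \<delta> n) ^ ?d) / \<delta> n * J\<bar> \<le> L * ((1 - (1 - \<delta> n) ^ ?d) * V)" for n
  proof -
    have A1: "A n \<subseteq> cball 0 1" "A n \<in> sets borel" by (auto simp: A_def)
    have mF: "(\<lambda>x. indicator (A n) x * (F x * (sgn x \<bullet> b))) \<in> borel_measurable lebesgue"
    proof -
      have "(\<lambda>x. indicator (A n) x * (Fh x * (sgn x \<bullet> b))) \<in> borel_measurable lebesgue"
        by (rule bm[OF A1(2)]) measurable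
      moreover have "indicator (A n) x * (Fh x * (sgn x \<bullet> b)) = indicator (A n) x * (F x * (sgn x \<bullet> b))" for x
        using A1(1) by (auto simp: Fh_def indicator_def)
      ultimately show ?thesis by simp
    qed
    have bF: "\<bar>F x * (sgn x \<bullet> b)\<bar> \<le> M" if "x \<in> A n" for x
    proof -
      have "\<bar>F x\<bar> * \<bar>sgn x \<bullet> b\<bar> \<le> M * 1" using M sb[of x] that A1(1) by (intro mult_mono) auto
      then show ?thesis by (simp add: abs_mult)
    qed
    have iF: "integrable lebesgue (\<lambda>x. indicator (A n) x * (F x * (sgn x \<bullet> b)))"
      by (rule int[OF A1(1) mF bF]) (use M(1) in auto)
    have iH: "integrable lebesgue (\<lambda>x. indicator (A n) x * H x)"
      by (rule int[OF A1(1) _ HM]) (use M(1) A1(2) in \<open>auto intro!: bm\<close>)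
    have i1: "integrable lebesgue (\<lambda>x. indicator (A n) x * (L * \<delta> n))"
      by (rule int[OF A1(1), of _ "L * \<delta> n"]) (use L(1) \<delta>(1)[of n] A1(2) in \<open>auto intro!: bm\<close>)
    have "\<bar>LINT x|lebesgue. indicator (A n) x * (F x * (sgn x \<bullet> b)) - indicator (A n) x * H x\<bar>
        \<le> (LINT x|lebesgue. indicator (A n) x * (L * \<delta> n))"
    proof (rule integral_abs_bound_integral[OF Bochner_Integration.integrable_diff[OF iF iH] i1])
      fix x
      show "\<bar>indicator (A n) x * (F x * (sgn x \<bullet> b)) - indicator (A n) x * H x\<bar> \<le> indicator (A n) x * (L * \<delta> n)"
      proof (cases "x \<in> A n")
        case True
        then have x: "1 - \<delta> n \<le> norm x" "norm x < 1" "x \<noteq> 0" using \<delta>[of n] by (auto simp: A_def)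
        have "x - sgn x = (norm x - 1) *\<^sub>R sgn x"
          using x(3) by (simp add: sgn_div_norm algebra_simps)
        then have "norm (x - sgn x) = \<bar>norm x - 1\<bar>" using x(3) by (simp add: norm_sgn)
        then have "\<bar>F x - F (sgn x)\<bar> \<le> L * (1 - norm x)"
          using L(2)[of x "sgn x"] x by (simp add: norm_sgn)
        also have "\<dots> \<le> L * \<delta> n" using L(1) x by (intro mult_left_mono) auto
        finally have "\<bar>F x - F (sgn x)\<bar> * \<bar>sgn x \<bullet> b\<bar> \<le> (L * \<delta> n) * 1"
          using sb[of x] by (intro mult_mono) auto
        then show ?thesis using True by (simp add: H_def Fh_sgn abs_mult[symmetric] left_diff_distrib)
      qed simp
    qed
    also have "\<dots> = (L * \<delta> n) * ((1 - (1 - \<delta> n) ^ ?d) * V)"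
      using collar[of "\<lambda>x. 1" 1 n] by (simp add: V_def)
    also have "(LINT x|lebesgue. indicator (A n) x * (F x * (sgn x \<bullet> b)) - indicator (A n) x * H x) =
        \<delta> n * R n - (1 - (1 - \<delta> n) ^ ?d) * J"
      using iF iH collar[OF _ hom HM, of n] \<delta>(1)[of n] by (simp add: R_def J_def)
    also have "\<dots> = \<delta> n * (R n - (1 - (1 - \<delta> n) ^ ?d) / \<delta> n * J)"
      using \<delta>(1)[of n] by (simp add: field_simps)
    finally have "\<delta> n * \<bar>R n - (1 - (1 - \<delta> n) ^ ?d) / \<delta> n * J\<bar> \<le> \<delta> n * (L * ((1 - (1 - \<delta> n) ^ ?d) * V))"
      using \<delta>(1)[of n] by (simp add: abs_mult mult_ac)
    then show ?thesis using \<delta>(1)[of n] by simp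
  qed
  have "(\<lambda>n. L * ((1 - (1 - \<delta> n) ^ ?d) * V)) \<longlonglongrightarrow> L * ((1 - (1 - 0) ^ ?d) * V)"
    by (intro tendsto_intros \<delta>0)
  then have "(\<lambda>n. L * ((1 - (1 - \<delta> n) ^ ?d) * V)) \<longlonglongrightarrow> 0" by simp
  with near have l0: "(\<lambda>n. R n - (1 - (1 - \<delta> n) ^ ?d) / \<delta> n * J) \<longlonglongrightarrow> 0" by (rule LIMSEQ_0_abs_le)
  have l1: "(\<lambda>n. (1 - (1 - \<delta> n) ^ ?d) / \<delta> n * J) \<longlonglongrightarrow> real ?d * J"
  proof (rule tendsto_mult_right)
    have "((\<lambda>x. 1 - (1 - x) ^ ?d) has_real_derivative real ?d) (at 0)"
      by (auto intro!: derivative_eq_intros)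
    then have "((\<lambda>h. (1 - (1 - h) ^ ?d) / h) \<longlongrightarrow> real ?d) (at 0)" by (simp add: DERIV_def)
    moreover have "filterlim \<delta> (at 0) sequentially"
      using \<delta>0 \<delta>(1) by (auto simp: filterlim_at intro!: always_eventually) (metis less_irrefl)
    ultimately show "(\<lambda>n. (1 - (1 - \<delta> n) ^ ?d) / \<delta> n) \<longlonglongrightarrow> real ?d" by (rule filterlim_compose)
  qed
  have lR: "R \<longlonglongrightarrow> real ?d * J" using tendsto_add[OF l0 l1] by simp
  have lg: "R \<longlonglongrightarrow> (LINT x|lebesgue_on (ball 0 1). g x)"
  proof -
    have "(\<lambda>n. LINT x|lebesgue_on (ball 0 1). g x * min 1 ((1 - norm x) / \<delta> n)) \<longlonglongrightarrow> (LINT x|lebesgue_on (ball 0 1). g x)"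
    proof (rule integral_dominated_convergence[where w="\<lambda>x. Mg"])
      show "integrable (lebesgue_on (ball (0::'a) 1)) (\<lambda>x. Mg)"
        using finite_measure.integrable_const[OF finite_measure_lebesgue_on_ball] by blast
      show "AE x in lebesgue_on (ball 0 1). (\<lambda>n. g x * min 1 ((1 - norm x) / \<delta> n)) \<longlonglongrightarrow> g x"
      proof (rule AE_I2)
        fix x :: 'a assume x: "x \<in> space (lebesgue_on (ball 0 1))"
        then have "\<forall>\<^sub>F n in sequentially. \<delta> n < 1 - norm x"
          using order_tendstoD(2)[OF \<delta>0, of "1 - norm x"] by simp
        then have "\<forall>\<^sub>F n in sequentially. g x * min 1 ((1 - norm x) / \<delta> n) = g x"
          by eventually_elim (use \<delta>(1) in \<open>auto simp: min_def field_simps\<close>)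
        then show "(\<lambda>n. g x * min 1 ((1 - norm x) / \<delta> n)) \<longlonglongrightarrow> g x" by (rule tendsto_eventually)
      qed
      show "AE x in lebesgue_on (ball 0 1). norm (g x * min 1 ((1 - norm x) / \<delta> n)) \<le> Mg" for n
      proof (rule AE_I2)
        fix x :: 'a assume x: "x \<in> space (lebesgue_on (ball 0 1))"
        then have "\<bar>g x\<bar> * \<bar>min 1 ((1 - norm x) / \<delta> n)\<bar> \<le> Mg * 1"
          using Mg \<delta>(1)[of n] by (intro mult_mono) (auto simp: min_def)
        then show "norm (g x * min 1 ((1 - norm x) / \<delta> n)) \<le> Mg" by (simp add: abs_mult)
      qed
      show "(\<lambda>x. g x * min 1 ((1 - norm x) / \<delta> n)) \<in> borel_measurable (lebesgue_on (ball 0 1))" for n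
        using \<delta>(1)[of n] by (intro measurable_continuous_on_cball continuous_intros g) auto
    qed (rule measurable_continuous_on_cball[OF g(1)])
    moreover have "R = (\<lambda>n. LINT x|lebesgue_on (ball 0 1). g x * min 1 ((1 - norm x) / \<delta> n))"
      by (rule ext) (simp only: R_def A_def collar_integral[OF F b \<delta> g])
    ultimately show ?thesis by (simp only:)
  qed
  have "(LINT x|lebesgue_on (ball 0 1). g x) = real ?d * J" by (rule LIMSEQ_unique[OF lg lR])
  moreover have "J = (LINT x|lebesgue_on (ball 0 1). F (sgn x) * (sgn x \<bullet> b))"
    by (simp add: J_def integral_restrict_space H_def Fh_sgn)
  moreover have "(LINT x|lebesgue_on (ball 0 1). g x) = (LINT x|lebesgue_on (ball 0 1). partial_at b F x)"
    by (rule Bochner_Integration.integral_cong) (auto simp: g(2))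
  ultimately show ?thesis by simp
qed

lemma sphere_measure_eq_density:
  "sphere_measure = density (distr (lebesgue_on (ball (0::'a::euclidean_space) 1)) borel sgn) (\<lambda>_. ennreal (real DIM('a)))"
  unfolding sphere_measure_def
  by (rule measure_eqI) (simp_all add: emeasure_density_const ennreal_of_nat_eq_real_of_nat)

lemma measurable_sgn_ball [measurable]: "sgn \<in> lebesgue_on (ball (0::'a::euclidean_space) 1) \<rightarrow>\<^sub>M borel"
proof -
  have "sgn \<in> (borel :: 'a measure) \<rightarrow>\<^sub>M borel" by simp
  then have "sgn \<in> (lebesgue :: 'a measure) \<rightarrow>\<^sub>M borel" by (intro measurable_completion) simp
  then show ?thesis by (rule measurable_restrict_space1)
qed

lemma sets_sphere_measure [measurable_cong, simp]: "sets sphere_measure = sets borel"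
  by (simp add: sphere_measure_def)

lemma integral_sphere_measure:
  fixes h :: "'a::euclidean_space \<Rightarrow> real"
  assumes [measurable]: "h \<in> borel_measurable borel"
  shows "(LINT x|sphere_measure. h x) = real DIM('a) * (LINT x|lebesgue_on (ball 0 1). h (sgn x))"
  unfolding sphere_measure_eq_density by (simp add: integral_density integral_distr)

lemma finite_measure_sphere_measure: "finite_measure (sphere_measure :: 'a::euclidean_space measure)"
proof
  interpret finite_measure "lebesgue_on (ball (0::'a) 1)" by (rule finite_measure_lebesgue_on_ball)
  show "emeasure sphere_measure (space (sphere_measure::'a measure)) \<noteq> \<infinity>"
    using emeasure_finite
    by (simp add: sphere_measure_def space_scale_measure emeasure_distr ennreal_mult_eq_top_iff)
qed

lemma AE_sphere_measure: "AE x in (sphere_measure :: 'a::euclidean_space measure). x \<in> sphere 0 1"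
proof -
  have "AE x in lborel. x \<noteq> (0::'a)" by (rule AE_lborel_singleton)
  then have "AE x in lebesgue. x \<noteq> (0::'a)" by (rule AE_completion)
  then have "AE x in lebesgue_on (ball (0::'a) 1). x \<noteq> 0"
    by (subst AE_restrict_space_iff) (auto elim: eventually_mono)
  then have "AE x in lebesgue_on (ball (0::'a) 1). norm (sgn x) = 1"
    by eventually_elim (simp add: norm_sgn)
  then show ?thesis
    unfolding sphere_measure_eq_density by (simp add: AE_density AE_distr_iff)
qed

text \<open>The indicator function matters for measurability: \<open>F\<close> is arbitrary outside the closed ball.\<close>

theorem divergence_theorem_ball:
  fixes F :: "'a::euclidean_space \<Rightarrow> real"
  assumes F: "Ck_closure (Suc k) (ball 0 1) F" and b: "b \<in> Basis"
  shows "(LINT x|lebesgue_on (ball 0 1). partial_at b F x) =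
    (LINT x|sphere_measure. indicator (sphere 0 1) x * F x * (x \<bullet> b))"
proof -
  have "continuous_on (sphere 0 1) F"
    using Ck_closure_continuous[OF F] by (rule continuous_on_subset) auto
  then have [measurable]: "(\<lambda>x. indicator (sphere 0 1) x * F x) \<in> borel_measurable borel"
    using borel_measurable_continuous_on_indicator[of "sphere 0 1" F] by simp
  have "(LINT x|sphere_measure. indicator (sphere 0 1) x * F x * (x \<bullet> b)) =
      real DIM('a) * (LINT x|lebesgue_on (ball 0 1). indicator (sphere 0 1) (sgn x) * F (sgn x) * (sgn x \<bullet> b))"
    by (rule integral_sphere_measure) measurable
  also have "(\<lambda>x. indicator (sphere 0 1) (sgn x) * F (sgn x) * (sgn x \<bullet> b)) = (\<lambda>x. F (sgn x) * (sgn x \<bullet> b))"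
    by (auto simp: fun_eq_iff indicator_def norm_sgn)
  finally show ?thesis using integral_partial_at_ball[OF F b] by simp
qed

section \<open>Functions that are differentiable up to the boundary\<close>

lemma has_derivative_cong_open:
  assumes "open S" "x \<in> S" "\<And>y. y \<in> S \<Longrightarrow> f y = g y"
  shows "(f has_derivative D) (at x) \<longleftrightarrow> (g has_derivative D) (at x)"
  using assms has_derivative_transform_within_open[of f D x UNIV S g]
    has_derivative_transform_within_open[of g D x UNIV S f] by auto

lemma partial_at_cong_open:
  assumes "open S" "x \<in> S" "\<And>y. y \<in> S \<Longrightarrow> f y = g y"
  shows "partial_at b f x = partial_at b g x"
  unfolding partial_at_def frechet_derivative_def using has_derivative_cong_open[OF assms] by simp

lemma partials_cong_open:
  assumes "open S" "\<And>y. y \<in> S \<Longrightarrow> f y = g y" "x \<in> S"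
  shows "partials bs f x = partials bs g x"
  using assms(3)
proof (induction bs arbitrary: x)
  case (Cons b bs)
  then show ?case unfolding partials_Cons by (intro partial_at_cong_open[OF assms(1)])
qed (use assms in simp)

lemma Ck_on_cong_open:
  assumes "open S" "\<And>y. y \<in> S \<Longrightarrow> f y = g y" "Ck_on k S f"
  shows "Ck_on k S g"
  using assms(2,3)
proof (induction k arbitrary: f g)
  case 0
  then show ?case by (simp cong: continuous_on_cong)
next
  case (Suc k)
  have "g differentiable (at x)" if x: "x \<in> S" for x
  proof -
    obtain D where "(f has_derivative D) (at x)" using Suc.prems(2) x by (auto simp: differentiable_def)
    then have "(g has_derivative D) (at x)"
      using has_derivative_cong_open[OF assms(1) x, of f g D] Suc.prems(1) by simp
    then show ?thesis by (auto simp: differentiable_def)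
  qed
  moreover have "Ck_on k S (partial_at b g)" if "b \<in> Basis" for b
    using Suc.IH[of "partial_at b f" "partial_at b g"] Suc.prems that partial_at_cong_open[OF assms(1) _ Suc.prems(1)]
    by auto
  ultimately show ?case by simp
qed

text \<open>Partial derivatives are replaced by their continuous extensions to the closed ball, to which the
  boundary lemmas apply again.\<close>

lemma Ck_closure_partial_at:
  fixes f :: "'a::euclidean_space \<Rightarrow> real"
  assumes f: "Ck_closure (Suc k) (ball 0 1) f" and b: "b \<in> Basis"
  obtains g where "Ck_closure k (ball 0 1) g" "\<And>x. x \<in> ball 0 1 \<Longrightarrow> g x = partial_at b f x"
proof -
  obtain g where g: "continuous_on (cball 0 1) g" "\<And>x. x \<in> ball 0 1 \<Longrightarrow> g x = partial_at b f x"
    using Ck_closure_extension[OF f multi_indices_single[OF b]] by (metis partials_Cons partials_Nil)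
  have "Ck_on k (ball 0 1) (partial_at b f)" using f b by (simp add: Ck_closure_def)
  then have "Ck_on k (ball 0 1) g" by (rule Ck_on_cong_open[rotated 2]) (auto simp: g(2))
  moreover have "\<exists>e. continuous_on (cball 0 1) e \<and> (\<forall>x\<in>ball 0 1. e x = partials bs g x)"
    if "bs \<in> multi_indices k" for bs
  proof -
    have "bs @ [b] \<in> multi_indices (Suc k)" using that b by (auto simp: multi_indices_def)
    from Ck_closure_extension[OF f this]
    obtain e where "continuous_on (cball 0 1) e" "\<And>x. x \<in> ball 0 1 \<Longrightarrow> e x = partials bs (partial_at b f) x"
      by (metis partials_append partials_Cons partials_Nil)
    moreover have "partials bs (partial_at b f) x = partials bs g x" if "x \<in> ball 0 1" for x
      using that g(2) by (intro partials_cong_open[of "ball 0 1"]) auto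
    ultimately show ?thesis by metis
  qed
  ultimately have "Ck_closure k (ball 0 1) g" using g(1) by (simp add: Ck_closure_def closure_ball)
  with g(2) that show ?thesis by blast
qed

lemma Ck_closure_mono: "Ck_closure (Suc k) (ball 0 1) f \<Longrightarrow> Ck_closure k (ball (0::'a::euclidean_space) 1) f"
  using Ck_on_Suc_imp unfolding Ck_closure_def multi_indices_def by auto

lemma C1_closureI:
  fixes f :: "'a::euclidean_space \<Rightarrow> real"
  assumes "continuous_on (cball 0 1) f" "\<And>x. x \<in> ball 0 1 \<Longrightarrow> f differentiable (at x)"
    "\<And>b. b \<in> Basis \<Longrightarrow> \<exists>g. continuous_on (cball 0 1) g \<and> (\<forall>x\<in>ball 0 1. g x = partial_at b f x)"
  shows "Ck_closure 1 (ball 0 1) f"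
proof -
  have "continuous_on (ball 0 1) (partial_at b f)" if "b \<in> Basis" for b
    using assms(3)[OF that] by (metis continuous_on_cong continuous_on_subset ball_subset_cball)
  moreover have "\<exists>g. continuous_on (cball 0 1) g \<and> (\<forall>x\<in>ball 0 1. g x = partials bs f x)"
    if bs: "bs \<in> multi_indices 1" for bs
  proof (cases bs)
    case Nil
    then show ?thesis using assms(1) by auto
  next
    case (Cons b cs)
    with bs have "bs = [b]" "b \<in> Basis" by (auto simp: multi_indices_def)
    with assms(3) show ?thesis by (simp add: partials_Cons)
  qed
  ultimately show ?thesis using assms(1,2) by (simp add: Ck_closure_def closure_ball)
qed

lemma C1_closure_mult:
  fixes f g :: "'a::euclidean_space \<Rightarrow> real"
  assumes f: "Ck_closure 1 (ball 0 1) f" and g: "Ck_closure 1 (ball 0 1) g"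
  shows "Ck_closure 1 (ball 0 1) (\<lambda>x. f x * g x)"
proof (rule C1_closureI)
  have df: "f differentiable (at x)" and dg: "g differentiable (at x)" if "x \<in> ball 0 1" for x
    using f g that by (auto simp: Ck_closure_def)
  show "continuous_on (cball 0 1) (\<lambda>x. f x * g x)"
    using f g by (intro continuous_intros Ck_closure_continuous)
  show "(\<lambda>x. f x * g x) differentiable (at x)" if "x \<in> ball 0 1" for x
    using df[OF that] dg[OF that] by simp
  fix b :: 'a assume b: "b \<in> Basis"
  obtain f' where f': "continuous_on (cball 0 1) f'" "\<And>x. x \<in> ball 0 1 \<Longrightarrow> f' x = partial_at b f x"
    using Ck_closure_extension[OF f, of "[b]"] b by (auto simp: partials_Cons)
  obtain g' where g': "continuous_on (cball 0 1) g'" "\<And>x. x \<in> ball 0 1 \<Longrightarrow> g' x = partial_at b g x"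
    using Ck_closure_extension[OF g, of "[b]"] b by (auto simp: partials_Cons)
  show "\<exists>h. continuous_on (cball 0 1) h \<and> (\<forall>x\<in>ball 0 1. h x = partial_at b (\<lambda>x. f x * g x) x)"
  proof (intro exI conjI ballI)
    show "continuous_on (cball 0 1) (\<lambda>x. f' x * g x + f x * g' x)"
      by (intro continuous_intros f'(1) g'(1) Ck_closure_continuous[OF f] Ck_closure_continuous[OF g])
    show "f' x * g x + f x * g' x = partial_at b (\<lambda>x. f x * g x) x" if "x \<in> ball 0 1" for x
      using that by (simp add: partial_at_mult[OF df dg] f'(2) g'(2))
  qed
qed

lemma smooth_C1_closure:
  assumes "smooth (f :: 'a::euclidean_space \<Rightarrow> real)" shows "Ck_closure 1 (ball 0 1) f"
proof (rule C1_closureI)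
  show "\<exists>g. continuous_on (cball 0 1) g \<and> (\<forall>x\<in>ball 0 1. g x = partial_at b f x)" if "b \<in> Basis" for b
    using smooth_continuous[OF smooth_partial_at[OF assms that]] by blast
qed (use assms in \<open>auto intro: smooth_continuous smooth_differentiable\<close>)

section \<open>Integration by parts for functions with a trace\<close>

lemma finite_multi_indices: "finite (multi_indices k :: 'a::euclidean_space list set)"
  unfolding multi_indices_def using finite_lists_length_le[of "Basis::'a set" k] by simp

lemma L2_norm_weak_deriv_le:
  assumes "bs \<in> multi_indices k"
  shows "L2_norm S (weak_deriv S bs f) \<le> sobolev_norm k S f"
proof -
  have "(L2_norm S (weak_deriv S bs f))\<^sup>2 \<le> (\<Sum>bs\<in>multi_indices k. (L2_norm S (weak_deriv S bs f))\<^sup>2)"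
    by (rule member_le_sum[OF assms]) (auto simp: finite_multi_indices)
  then show ?thesis unfolding sobolev_norm_def by (rule real_le_rsqrt)
qed

text \<open>The norm is taken of the weak derivative that \<^const>\<open>weak_deriv\<close> happens to choose; by \<open>weak_integral_eq\<close> any
  other one has the same pairing with \<open>g\<close>. The bound is uniform in \<open>f\<close>, so convergence in the
  Sobolev norm implies convergence of pairings of derivatives.\<close>

lemma sobolev_norm_pairing_bound:
  assumes g: "continuous_on (cball (0::'a::euclidean_space) 1) g"
  shows "\<exists>K\<ge>0. \<forall>k. \<forall>bs\<in>multi_indices k. \<forall>f. \<forall>v\<in>L2_space (ball 0 1). has_weak_deriv (ball 0 1) bs f v \<longrightarrow>
      \<bar>LINT x|lebesgue_on (ball 0 1). v x * g x\<bar> \<le> K * sobolev_norm k (ball 0 1) f"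
proof -
  let ?B = "ball (0::'a) 1" and ?L = "lebesgue_on (ball (0::'a) 1)"
  obtain K where K: "0 \<le> K" "\<And>f. f \<in> L2_space ?B \<Longrightarrow> \<bar>LINT x|?L. f x * g x\<bar> \<le> K * L2_norm ?B f"
    using L2_pairing_bound[OF g] by blast
  have "\<bar>LINT x|?L. v x * g x\<bar> \<le> K * sobolev_norm k ?B f"
    if bs: "bs \<in> multi_indices k" and v: "v \<in> L2_space ?B" "has_weak_deriv ?B bs f v" for k bs f v
  proof -
    have "\<exists>p. p \<in> L2_space ?B \<and> has_weak_deriv ?B bs f p" using v by blast
    from someI_ex[OF this, folded weak_deriv_def]
    have z: "weak_deriv ?B bs f \<in> L2_space ?B" "has_weak_deriv ?B bs f (weak_deriv ?B bs f)" by auto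
    have "(LINT x|?L. v x * g x) = (LINT x|?L. weak_deriv ?B bs f x * g x)"
    proof (rule weak_integral_eq[OF v(1) z(1) _ g])
      fix \<theta> assume "test_function ?B \<theta>"
      then have "(- 1) ^ length bs * (LINT x|?L. v x * \<theta> x) = (- 1) ^ length bs * (LINT x|?L. weak_deriv ?B bs f x * \<theta> x)"
        using v(2) z(2) unfolding has_weak_deriv_def by metis
      then show "(LINT x|?L. v x * \<theta> x) = (LINT x|?L. weak_deriv ?B bs f x * \<theta> x)" by simp
    qed
    also have "\<bar>\<dots>\<bar> \<le> K * L2_norm ?B (weak_deriv ?B bs f)" by (rule K(2)[OF z(1)])
    also have "\<dots> \<le> K * sobolev_norm k ?B f" by (intro mult_left_mono L2_norm_weak_deriv_le bs K)
    finally show ?thesis .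
  qed
  with K(1) show ?thesis by (intro exI[of _ K]) auto
qed

text \<open>The divergence theorem for \<open>\<psi> \<theta>\<close>, which vanishes on the sphere.\<close>

lemma smooth_has_weak_deriv:
  fixes \<psi> :: "'a::euclidean_space \<Rightarrow> real"
  assumes \<psi>: "smooth \<psi>" and b: "b \<in> Basis"
  shows "has_weak_deriv (ball 0 1) [b] \<psi> (partial_at b \<psi>)"
  unfolding has_weak_deriv_def
proof safe
  fix \<theta> :: "'a \<Rightarrow> real" assume \<theta>: "test_function (ball 0 1) \<theta>"
  then have s: "smooth \<theta>" by (simp add: test_function_def)
  have z: "\<theta> x = 0" if "x \<in> sphere 0 1" for x
    using \<theta> that closure_subset[of "{x. \<theta> x \<noteq> 0}"] unfolding test_function_def by force
  let ?L = "lebesgue_on (ball (0::'a) 1)"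
  have i: "integrable ?L (\<lambda>x. f x * g x)" if "smooth f" "smooth g" for f g
    by (intro integrable_L2_mult L2_space_continuous smooth_continuous that)
  have "Ck_closure 1 (ball 0 1) (\<lambda>x. \<psi> x * \<theta> x)" by (intro C1_closure_mult smooth_C1_closure \<psi> s)
  from integral_partial_at_ball[of 0, unfolded One_nat_def[symmetric], OF this b]
  have "(LINT x|?L. partial_at b (\<lambda>x. \<psi> x * \<theta> x) x) =
      real DIM('a) * (LINT x|?L. \<psi> (sgn x) * \<theta> (sgn x) * (sgn x \<bullet> b))" .
  also have "(\<lambda>x. \<psi> (sgn x) * \<theta> (sgn x) * (sgn x \<bullet> b)) = (\<lambda>x. 0)"
  proof
    fix x :: 'a
    show "\<psi> (sgn x) * \<theta> (sgn x) * (sgn x \<bullet> b) = 0"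
      using z[of "sgn x"] by (cases "x = 0") (auto simp: norm_sgn)
  qed
  finally have "(LINT x|?L. partial_at b \<psi> x * \<theta> x + \<psi> x * partial_at b \<theta> x) = 0"
    by (simp add: partial_at_mult smooth_differentiable \<psi> s)
  then have "(LINT x|?L. partial_at b \<psi> x * \<theta> x) + (LINT x|?L. \<psi> x * partial_at b \<theta> x) = 0"
    by (subst (asm) Bochner_Integration.integral_add) (intro i smooth_partial_at \<psi> s b | assumption)+
  then show "(LINT x|?L. \<psi> x * partials [b] \<theta> x) = (- 1) ^ length [b] * (LINT x|?L. partial_at b \<psi> x * \<theta> x)"
    by (simp add: partials_Cons)
qed

lemma integrable_mult_bounded:
  fixes u \<kappa> :: "'a \<Rightarrow> real"
  assumes "integrable M u" "\<kappa> \<in> borel_measurable M" "\<And>x. \<bar>\<kappa> x\<bar> \<le> K"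
  shows "integrable M (\<lambda>x. u x * \<kappa> x)"
proof (rule Bochner_Integration.integrable_bound[of _ "\<lambda>x. K * u x"])
  have "0 \<le> K" using assms(3)[of undefined] by linarith
  then show "AE x in M. norm (u x * \<kappa> x) \<le> norm (K * u x)"
    using assms(3) by (intro AE_I2) (auto simp: abs_mult mult.commute intro!: mult_right_mono)
qed (use assms in simp_all)

lemma sphere_kernel_bounded:
  fixes G :: "'a::euclidean_space \<Rightarrow> real"
  assumes G: "continuous_on (cball 0 1) G" and b: "b \<in> Basis"
  obtains M where "0 < M" "\<And>x. \<bar>indicator (sphere 0 1) x * G x * (x \<bullet> b)\<bar> \<le> M"
    "(\<lambda>x. indicator (sphere 0 1) x * G x * (x \<bullet> b)) \<in> borel_measurable borel"
proof -
  obtain M where M: "0 < M" "\<And>x. x \<in> cball 0 1 \<Longrightarrow> \<bar>G x\<bar> \<le> M"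
    using continuous_on_cball_bounded[OF G] by blast
  have [measurable]: "(\<lambda>x. indicator (sphere 0 1) x * G x) \<in> borel_measurable borel"
    using borel_measurable_continuous_on_indicator[of "sphere 0 1" G] continuous_on_subset[OF G, of "sphere 0 1"] by auto
  have "\<bar>indicator (sphere 0 1) x * G x * (x \<bullet> b)\<bar> \<le> M" for x
  proof (cases "x \<in> sphere 0 1")
    case True
    then have "\<bar>G x\<bar> * \<bar>x \<bullet> b\<bar> \<le> M * 1"
      using M Basis_le_norm[OF b, of x] by (intro mult_mono) auto
    with True show ?thesis by (simp add: abs_mult)
  qed (use M(1) in simp)
  moreover have "(\<lambda>x. indicator (sphere 0 1) x * G x * (x \<bullet> b)) \<in> borel_measurable borel" by measurable
  ultimately show ?thesis using that M(1) by blast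
qed

text \<open>For smooth functions in place of \<open>f\<close> this is the divergence theorem for the product with \<open>G\<close>. Both sides
  pass to the limit along the approximations in the definition of a trace: the left hand side
  by convergence in \<open>H\<^sup>1\<close>, the right hand side by convergence in \<open>L\<^sub>2\<close> of the sphere.\<close>

lemma trace_integral_by_parts:
  fixes f h G :: "'a::euclidean_space \<Rightarrow> real"
  assumes tr: "has_trace f h" and G: "Ck_closure 1 (ball 0 1) G" and b: "b \<in> Basis"
  shows "(LINT x|lebesgue_on (ball 0 1). weak_deriv (ball 0 1) [b] f x * G x) +
      (LINT x|lebesgue_on (ball 0 1). f x * partial_at b G x) =
    (LINT x|sphere_measure. h x * (indicator (sphere 0 1) x * G x * (x \<bullet> b)))"
proof -
  let ?L = "lebesgue_on (ball (0::'a) 1)" and ?B = "ball (0::'a) 1" and ?S = "sphere_measure :: 'a measure"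
  have f: "f \<in> sobolev 1 ?B" and h: "h \<in> borel_measurable borel" "integrable ?S (\<lambda>x. (h x)\<^sup>2)"
    using tr by (auto simp: has_trace_def)
  obtain \<psi> where s: "\<And>n. smooth (\<psi> n)"
    and lf: "(\<lambda>n. sobolev_norm 1 ?B (\<lambda>x. \<psi> n x - f x)) \<longlonglongrightarrow> 0"
    and lh: "(\<lambda>n. LINT x|?S. (\<psi> n x - h x)\<^sup>2) \<longlonglongrightarrow> 0"
    using tr by (auto simp: has_trace_def)
  note Gc = Ck_closure_continuous[OF G]
  have b1: "[b] \<in> multi_indices 1" and n1: "[] \<in> multi_indices 1" using b by (auto simp: multi_indices_def)
  obtain G' where G': "continuous_on (cball 0 1) G'" "\<And>x. x \<in> ?B \<Longrightarrow> G' x = partial_at b G x"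
    using Ck_closure_extension[OF G b1] by (auto simp: partials_Cons)
  define w where "w = weak_deriv ?B [b] f"
  have f2: "f \<in> L2_space ?B" by (rule sobolev_L2_space[OF f])
  have w: "w \<in> L2_space ?B" "has_weak_deriv ?B [b] f w"
    using weak_deriv_sobolev[OF f b1] by (auto simp: w_def)
  have \<psi>2: "\<psi> n \<in> L2_space ?B" "partial_at b (\<psi> n) \<in> L2_space ?B" for n
    using s b by (auto intro!: L2_space_continuous smooth_continuous smooth_partial_at)
  define e where "e n = (\<lambda>x. \<psi> n x - f x)" for n
  define e' where "e' n = (\<lambda>x. partial_at b (\<psi> n) x - w x)" for n
  have e2: "e n \<in> L2_space ?B" "e' n \<in> L2_space ?B" for n
    unfolding e_def e'_def by (intro L2_space_diff \<psi>2 f2 w)+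
  have we0: "has_weak_deriv ?B [] (e n) (e n)" for n by (simp add: has_weak_deriv_def)
  have we1: "has_weak_deriv ?B [b] (e n) (e' n)" for n
    unfolding has_weak_deriv_def
  proof safe
    fix \<theta> assume \<theta>: "test_function ?B \<theta>"
    note c = test_function_continuous[OF \<theta>] test_function_continuous[OF test_function_partial_at[OF \<theta> b]]
    show "(LINT x|?L. e n x * partials [b] \<theta> x) = (- 1) ^ length [b] * (LINT x|?L. e' n x * \<theta> x)"
      using w(2) smooth_has_weak_deriv[OF s b, of n] \<theta> unfolding has_weak_deriv_def e_def e'_def
      by (simp add: partials_Cons left_diff_distrib integrable_L2_mult \<psi>2 f2 w c)
  qed
  have key: "(\<lambda>n. LINT x|?L. v n x * g x) \<longlonglongrightarrow> 0"
    if bs: "bs \<in> multi_indices 1" and v: "\<And>n. v n \<in> L2_space ?B" "\<And>n. has_weak_deriv ?B bs (e n) (v n)"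
      and g: "continuous_on (cball 0 1) g" for bs v g
  proof -
    obtain K where K: "\<forall>k. \<forall>bs\<in>multi_indices k. \<forall>f. \<forall>v\<in>L2_space ?B. has_weak_deriv ?B bs f v \<longrightarrow>
        \<bar>LINT x|?L. v x * g x\<bar> \<le> K * sobolev_norm k ?B f"
      using sobolev_norm_pairing_bound[OF g] by (elim exE conjE)
    have "\<bar>LINT x|?L. v n x * g x\<bar> \<le> K * sobolev_norm 1 ?B (e n)" for n
      using K bs v by blast
    moreover have "(\<lambda>n. K * sobolev_norm 1 ?B (e n)) \<longlonglongrightarrow> 0"
      using tendsto_mult_left[OF lf, of K] by (simp add: e_def)
    ultimately show ?thesis by (rule LIMSEQ_0_abs_le)
  qed
  have "(\<lambda>n. (LINT x|?L. e' n x * G x) + (LINT x|?L. e n x * G' x)) \<longlonglongrightarrow> 0 + 0"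
    by (intro tendsto_add key[OF b1 e2(2) we1 Gc] key[OF n1 e2(1) we0 G'(1)])
  moreover have "(LINT x|?L. e' n x * G x) + (LINT x|?L. e n x * G' x) =
      (LINT x|?S. \<psi> n x * (indicator (sphere 0 1) x * G x * (x \<bullet> b))) - ((LINT x|?L. w x * G x) + (LINT x|?L. f x * G' x))" for n
  proof -
    have C: "Ck_closure 1 ?B (\<lambda>x. \<psi> n x * G x)" by (intro C1_closure_mult smooth_C1_closure s G)
    have "(LINT x|?L. partial_at b (\<psi> n) x * G x) + (LINT x|?L. \<psi> n x * G' x) =
        (LINT x|?L. partial_at b (\<psi> n) x * G x + \<psi> n x * G' x)"
      by (intro Bochner_Integration.integral_add[symmetric] integrable_L2_mult \<psi>2 Gc G')
    also have "\<dots> = (LINT x|?L. partial_at b (\<lambda>x. \<psi> n x * G x) x)"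
    proof (rule Bochner_Integration.integral_cong[OF refl])
      fix x assume "x \<in> space ?L"
      then have x: "x \<in> ?B" by simp
      then have "G differentiable (at x)" using G by (auto simp: Ck_closure_def)
      then show "partial_at b (\<psi> n) x * G x + \<psi> n x * G' x = partial_at b (\<lambda>x. \<psi> n x * G x) x"
        using G'(2)[OF x] smooth_differentiable[OF s] by (simp add: partial_at_mult)
    qed
    also have "\<dots> = (LINT x|?S. indicator (sphere 0 1) x * (\<psi> n x * G x) * (x \<bullet> b))"
      using divergence_theorem_ball[of 0 "\<lambda>x. \<psi> n x * G x", OF _ b] C by simp
    also have "\<dots> = (LINT x|?S. \<psi> n x * (indicator (sphere 0 1) x * G x * (x \<bullet> b)))"
      by (simp add: mult_ac)
    finally show ?thesis
      unfolding e_def e'_def by (simp add: left_diff_distrib integrable_L2_mult \<psi>2 f2 w Gc G')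
  qed
  ultimately have l1: "(\<lambda>n. LINT x|?S. \<psi> n x * (indicator (sphere 0 1) x * G x * (x \<bullet> b)))
      \<longlonglongrightarrow> (LINT x|?L. w x * G x) + (LINT x|?L. f x * G' x)"
    by (simp add: LIM_zero_iff)
  have l2: "(\<lambda>n. LINT x|?S. \<psi> n x * (indicator (sphere 0 1) x * G x * (x \<bullet> b)))
      \<longlonglongrightarrow> (LINT x|?S. h x * (indicator (sphere 0 1) x * G x * (x \<bullet> b)))"
  proof -
    interpret S: finite_measure ?S by (rule finite_measure_sphere_measure)
    define \<kappa> where "\<kappa> x = indicator (sphere 0 1) x * G x * (x \<bullet> b)" for x
    obtain M where M: "0 < M" and \<kappa>M: "\<And>x. \<bar>\<kappa> x\<bar> \<le> M" and \<kappa>[measurable]: "\<kappa> \<in> borel_measurable borel"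
      using sphere_kernel_bounded[OF Gc b] unfolding \<kappa>_def by blast
    have [measurable]: "\<psi> n \<in> borel_measurable borel" for n
      by (intro borel_measurable_continuous_onI smooth_continuous s)
    note [measurable] = h(1)
    have sq: "integrable ?S (\<lambda>x. (\<psi> n x - h x)\<^sup>2)" and sp: "integrable ?S (\<lambda>x. (\<psi> n x)\<^sup>2)" for n
    proof -
      obtain N where N: "0 < N" "\<And>x. x \<in> cball 0 1 \<Longrightarrow> \<bar>\<psi> n x\<bar> \<le> N"
        using continuous_on_cball_bounded[OF smooth_continuous[OF s]] by blast
      show sp: "integrable ?S (\<lambda>x. (\<psi> n x)\<^sup>2)"
      proof (rule S.integrable_const_bound)
        show "AE x in ?S. norm ((\<psi> n x)\<^sup>2) \<le> N\<^sup>2"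
          using AE_sphere_measure by eventually_elim (use N in \<open>auto simp: abs_le_square_iff[symmetric]\<close>)
      qed simp
      show "integrable ?S (\<lambda>x. (\<psi> n x - h x)\<^sup>2)"
      proof (rule Bochner_Integration.integrable_bound)
        show "integrable ?S (\<lambda>x. 2 * (\<psi> n x)\<^sup>2 + 2 * (h x)\<^sup>2)" using sp h(2) by simp
        show "AE x in ?S. norm ((\<psi> n x - h x)\<^sup>2) \<le> norm (2 * (\<psi> n x)\<^sup>2 + 2 * (h x)\<^sup>2)"
        proof (rule AE_I2)
          fix x
          have "(\<psi> n x - h x)\<^sup>2 \<le> 2 * (\<psi> n x)\<^sup>2 + 2 * (h x)\<^sup>2"
            using zero_le_power2[of "\<psi> n x + h x"] by (simp add: power2_eq_square algebra_simps)
          then show "norm ((\<psi> n x - h x)\<^sup>2) \<le> norm (2 * (\<psi> n x)\<^sup>2 + 2 * (h x)\<^sup>2)" by simp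
        qed
      qed simp
    qed
    have ik: "integrable ?S (\<lambda>x. u x * \<kappa> x)" if "integrable ?S u" for u
      by (rule integrable_mult_bounded[OF that _ \<kappa>M]) simp
    have ih: "integrable ?S h"
      by (rule integral_abs_square_bound(1)[OF S.finite_measure_axioms _ h(2)]) simp
    have ip: "integrable ?S (\<psi> n)" for n
      by (rule integral_abs_square_bound(1)[OF S.finite_measure_axioms _ sp]) simp
    have "\<bar>(LINT x|?S. \<psi> n x * \<kappa> x) - (LINT x|?S. h x * \<kappa> x)\<bar>
        \<le> M * (sqrt (measure ?S (space ?S)) * sqrt (LINT x|?S. (\<psi> n x - h x)\<^sup>2))" for n
    proof -
      have "(LINT x|?S. \<psi> n x * \<kappa> x) - (LINT x|?S. h x * \<kappa> x) = (LINT x|?S. (\<psi> n x - h x) * \<kappa> x)"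
        using ik[OF ih] ik[OF ip[of n]] by (simp add: left_diff_distrib)
      also have "\<bar>\<dots>\<bar> \<le> (LINT x|?S. M * \<bar>\<psi> n x - h x\<bar>)"
      proof (rule integral_abs_bound_integral)
        show "integrable ?S (\<lambda>x. (\<psi> n x - h x) * \<kappa> x)" using ih ip by (intro ik) auto
        show "integrable ?S (\<lambda>x. M * \<bar>\<psi> n x - h x\<bar>)" using ih ip[of n] by (intro integrable_mult_right integrable_abs) simp
        show "\<bar>(\<psi> n x - h x) * \<kappa> x\<bar> \<le> M * \<bar>\<psi> n x - h x\<bar>" for x
          using mult_left_mono[OF \<kappa>M[of x], of "\<bar>\<psi> n x - h x\<bar>"] by (simp add: abs_mult mult.commute)
      qed
      also have "\<dots> = M * (LINT x|?S. \<bar>\<psi> n x - h x\<bar>)" by simp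
      also have "\<dots> \<le> M * (sqrt (measure ?S (space ?S)) * sqrt (LINT x|?S. (\<psi> n x - h x)\<^sup>2))"
        using M by (intro mult_left_mono integral_abs_square_bound(2)[OF S.finite_measure_axioms _ sq]) auto
      finally show ?thesis .
    qed
    moreover have "(\<lambda>n. M * (sqrt (measure ?S (space ?S)) * sqrt (LINT x|?S. (\<psi> n x - h x)\<^sup>2))) \<longlonglongrightarrow> 0"
      using tendsto_mult_left[OF tendsto_mult_left[OF tendsto_real_sqrt[OF lh]]] by simp
    ultimately have "(\<lambda>n. (LINT x|?S. \<psi> n x * \<kappa> x) - (LINT x|?S. h x * \<kappa> x)) \<longlonglongrightarrow> 0"
      by (rule LIMSEQ_0_abs_le)
    then show ?thesis unfolding \<kappa>_def by (simp add: LIM_zero_iff)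
  qed
  have "(LINT x|?L. f x * G' x) = (LINT x|?L. f x * partial_at b G x)"
    by (rule Bochner_Integration.integral_cong) (auto simp: G'(2))
  with LIMSEQ_unique[OF l1 l2] show ?thesis by (simp add: w_def)
qed

section \<open>Green's formula for the clamped operator\<close>

text \<open>Near \<open>x\<close> radial symmetry gives \<open>\<phi>(y) = \<phi>(|y| x)\<close>, and the derivative at \<open>x\<close> in direction \<open>x\<close> is zero, so
  \<open>\<phi>(y) = o(1 - |y|)\<close>. At depth \<open>t\<close> below \<open>x\<close> there is room for a segment of length \<open>t / 2\<close> in any direction
  \<open>b\<close>, and the mean value theorem on it yields points tending to \<open>x\<close> where the partial derivative tends to 0.\<close>

lemma radial_clamped_gradient_zero:
  fixes \<phi> g :: "'a::euclidean_space \<Rightarrow> real"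
  assumes \<phi>: "Ck_closure (Suc k) (ball 0 1) \<phi>" and x: "x \<in> sphere 0 1" and 0: "\<phi> x = 0"
    and D: "(\<phi> has_derivative D) (at x within cball 0 1)" "D x = 0"
    and radial: "\<And>y z. y \<in> cball 0 1 \<Longrightarrow> z \<in> cball 0 1 \<Longrightarrow> norm y = norm z \<Longrightarrow> \<phi> y = \<phi> z"
    and b: "b \<in> Basis" and g: "continuous_on (cball 0 1) g" "\<And>y. y \<in> ball 0 1 \<Longrightarrow> g y = partial_at b \<phi> y"
  shows "g x = 0"
proof -
  have nx: "norm x = 1" and nb: "norm b = 1" using x b by auto
  have "\<bar>g x\<bar> \<le> e" if "0 < e" for e
  proof -
    \<comment> \<open>six times \<open>e'\<close> bounds the derivative at the intermediate point, one more the oscillation of \<open>g\<close>\<close>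
    define e' where "e' = e / 7"
    have e': "0 < e'" using that by (simp add: e'_def)
    interpret bounded_linear D using D(1) by (rule has_derivative_bounded_linear)
    obtain d1 where d1: "0 < d1" "\<And>y. y \<in> cball 0 1 \<Longrightarrow> norm (y - x) < d1 \<Longrightarrow> norm (\<phi> y - \<phi> x - D (y - x)) \<le> e' * norm (y - x)"
      using D(1) e' unfolding has_derivative_within_alt by blast
    have small: "\<bar>\<phi> y\<bar> \<le> e' * (1 - norm y)" if y: "y \<in> cball 0 1" "1 - norm y < d1" for y
    proof -
      \<comment> \<open>by radial symmetry \<open>\<phi>\<close> has the same value at this point on the ray through \<open>x\<close>\<close>
      let ?z = "norm y *\<^sub>R x"
      have z: "?z - x = (norm y - 1) *\<^sub>R x" by (simp add: algebra_simps)
      have nz: "norm (?z - x) = 1 - norm y" unfolding z using y nx by simp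
      have "\<phi> y = \<phi> ?z" using y nx by (intro radial) auto
      moreover have "norm (\<phi> ?z - \<phi> x - D (?z - x)) \<le> e' * norm (?z - x)"
        using y nx nz by (intro d1) auto
      moreover have "D (?z - x) = 0" unfolding z using D(2) by (simp add: scaleR)
      ultimately show ?thesis using 0 nz by simp
    qed
    obtain d2 where d2: "0 < d2" "\<And>y. y \<in> cball 0 1 \<Longrightarrow> dist y x < d2 \<Longrightarrow> dist (g y) (g x) < e'"
      using g(1) x e' unfolding continuous_on_iff by (metis sphere_cball subsetD)
    define t where "t = min (min d1 d2) 1 / 2"
    have t: "0 < t" "t \<le> d1 / 2" "t \<le> d2 / 2" "t < 1" using d1(1) d2(1) by (auto simp: t_def)
    define y where "y s = (1 - t) *\<^sub>R x + s *\<^sub>R b" for s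
    have y: "y s - x = s *\<^sub>R b - t *\<^sub>R x" for s by (simp add: y_def algebra_simps)
    have ny: "norm (y s) \<le> 1 - t + s" "norm (y s) \<ge> 1 - t - s" "norm (y s - x) \<le> t + s" if "0 \<le> s" for s
    proof -
      show "norm (y s) \<le> 1 - t + s"
        using norm_triangle_ineq[of "(1 - t) *\<^sub>R x" "s *\<^sub>R b"] that t nx nb by (simp add: y_def)
      show "norm (y s) \<ge> 1 - t - s"
        using norm_diff_ineq[of "(1 - t) *\<^sub>R x" "s *\<^sub>R b"] that t nx nb by (simp add: y_def)
      show "norm (y s - x) \<le> t + s"
        using norm_triangle_ineq4[of "s *\<^sub>R b" "t *\<^sub>R x"] that t nx nb by (simp add: y)
    qed
    have inb: "y s \<in> ball 0 1" if "0 \<le> s" "s \<le> t / 2" for s using ny(1)[OF that(1)] that t by auto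
    have der: "((\<lambda>s. \<phi> (y s)) has_real_derivative partial_at b \<phi> (y s)) (at s)" if "0 \<le> s" "s \<le> t / 2" for s
      using has_derivative_along_line[of \<phi> "(1 - t) *\<^sub>R x" s b] \<phi> inb[OF that]
      by (auto simp: y_def Ck_closure_def)
    obtain s where s: "0 < s" "s < t / 2" "\<phi> (y (t / 2)) - \<phi> (y 0) = (t / 2 - 0) * partial_at b \<phi> (y s)"
      using MVT2[of 0 "t / 2" "\<lambda>s. \<phi> (y s)" "\<lambda>s. partial_at b \<phi> (y s)"] der t by auto
    have "\<bar>\<phi> (y r)\<bar> \<le> e' * (3 / 2 * t)" if r: "0 \<le> r" "r \<le> t / 2" for r
    proof -
      have "\<bar>\<phi> (y r)\<bar> \<le> e' * (1 - norm (y r))"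
        using inb[OF r] ny(2)[OF r(1)] r t by (intro small) auto
      also have "\<dots> \<le> e' * (3 / 2 * t)" using ny(2)[OF r(1)] r e' by (intro mult_left_mono) auto
      finally show ?thesis .
    qed
    from this[of "t / 2"] this[of 0] have "\<bar>\<phi> (y (t / 2)) - \<phi> (y 0)\<bar> \<le> e' * (3 * t)" using t by simp
    then have "t / 2 * \<bar>partial_at b \<phi> (y s)\<bar> \<le> t / 2 * (6 * e')" using s(3) t(1) by (simp add: abs_mult)
    then have "\<bar>partial_at b \<phi> (y s)\<bar> \<le> 6 * e'" using t(1) by (simp only: mult_le_cancel_left_pos half_gt_zero)
    then have "\<bar>g (y s)\<bar> \<le> 6 * e'" using g(2)[OF inb] s by simp
    moreover have "dist (g (y s)) (g x) < e'"
      using inb[of s] s ny(3)[of s] t by (intro d2) (auto simp: dist_norm)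
    ultimately show ?thesis using that unfolding dist_real_def e'_def by linarith
  qed
  then show ?thesis using field_le_epsilon[of "\<bar>g x\<bar>" 0] by simp
qed

text \<open>What Green's formula uses of the eigenfunction. The gradient on the sphere is that of the
  continuous extension from inside.\<close>

locale clamped_C4_function =
  fixes \<phi> :: "'a::euclidean_space \<Rightarrow> real"
  assumes C4: "Ck_closure 4 (ball 0 1) \<phi>"
    and zero: "\<And>x. x \<in> sphere 0 1 \<Longrightarrow> \<phi> x = 0"
    and gradient_zero: "\<And>b g x. b \<in> Basis \<Longrightarrow> continuous_on (cball 0 1) g \<Longrightarrow>
      (\<And>y. y \<in> ball 0 1 \<Longrightarrow> g y = partial_at b \<phi> y) \<Longrightarrow> x \<in> sphere 0 1 \<Longrightarrow> g x = 0"
begin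

lemma continuous: "continuous_on (cball 0 1) \<phi>"
  using C4 by (rule Ck_closure_continuous)

text \<open>Integrate by parts once against \<open>\<phi>\<close> and once against its derivative; both vanish on the sphere.\<close>

lemma weak_deriv_move_two:
  assumes u: "u \<in> sobolev k (ball 0 1)" and bs: "bs @ [c, c] \<in> multi_indices k"
    and g: "continuous_on (cball 0 1) g" "\<And>x. x \<in> ball 0 1 \<Longrightarrow> g x = partials [c, c] \<phi> x"
  shows "(LINT x|lebesgue_on (ball 0 1). weak_deriv (ball 0 1) (bs @ [c, c]) u x * \<phi> x) =
    (LINT x|lebesgue_on (ball 0 1). weak_deriv (ball 0 1) bs u x * g x)"
proof -
  let ?w = "\<lambda>bs. weak_deriv (ball 0 1) bs u" and ?I = "\<lambda>f. LINT x|lebesgue_on (ball (0::'a) 1). f x"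
  have c: "c \<in> Basis" and m: "bs \<in> multi_indices k" "bs @ [c] \<in> multi_indices k" "(bs @ [c]) @ [c] \<in> multi_indices k"
    using bs by (auto simp: multi_indices_def)
  have \<phi>: "Ck_closure (Suc (Suc 2)) (ball 0 1) \<phi>" using C4 by (simp add: numeral_eq_Suc)
  obtain h where h: "Ck_closure (Suc 2) (ball 0 1) h" "\<And>x. x \<in> ball 0 1 \<Longrightarrow> h x = partial_at c \<phi> x"
    using Ck_closure_partial_at[OF \<phi> c] by blast
  have h0: "h x = 0" if "x \<in> sphere 0 1" for x
    using gradient_zero[OF c Ck_closure_continuous[OF h(1)] h(2) that] by blast
  have hc: "partial_at c h x = g x" if "x \<in> ball 0 1" for x
    using partial_at_cong_open[OF open_ball that h(2)] g(2)[OF that] by (simp add: partials_Cons)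
  have "?I (\<lambda>x. ?w (bs @ [c]) x * partial_at c \<phi> x) = - ?I (\<lambda>x. ?w ((bs @ [c]) @ [c]) x * \<phi> x)"
    by (rule weak_partial_integral_by_parts[OF weak_deriv_sobolev(1)[OF u m(2)]
          weak_deriv_sobolev(1)[OF u m(3)] has_weak_deriv_snoc[OF u m(3)] c \<phi> zero])
  moreover have "?I (\<lambda>x. ?w bs x * partial_at c h x) = - ?I (\<lambda>x. ?w (bs @ [c]) x * h x)"
    by (rule weak_partial_integral_by_parts[OF weak_deriv_sobolev(1)[OF u m(1)]
          weak_deriv_sobolev(1)[OF u m(2)] has_weak_deriv_snoc[OF u m(2)] c h(1) h0])
  moreover have "?I (\<lambda>x. ?w (bs @ [c]) x * partial_at c \<phi> x) = ?I (\<lambda>x. ?w (bs @ [c]) x * h x)"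
    by (rule Bochner_Integration.integral_cong) (auto simp: h(2))
  moreover have "?I (\<lambda>x. ?w bs x * partial_at c h x) = ?I (\<lambda>x. ?w bs x * g x)"
    by (rule Bochner_Integration.integral_cong) (auto simp: hc)
  ultimately show ?thesis by simp
qed

end

text \<open>The boundary terms of the first integration by parts add up to the integral of \<open>G\<close> times the normal
  derivative of \<open>u\<close>, those of the second contain the trace of \<open>u\<close>; both are zero.\<close>

lemma clamped_weak_laplacian:
  fixes u G :: "'a::euclidean_space \<Rightarrow> real"
  assumes u: "u \<in> sobolev k (ball 0 1)" "2 \<le> k" and cl: "clamped u" and G: "Ck_closure 2 (ball 0 1) G"
  shows "(\<Sum>b\<in>Basis. LINT x|lebesgue_on (ball 0 1). weak_deriv (ball 0 1) [b, b] u x * G x) =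
    (\<Sum>b\<in>Basis. LINT x|lebesgue_on (ball 0 1). u x * partials [b, b] G x)"
proof -
  let ?w = "\<lambda>bs. weak_deriv (ball 0 1) bs u" and ?I = "\<lambda>f. LINT x|lebesgue_on (ball (0::'a) 1). f x"
  let ?S = "sphere_measure :: 'a measure"
  define K where "K b x = indicator (sphere 0 1) x * G x * (x \<bullet> b)" for b x
  obtain h where h: "\<And>b. b \<in> Basis \<Longrightarrow> has_trace (?w [b]) (h b)"
    and h0: "AE x in ?S. (\<Sum>b\<in>Basis. (x \<bullet> b) * h b x) = 0"
    and tr: "has_trace u (\<lambda>x. 0)"
    using cl unfolding clamped_def by blast
  have G1: "Ck_closure 1 (ball 0 1) G" and G2: "Ck_closure (Suc 1) (ball 0 1) G"
    using G Ck_closure_mono[of 1 G] by (simp_all add: numeral_2_eq_2)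
  note Gc = Ck_closure_continuous[OF G]
  have 1: "?I (\<lambda>x. ?w [b, b] x * G x) + ?I (\<lambda>x. ?w [b] x * partial_at b G x) = (LINT x|?S. h b x * K b x)"
    if b: "b \<in> Basis" for b
  proof -
    have m: "[b] \<in> multi_indices k" "[b] @ [b] \<in> multi_indices k" using u(2) b by (auto simp: multi_indices_def)
    have s: "?w [b] \<in> sobolev 1 (ball 0 1)" using h[OF b] by (simp add: has_trace_def)
    have m1: "[b] \<in> multi_indices 1" using b by (simp add: multi_indices_def)
    note ww = weak_deriv_sobolev[OF s m1]
    note wb = weak_deriv_sobolev(1)[OF u(1) m(2)] has_weak_deriv_snoc[OF u(1) m(2)]
    have "?I (\<lambda>x. ?w ([b] @ [b]) x * G x) = ?I (\<lambda>x. weak_deriv (ball 0 1) [b] (?w [b]) x * G x)"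
      by (rule weak_integral_eq[OF wb(1) ww(1) _ Gc])
         (use wb(2) ww(2) in \<open>auto simp: has_weak_deriv_def\<close>)
    then show ?thesis using trace_integral_by_parts[OF h[OF b] G1 b] by (simp add: K_def)
  qed
  have 2: "?I (\<lambda>x. ?w [b] x * partial_at b G x) = - ?I (\<lambda>x. u x * partials [b, b] G x)" if b: "b \<in> Basis" for b
  proof -
    obtain g where g: "Ck_closure 1 (ball 0 1) g" "\<And>x. x \<in> ball 0 1 \<Longrightarrow> g x = partial_at b G x"
      using Ck_closure_partial_at[OF G2 b] by blast
    have "partial_at b g x = partials [b, b] G x" if "x \<in> ball 0 1" for x
      using partial_at_cong_open[OF open_ball that g(2)] by (simp add: partials_Cons)
    then have "?I (\<lambda>x. u x * partials [b, b] G x) = ?I (\<lambda>x. u x * partial_at b g x)"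
      by (intro Bochner_Integration.integral_cong) auto
    moreover have "?I (\<lambda>x. ?w [b] x * partial_at b G x) = ?I (\<lambda>x. ?w [b] x * g x)"
      by (intro Bochner_Integration.integral_cong) (auto simp: g(2))
    ultimately show ?thesis using trace_integral_by_parts[OF tr g(1) b] by simp
  qed
  have "(\<Sum>b\<in>Basis. LINT x|?S. h b x * K b x) = (LINT x|?S. (\<Sum>b\<in>Basis. h b x * K b x))"
  proof (rule Bochner_Integration.integral_sum[symmetric])
    fix b :: 'a assume b: "b \<in> Basis"
    have hb: "h b \<in> borel_measurable borel" "integrable ?S (\<lambda>x. (h b x)\<^sup>2)"
      using h[OF b] by (auto simp: has_trace_def)
    have "integrable ?S (h b)"
      by (rule integral_abs_square_bound(1)[OF finite_measure_sphere_measure _ hb(2)]) (use hb(1) in simp)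
    moreover obtain M where "\<And>x. \<bar>K b x\<bar> \<le> M" "K b \<in> borel_measurable borel"
      using sphere_kernel_bounded[OF Gc b] unfolding K_def by blast
    ultimately show "integrable ?S (\<lambda>x. h b x * K b x)" by (intro integrable_mult_bounded) auto
  qed
  also have "\<dots> = 0"
  proof (rule integral_eq_zero_AE)
    show "AE x in ?S. (\<Sum>b\<in>Basis. h b x * K b x) = 0"
      using h0
    proof eventually_elim
      case (elim x)
      have "(\<Sum>b\<in>Basis. h b x * K b x) = (indicator (sphere 0 1) x * G x) * (\<Sum>b\<in>Basis. (x \<bullet> b) * h b x)"
        unfolding sum_distrib_left K_def by (simp add: mult_ac)
      with elim show ?case by simp
    qed
  qed
  finally have "(\<Sum>b\<in>Basis. LINT x|?S. h b x * K b x) = 0" .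
  moreover have "(\<Sum>b\<in>Basis. LINT x|?S. h b x * K b x) =
      (\<Sum>b\<in>Basis. ?I (\<lambda>x. ?w [b, b] x * G x)) - (\<Sum>b\<in>Basis. ?I (\<lambda>x. u x * partials [b, b] G x))"
    unfolding sum_subtractf[symmetric] using 1 2 by (intro sum.cong) (auto simp: algebra_simps)
  ultimately show ?thesis by simp
qed

context clamped_C4_function
begin

lemma second_partial:
  assumes c: "c \<in> Basis"
  obtains g where "Ck_closure 2 (ball 0 1) g" "\<And>x. x \<in> ball 0 1 \<Longrightarrow> g x = partials [c, c] \<phi> x"
proof -
  have \<phi>: "Ck_closure (Suc (Suc 2)) (ball 0 1) \<phi>" using C4 by (simp add: numeral_eq_Suc)
  obtain h where h: "Ck_closure (Suc 2) (ball 0 1) h" "\<And>x. x \<in> ball 0 1 \<Longrightarrow> h x = partial_at c \<phi> x"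
    using Ck_closure_partial_at[OF \<phi> c] by blast
  obtain g where g: "Ck_closure 2 (ball 0 1) g" "\<And>x. x \<in> ball 0 1 \<Longrightarrow> g x = partial_at c h x"
    using Ck_closure_partial_at[OF h(1) c] by blast
  have "g x = partials [c, c] \<phi> x" if "x \<in> ball 0 1" for x
    using g(2)[OF that] partial_at_cong_open[OF open_ball that h(2)] by (simp add: partials_Cons)
  with g(1) that show ?thesis by blast
qed

lemma integrable_L2_mult_partials:
  assumes "u \<in> L2_space (ball 0 1)" "bs \<in> multi_indices 4"
  shows "integrable (lebesgue_on (ball 0 1)) (\<lambda>x. u x * partials bs \<phi> x)"
proof -
  obtain g where g: "continuous_on (cball 0 1) g" "\<And>x. x \<in> ball 0 1 \<Longrightarrow> g x = partials bs \<phi> x"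
    using Ck_closure_extension[OF C4 assms(2)] by blast
  have "integrable (lebesgue_on (ball 0 1)) (\<lambda>x. u x * g x) \<longleftrightarrow> integrable (lebesgue_on (ball 0 1)) (\<lambda>x. u x * partials bs \<phi> x)"
    by (rule Bochner_Integration.integrable_cong) (auto simp: g(2))
  then show ?thesis using integrable_L2_mult[OF assms(1) g(1)] by simp
qed

lemma integral_weak_laplacian:
  assumes u: "u \<in> sobolev 4 (ball 0 1)"
  shows "(LINT x|lebesgue_on (ball 0 1). weak_laplacian (ball 0 1) u x * \<phi> x) =
    (LINT x|lebesgue_on (ball 0 1). u x * laplacian \<phi> x)"
proof -
  let ?I = "\<lambda>f. LINT x|lebesgue_on (ball (0::'a) 1). f x"
  note u2 = sobolev_L2_space[OF u]
  have m: "[b, b] \<in> multi_indices 4" "[] \<in> multi_indices 4" if "b \<in> Basis" for b :: 'a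
    using that by (auto simp: multi_indices_def)
  have "?I (\<lambda>x. weak_deriv (ball 0 1) [b, b] u x * \<phi> x) = ?I (\<lambda>x. u x * partials [b, b] \<phi> x)" if b: "b \<in> Basis" for b
  proof -
    obtain g where g: "Ck_closure 2 (ball 0 1) g" "\<And>x. x \<in> ball 0 1 \<Longrightarrow> g x = partials [b, b] \<phi> x"
      using second_partial[OF b] by blast
    note gc = Ck_closure_continuous[OF g(1)]
    have "?I (\<lambda>x. weak_deriv (ball 0 1) ([] @ [b, b]) u x * \<phi> x) = ?I (\<lambda>x. weak_deriv (ball 0 1) [] u x * g x)"
      by (rule weak_deriv_move_two[OF u _ gc g(2)]) (use m[OF b] in simp_all)
    also have "\<dots> = ?I (\<lambda>x. u x * g x)"
      by (rule weak_integral_eq[OF _ u2 _ gc])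
         (use weak_deriv_sobolev[OF u m(2)[OF b]] in \<open>auto simp: has_weak_deriv_def\<close>)
    also have "\<dots> = ?I (\<lambda>x. u x * partials [b, b] \<phi> x)"
      by (rule Bochner_Integration.integral_cong) (auto simp: g(2))
    finally show ?thesis by simp
  qed
  then show ?thesis
    unfolding weak_laplacian_def laplacian_def sum_distrib_right sum_distrib_left
    by (subst (1 2) Bochner_Integration.integral_sum)
       (auto intro!: integrable_L2_mult integrable_L2_mult_partials weak_deriv_sobolev[OF u] continuous u2 m sum.cong)
qed

text \<open>For each direction \<open>c\<close> the two inner derivatives are moved to \<open>\<phi>\<close>. The remaining sum over \<open>b\<close> is a weak Laplacian
  of \<open>u\<close> paired with \<open>\<partial>\<^sub>c\<partial>\<^sub>c \<phi>\<close>, which has no reason to vanish on the sphere.\<close>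

lemma integral_weak_bilaplacian:
  assumes u: "u \<in> sobolev 4 (ball 0 1)" and cl: "clamped u"
  shows "(LINT x|lebesgue_on (ball 0 1). weak_bilaplacian (ball 0 1) u x * \<phi> x) =
    (LINT x|lebesgue_on (ball 0 1). u x * bilaplacian \<phi> x)"
proof -
  let ?I = "\<lambda>f. LINT x|lebesgue_on (ball (0::'a) 1). f x"
  note u2 = sobolev_L2_space[OF u]
  have m: "[b, b, c, c] \<in> multi_indices 4" if "b \<in> Basis" "c \<in> Basis" for b c :: 'a
    using that by (auto simp: multi_indices_def)
  have key: "(\<Sum>b\<in>Basis. ?I (\<lambda>x. weak_deriv (ball 0 1) [b, b, c, c] u x * \<phi> x)) =
      (\<Sum>b\<in>Basis. ?I (\<lambda>x. u x * partials [b, b, c, c] \<phi> x))" if c: "c \<in> Basis" for c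
  proof -
    obtain g where g: "Ck_closure 2 (ball 0 1) g" "\<And>x. x \<in> ball 0 1 \<Longrightarrow> g x = partials [c, c] \<phi> x"
      using second_partial[OF c] by blast
    note gc = Ck_closure_continuous[OF g(1)]
    have "?I (\<lambda>x. weak_deriv (ball 0 1) ([b, b] @ [c, c]) u x * \<phi> x) = ?I (\<lambda>x. weak_deriv (ball 0 1) [b, b] u x * g x)"
      if "b \<in> Basis" for b
      by (rule weak_deriv_move_two[OF u _ gc g(2)]) (use m[OF that c] in simp_all)
    then have "(\<Sum>b\<in>Basis. ?I (\<lambda>x. weak_deriv (ball 0 1) [b, b, c, c] u x * \<phi> x)) =
        (\<Sum>b\<in>Basis. ?I (\<lambda>x. weak_deriv (ball 0 1) [b, b] u x * g x))" by (intro sum.cong) auto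
    also have "\<dots> = (\<Sum>b\<in>Basis. ?I (\<lambda>x. u x * partials [b, b] g x))"
      by (rule clamped_weak_laplacian[OF u _ cl g(1)]) simp
    also have "\<dots> = (\<Sum>b\<in>Basis. ?I (\<lambda>x. u x * partials [b, b, c, c] \<phi> x))"
    proof (intro sum.cong Bochner_Integration.integral_cong refl)
      fix b x assume "x \<in> space (lebesgue_on (ball (0::'a) 1))"
      then have "partials [b, b] g x = partials [b, b] (partials [c, c] \<phi>) x"
        by (intro partials_cong_open[of "ball 0 1"] g(2)) auto
      then show "u x * partials [b, b] g x = u x * partials [b, b, c, c] \<phi> x"
        by (simp add: partials_append[symmetric])
    qed
    finally show ?thesis .
  qed
  have "?I (\<lambda>x. weak_bilaplacian (ball 0 1) u x * \<phi> x) =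
      (\<Sum>c\<in>Basis. \<Sum>b\<in>Basis. ?I (\<lambda>x. weak_deriv (ball 0 1) [b, b, c, c] u x * \<phi> x))"
    unfolding weak_bilaplacian_def sum_distrib_right
    by (subst Bochner_Integration.integral_sum, (intro Bochner_Integration.integrable_sum integrable_L2_mult continuous weak_deriv_sobolev[OF u] m; assumption)[1],
        subst sum.swap, intro sum.cong refl Bochner_Integration.integral_sum integrable_L2_mult continuous weak_deriv_sobolev[OF u] m) auto
  also have "\<dots> = (\<Sum>c\<in>Basis. \<Sum>b\<in>Basis. ?I (\<lambda>x. u x * partials [b, b, c, c] \<phi> x))"
    by (rule sum.cong[OF refl], rule key)
  also have "\<dots> = ?I (\<lambda>x. u x * bilaplacian \<phi> x)"
    unfolding bilaplacian_def sum_distrib_left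
    by (subst Bochner_Integration.integral_sum, (intro Bochner_Integration.integrable_sum integrable_L2_mult_partials u2 m; assumption)[1],
        subst sum.swap, intro sum.cong refl Bochner_Integration.integral_sum[symmetric] integrable_L2_mult_partials u2 m) auto
  finally show ?thesis .
qed

end

section \<open>Pairing functions of time with a fixed function of space\<close>

lemma sobolev_0_pairing_bound:
  assumes g: "continuous_on (cball (0::'a::euclidean_space) 1) g"
  obtains K where "0 \<le> K"
    "\<And>f. f \<in> L2_space (ball 0 1) \<Longrightarrow> \<bar>LINT x|lebesgue_on (ball 0 1). f x * g x\<bar> \<le> K * sobolev_norm 0 (ball 0 1) f"
proof -
  obtain K where K: "0 \<le> K" "\<forall>k. \<forall>bs\<in>multi_indices k. \<forall>f. \<forall>v\<in>L2_space (ball (0::'a) 1).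
      has_weak_deriv (ball 0 1) bs f v \<longrightarrow>
      \<bar>LINT x|lebesgue_on (ball 0 1). v x * g x\<bar> \<le> K * sobolev_norm k (ball 0 1) f"
    using sobolev_norm_pairing_bound[OF g] by (elim exE conjE)
  have "\<bar>LINT x|lebesgue_on (ball 0 1). f x * g x\<bar> \<le> K * sobolev_norm 0 (ball 0 1) f"
    if "f \<in> L2_space (ball 0 1)" for f
    by (rule K(2)[rule_format, of "[]", OF _ that]) (auto simp: multi_indices_def has_weak_deriv_def)
  with K(1) show thesis by (rule that)
qed

lemma sobolev_norm_nonneg: "0 \<le> sobolev_norm k S f"
  unfolding sobolev_norm_def by (intro real_sqrt_ge_zero sum_nonneg) auto

lemma C1_in_L2_pairing:
  fixes u :: "real \<Rightarrow> 'a::euclidean_space \<Rightarrow> real"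
  assumes C1: "C1_in_L2 I u u'" and g: "continuous_on (cball 0 1) g"
  shows "t \<in> I \<Longrightarrow> ((\<lambda>t. LINT x|lebesgue_on (ball 0 1). u t x * g x) has_real_derivative
      (LINT x|lebesgue_on (ball 0 1). u' t x * g x)) (at t within I)"
    and "continuous_on I (\<lambda>t. LINT x|lebesgue_on (ball 0 1). u' t x * g x)"
proof -
  let ?B = "ball (0::'a) 1" and ?I = "\<lambda>f. LINT x|lebesgue_on (ball (0::'a) 1). f x * g x"
  have u: "u t \<in> L2_space ?B" and u': "u' t \<in> L2_space ?B" if "t \<in> I" for t
    using C1 that by (auto simp: C1_in_L2_def cont_in_sobolev_def intro: sobolev_L2_space)
  note int = integrable_L2_mult[OF _ g]
  show "((\<lambda>t. ?I (u t)) has_real_derivative ?I (u' t)) (at t within I)" if t: "t \<in> I" for t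
  proof -
    obtain K where K: "0 \<le> K" "\<And>f. f \<in> L2_space ?B \<Longrightarrow> \<bar>?I f\<bar> \<le> K * L2_norm ?B f"
      using L2_pairing_bound[OF g] by blast
    have lim: "((\<lambda>s. K * L2_norm ?B (\<lambda>x. (u s x - u t x) / (s - t) - u' t x)) \<longlongrightarrow> K * 0) (at t within I)"
      using C1 t unfolding C1_in_L2_def by (intro tendsto_mult_left) blast
    have "((\<lambda>s. (?I (u s) - ?I (u t)) / (s - t) - ?I (u' t)) \<longlongrightarrow> 0) (at t within I)"
    proof (rule Lim_null_comparison)
      show "((\<lambda>s. K * L2_norm ?B (\<lambda>x. (u s x - u t x) / (s - t) - u' t x)) \<longlongrightarrow> 0) (at t within I)"
        using lim by simp
      have "\<bar>(?I (u s) - ?I (u t)) / (s - t) - ?I (u' t)\<bar> \<le> K * L2_norm ?B (\<lambda>x. (u s x - u t x) / (s - t) - u' t x)"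
        if s: "s \<in> I" for s
      proof -
        have L: "(\<lambda>x. inverse (s - t) * (u s x - u t x) - u' t x) \<in> L2_space ?B"
          by (intro L2_space_diff L2_space_cmult u u' s t)
        have "?I (\<lambda>x. inverse (s - t) * (u s x - u t x) - u' t x) =
            (LINT x|lebesgue_on ?B. inverse (s - t) * (u s x * g x - u t x * g x) - u' t x * g x)"
          by (simp add: algebra_simps)
        also have "\<dots> = inverse (s - t) * (?I (u s) - ?I (u t)) - ?I (u' t)"
          using int[OF u[OF s]] int[OF u[OF t]] int[OF u'[OF t]] by simp
        finally show ?thesis using K(2)[OF L] by (simp add: divide_inverse mult.commute)
      qed
      then show "\<forall>\<^sub>F s in at t within I. norm ((?I (u s) - ?I (u t)) / (s - t) - ?I (u' t))
          \<le> K * L2_norm ?B (\<lambda>x. (u s x - u t x) / (s - t) - u' t x)"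
        by (auto simp: eventually_at_filter)
    qed
    then show ?thesis by (simp add: has_field_derivative_iff LIM_zero_iff)
  qed
  obtain K where K: "0 \<le> K" "\<And>f. f \<in> L2_space ?B \<Longrightarrow> \<bar>?I f\<bar> \<le> K * sobolev_norm 0 ?B f"
    using sobolev_0_pairing_bound[OF g] by blast
  show "continuous_on I (\<lambda>t. ?I (u' t))"
    unfolding continuous_on_def
  proof
    fix t assume t: "t \<in> I"
    have lim: "((\<lambda>s. K * sobolev_norm 0 ?B (\<lambda>x. u' s x - u' t x)) \<longlongrightarrow> K * 0) (at t within I)"
      using C1 t unfolding C1_in_L2_def cont_in_sobolev_def by (intro tendsto_mult_left) blast
    have "((\<lambda>s. ?I (u' s) - ?I (u' t)) \<longlongrightarrow> 0) (at t within I)"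
    proof (rule Lim_null_comparison)
      show "((\<lambda>s. K * sobolev_norm 0 ?B (\<lambda>x. u' s x - u' t x)) \<longlongrightarrow> 0) (at t within I)"
        using lim by simp
      have "\<bar>?I (u' s) - ?I (u' t)\<bar> \<le> K * sobolev_norm 0 ?B (\<lambda>x. u' s x - u' t x)" if s: "s \<in> I" for s
      proof -
        have "?I (\<lambda>x. u' s x - u' t x) = ?I (u' s) - ?I (u' t)"
          using int[OF u'[OF s]] int[OF u'[OF t]] by (simp add: left_diff_distrib)
        then show ?thesis using K(2)[OF L2_space_diff[OF u'[OF s] u'[OF t]]] by simp
      qed
      then show "\<forall>\<^sub>F s in at t within I. norm (?I (u' s) - ?I (u' t)) \<le> K * sobolev_norm 0 ?B (\<lambda>x. u' s x - u' t x)"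
        by (auto simp: eventually_at_filter)
    qed
    then show "((\<lambda>t. ?I (u' t)) \<longlongrightarrow> ?I (u' t)) (at t within I)" by (simp add: LIM_zero_iff)
  qed
qed

text \<open>The simple functions that approximate \<open>f\<close> have pairings with \<open>g\<close> that are scalar step functions, whose
  integrals converge to the pairing of \<open>F\<close>. Up to an error that is small in \<open>L\<^sub>1\<close>, these step functions
  lie above \<open>w\<close>. An integrable minorant \<open>w\<close> takes the place of the integral of the pairing of \<open>f\<close>, about whose
  measurability the definition says nothing directly.\<close>

lemma bochner_integral_pairing_ge:
  fixes f :: "real \<Rightarrow> 'a::euclidean_space \<Rightarrow> real"
  assumes F: "has_L2_bochner_integral r f F" and g: "continuous_on (cball 0 1) g"
    and w: "integrable (lebesgue_on {0<..<r}) w"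
    and le: "AE t in lebesgue_on {0<..<r}. w t \<le> (LINT x|lebesgue_on (ball 0 1). f t x * g x)"
  shows "(LINT t|lebesgue_on {0<..<r}. w t) \<le> (LINT x|lebesgue_on (ball 0 1). F x * g x)"
proof -
  let ?B = "ball (0::'a) 1" and ?I = "\<lambda>f. LINT x|lebesgue_on (ball (0::'a) 1). f x * g x"
  let ?T = "lebesgue_on {0<..<r}"
  interpret T: finite_measure ?T by (rule finite_measure_lebesgue_on) simp
  obtain s where s: "bochner_approx 0 r f s" and F2: "F \<in> L2_space ?B"
    and lim: "(\<lambda>n. L2_norm ?B (\<lambda>x. (\<Sum>h\<in>s n ` {0<..<r}. measure lebesgue {t \<in> {0<..<r}. s n t = h} * h x) - F x)) \<longlonglongrightarrow> 0"
    using F unfolding has_L2_bochner_integral_def by blast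
  have fs: "AE t in ?T. f t \<in> sobolev 0 ?B" and sf: "\<And>n. simple_function ?T (s n)"
    and ss: "\<And>n t. t \<in> {0<..<r} \<Longrightarrow> s n t \<in> L2_space ?B"
    and Nm: "\<And>n. (\<lambda>t. sobolev_norm 0 ?B (\<lambda>x. f t x - s n t x)) \<in> borel_measurable ?T"
    and Nl: "(\<lambda>n. \<integral>\<^sup>+t. ennreal (sobolev_norm 0 ?B (\<lambda>x. f t x - s n t x)) \<partial>?T) \<longlonglongrightarrow> 0"
    using s unfolding bochner_approx_def by (auto intro: sobolev_L2_space[of _ 0])
  define N where "N n t = sobolev_norm 0 ?B (\<lambda>x. f t x - s n t x)" for n t
  obtain K where K: "0 \<le> K" "\<And>f. f \<in> L2_space ?B \<Longrightarrow> \<bar>?I f\<bar> \<le> K * sobolev_norm 0 ?B f"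
    using sobolev_0_pairing_bound[OF g] by blast
  obtain K' where K': "0 \<le> K'" "\<And>f. f \<in> L2_space ?B \<Longrightarrow> \<bar>?I f\<bar> \<le> K' * L2_norm ?B f"
    using L2_pairing_bound[OF g] by blast
  note int = integrable_L2_mult[OF _ g]
  have N0: "0 \<le> N n t" for n t by (simp add: N_def sobolev_norm_nonneg)
  have iN: "\<forall>\<^sub>F n in sequentially. integrable ?T (N n) \<and> ennreal (LINT t|?T. N n t) = (\<integral>\<^sup>+t. ennreal (N n t) \<partial>?T)"
  proof -
    have "\<forall>\<^sub>F n in sequentially. (\<integral>\<^sup>+t. ennreal (N n t) \<partial>?T) < 1"
      using order_tendstoD(2)[OF Nl, of 1] by (simp add: N_def)
    then show ?thesis
    proof eventually_elim
      case (elim n)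
      then have "integrable ?T (N n)"
        using Nm[of n] by (intro integrableI_nonneg) (auto simp: N_def[abs_def] sobolev_norm_nonneg intro: less_trans)
      then show ?case
        using nn_integral_eq_integral[of ?T "N n"] N0 by simp
    qed
  qed
  have Nlim: "(\<lambda>n. LINT t|?T. N n t) \<longlonglongrightarrow> 0"
  proof -
    have "\<forall>\<^sub>F n in sequentially. (\<integral>\<^sup>+t. ennreal (N n t) \<partial>?T) = ennreal (LINT t|?T. N n t)"
      using iN by eventually_elim simp
    with Nl[folded N_def] have "(\<lambda>n. ennreal (LINT t|?T. N n t)) \<longlonglongrightarrow> 0"
      by (rule Lim_transform_eventually)
    then have "(\<lambda>n. ennreal (LINT t|?T. N n t)) \<longlonglongrightarrow> ennreal 0" by simp
    then show ?thesis
      by (rule tendsto_ennrealD) (use N0 in \<open>auto intro!: integral_nonneg_AE always_eventually\<close>)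
  qed
  define q where "q n t = ?I (s n t)" for n t
  define S where "S n x = (\<Sum>h\<in>s n ` {0<..<r}. measure lebesgue {t \<in> {0<..<r}. s n t = h} * h x)" for n x
  have fin: "finite (s n ` {0<..<r})" for n using sf[of n] by (simp add: simple_function_def)
  have S2: "S n \<in> L2_space ?B" for n
    unfolding S_def by (rule L2_space_sum[OF fin]) (auto intro!: L2_space_cmult ss)
  have q_int: "integrable ?T (q n)" and q_eq: "(LINT t|?T. q n t) = ?I (S n)" for n
  proof -
    have A: "{t \<in> {0<..<r}. s n t = h} \<in> sets ?T" for h
      using simple_functionD(2)[OF sf, of n "{h}"] by (simp add: vimage_def Int_def conj_commute)
    have iA: "integrable ?T (indicator {t \<in> {0<..<r}. s n t = h} :: real \<Rightarrow> real)" for h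
      by (rule integrable_real_indicator[OF A]) (simp add: T.emeasure_finite less_top[symmetric])
    have q: "q n t = (\<Sum>h\<in>s n ` {0<..<r}. indicator {t \<in> {0<..<r}. s n t = h} t * ?I h)" if "t \<in> space ?T" for t
    proof -
      have "(\<Sum>h\<in>s n ` {0<..<r}. indicator {t \<in> {0<..<r}. s n t = h} t * ?I h) =
          (\<Sum>h\<in>s n ` {0<..<r}. if s n t = h then ?I h else 0)"
        using that by (intro sum.cong) auto
      also have "\<dots> = ?I (s n t)" using that fin by (subst sum.delta') auto
      finally show ?thesis by (simp add: q_def)
    qed
    have iq: "integrable ?T (\<lambda>t. \<Sum>h\<in>s n ` {0<..<r}. indicator {t \<in> {0<..<r}. s n t = h} t * ?I h)"
      by (intro Bochner_Integration.integrable_sum integrable_mult_left iA)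
    then show "integrable ?T (q n)" by (subst Bochner_Integration.integrable_cong[OF refl q])
    have "(LINT t|?T. q n t) = (\<Sum>h\<in>s n ` {0<..<r}. (LINT t|?T. indicator {t \<in> {0<..<r}. s n t = h} t * ?I h))"
      by (subst Bochner_Integration.integral_cong[OF refl q], assumption)
         (intro Bochner_Integration.integral_sum integrable_mult_left iA)
    also have "\<dots> = (\<Sum>h\<in>s n ` {0<..<r}. measure lebesgue {t \<in> {0<..<r}. s n t = h} * ?I h)"
    proof (rule sum.cong[OF refl])
      fix h
      have "measure ?T {t \<in> {0<..<r}. s n t = h} = measure lebesgue {t \<in> {0<..<r}. s n t = h}"
        by (rule measure_restrict_space) auto
      moreover have "{t \<in> {0<..<r}. s n t = h} \<inter> space ?T = {t \<in> {0<..<r}. s n t = h}" by auto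
      ultimately show "(LINT t|?T. indicator {t \<in> {0<..<r}. s n t = h} t * ?I h) =
          measure lebesgue {t \<in> {0<..<r}. s n t = h} * ?I h" by simp
    qed
    also have "\<dots> = ?I (S n)"
      unfolding S_def sum_distrib_right
      by (subst Bochner_Integration.integral_sum) (auto intro!: int ss L2_space_cmult simp: mult.assoc)
    finally show "(LINT t|?T. q n t) = ?I (S n)" .
  qed
  have qlim: "(\<lambda>n. LINT t|?T. q n t) \<longlonglongrightarrow> ?I F"
  proof -
    have "\<bar>(LINT t|?T. q n t) - ?I F\<bar> \<le> K' * L2_norm ?B (\<lambda>x. S n x - F x)" for n
    proof -
      have "?I (\<lambda>x. S n x - F x) = ?I (S n) - ?I F"
        using int[OF S2[of n]] int[OF F2] by (simp add: left_diff_distrib)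
      then show ?thesis using K'(2)[OF L2_space_diff[OF S2[of n] F2]] q_eq by simp
    qed
    moreover have "(\<lambda>n. K' * L2_norm ?B (\<lambda>x. S n x - F x)) \<longlonglongrightarrow> 0"
      using tendsto_mult_left[OF lim, of K'] by (simp add: S_def)
    ultimately have "(\<lambda>n. (LINT t|?T. q n t) - ?I F) \<longlonglongrightarrow> 0" by (rule LIMSEQ_0_abs_le)
    then show ?thesis by (simp add: LIM_zero_iff)
  qed
  have "\<forall>\<^sub>F n in sequentially. (LINT t|?T. w t) \<le> (LINT t|?T. q n t) + K * (LINT t|?T. N n t)"
    using iN
  proof eventually_elim
    case (elim n)
    then have i: "integrable ?T (N n)" by simp
    have "AE t in ?T. w t \<le> q n t + K * N n t"
      using le fs AE_space
    proof eventually_elim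
      case (elim t)
      have f2: "f t \<in> L2_space ?B" and s2: "s n t \<in> L2_space ?B" using elim ss by (auto intro: sobolev_L2_space)
      have "?I (\<lambda>x. f t x - s n t x) = ?I (f t) - ?I (s n t)"
        using int[OF f2] int[OF s2] by (simp add: left_diff_distrib)
      then have "?I (f t) \<le> q n t + K * N n t"
        using K(2)[OF L2_space_diff[OF f2 s2]] by (simp add: q_def N_def)
      with elim show ?case by linarith
    qed
    then have "(LINT t|?T. w t) \<le> (LINT t|?T. q n t + K * N n t)"
      using w q_int i by (intro integral_mono_AE) auto
    also have "\<dots> = (LINT t|?T. q n t) + K * (LINT t|?T. N n t)" using q_int[of n] i by simp
    finally show ?case .
  qed
  moreover have "(\<lambda>n. (LINT t|?T. q n t) + K * (LINT t|?T. N n t)) \<longlonglongrightarrow> ?I F + K * 0"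
    by (intro tendsto_intros qlim Nlim)
  ultimately show ?thesis
    using tendsto_lowerbound[of _ "?I F + K * 0" sequentially "LINT t|?T. w t"] by simp
qed

section \<open>Differential inequalities on a half-line\<close>

lemma smooth_has_real_derivative:
  fixes f :: "real \<Rightarrow> real"
  assumes "smooth f"
  shows "(f has_real_derivative partial_at 1 f t) (at t)"
  using has_derivative_along_line[of f 0 t 1] smooth_differentiable[OF assms] by simp

lemma deriv_smooth: "smooth f \<Longrightarrow> deriv f = partial_at (1::real) f"
  by (intro ext DERIV_imp_deriv smooth_has_real_derivative)

text \<open>A mollified indicator function of \<open>[s, t]\<close>. Its derivative is a difference of two mollifiers, so testing
  with it compares the values of a function near \<open>s\<close> and near \<open>t\<close>.\<close>

lemma smooth_plateau:
  fixes s t \<epsilon> :: real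
  assumes \<epsilon>: "0 < \<epsilon>" and st: "s \<le> t"
  obtains \<psi> where "smooth \<psi>" "\<And>\<tau>. 0 \<le> \<psi> \<tau>" "\<And>\<tau>. \<tau> \<le> s - \<epsilon> \<or> t + \<epsilon> \<le> \<tau> \<Longrightarrow> \<psi> \<tau> = 0"
    "\<And>\<tau>. deriv \<psi> \<tau> = mollifier \<epsilon> (\<tau> - s) - mollifier \<epsilon> (\<tau> - t)"
proof
  let ?m = "mollifier \<epsilon> :: real \<Rightarrow> real"
  define \<psi> where "\<psi> \<tau> = integral (cbox s t) (\<lambda>y. 1 * ?m (\<tau> - y))" for \<tau>
  have m1: "Ck_on 1 UNIV ?m" using smooth_mollifier[of \<epsilon>] unfolding smooth_def by blast
  show s: "smooth \<psi>" unfolding \<psi>_def by (rule smooth_convolution[OF smooth_mollifier continuous_on_const])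
  have c: "continuous_on S (\<lambda>y. 1 * ?m (\<tau> - y))" for S \<tau>
    by (intro continuous_intros continuous_on_compose2[OF continuous_mollifier[of UNIV]]) auto
  show "0 \<le> \<psi> \<tau>" for \<tau>
    unfolding \<psi>_def using mollifier_nonneg[OF \<epsilon>] by (intro integral_nonneg integrable_continuous c) auto
  show "\<psi> \<tau> = 0" if "\<tau> \<le> s - \<epsilon> \<or> t + \<epsilon> \<le> \<tau>" for \<tau>
  proof -
    have "\<psi> \<tau> = integral (cbox s t) (\<lambda>y. 0)"
      unfolding \<psi>_def using that by (intro integral_cong) (auto intro!: mollifier_eq_0[OF \<epsilon>])
    then show ?thesis by simp
  qed
  show "deriv \<psi> \<tau> = ?m (\<tau> - s) - ?m (\<tau> - t)" for \<tau>
  proof -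
    have "deriv \<psi> \<tau> = integral {s..t} (\<lambda>y. partial_at 1 ?m (\<tau> - y))"
      unfolding deriv_smooth[OF s] unfolding \<psi>_def using partial_at_convolution[OF m1 continuous_on_const, of 1 s t 1] by simp
    also have "((\<lambda>y. partial_at 1 ?m (\<tau> - y)) has_integral (- ?m (\<tau> - t)) - (- ?m (\<tau> - s))) {s..t}"
    proof (rule fundamental_theorem_of_calculus[OF st])
      fix y
      have "((\<lambda>y. - ?m (\<tau> - y)) has_real_derivative - (partial_at 1 ?m (\<tau> - y) * (- 1))) (at y within {s..t})"
        by (intro DERIV_minus DERIV_chain2[OF smooth_has_real_derivative[OF smooth_mollifier]])
           (auto intro!: derivative_eq_intros)
      then show "((\<lambda>y. - ?m (\<tau> - y)) has_vector_derivative partial_at 1 ?m (\<tau> - y)) (at y within {s..t})"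
        by (simp add: has_real_derivative_iff_has_vector_derivative)
    qed
    then have "integral {s..t} (\<lambda>y. partial_at 1 ?m (\<tau> - y)) = ?m (\<tau> - s) - ?m (\<tau> - t)"
      by (simp add: integral_unique)
    finally show ?thesis .
  qed
qed

lemma nonincreasing_if_weakly:
  fixes W :: "real \<Rightarrow> real"
  assumes s: "0 < s" and st: "s < t" and t: "t < r" and W: "continuous_on {0..r} W"
    and H: "\<And>\<psi>. test_function {0<..<r} \<psi> \<Longrightarrow> (\<And>\<tau>. 0 \<le> \<psi> \<tau>) \<Longrightarrow>
      0 \<le> (LINT \<tau>|lebesgue_on {0<..<r}. deriv \<psi> \<tau> * W \<tau>)"
  shows "W t \<le> W s"
proof (rule field_le_epsilon)
  fix e :: real assume "0 < e"
  then have e: "0 < e / 2" by simp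
  \<comment> \<open>\<open>W\<close> is only known on \<open>[0, r]\<close>; the extension does not change the integrals\<close>
  define V where "V \<tau> = W (max 0 (min r \<tau>))" for \<tau>
  have V: "continuous_on UNIV V"
    unfolding V_def using s st t by (intro continuous_on_compose2[OF W] continuous_intros) auto
  have VW: "V \<tau> = W \<tau>" if "0 \<le> \<tau>" "\<tau> \<le> r" for \<tau> using that by (simp add: V_def)
  have "\<exists>d>0. \<forall>z. norm z < d \<longrightarrow> \<bar>V (a + z) - V a\<bar> \<le> e / 2" for a
  proof -
    have "isCont V a" using V by (simp add: continuous_on_eq_continuous_at)
    then obtain d where d: "0 < d" "\<And>y. norm (y - a) < d \<Longrightarrow> norm (V y - V a) < e / 2"
      using e unfolding continuous_at_eps_delta dist_norm by blast
    have "\<bar>V (a + z) - V a\<bar> \<le> e / 2" if "norm z < d" for z using d(2)[of "a + z"] that by simp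
    with d(1) show ?thesis by blast
  qed
  then obtain d where d: "\<And>a. 0 < d a" "\<And>a z. norm z < d a \<Longrightarrow> \<bar>V (a + z) - V a\<bar> \<le> e / 2" by metis
  define \<mu> where "\<mu> = min (min (d s) (d t)) (min s (r - t))"
  have "0 < \<mu>" using d(1) s t by (simp add: \<mu>_def)
  moreover have "\<mu> \<le> d s" "\<mu> \<le> d t" "\<mu> \<le> s" "\<mu> \<le> r - t" by (auto simp: \<mu>_def)
  moreover define \<epsilon> where "\<epsilon> = \<mu> / 2"
  ultimately have \<epsilon>: "0 < \<epsilon>" "\<epsilon> < d s" "\<epsilon> < d t" "\<epsilon> < s" "\<epsilon> < r - t" by auto
  obtain \<psi> where \<psi>: "smooth \<psi>" "\<And>\<tau>. 0 \<le> \<psi> \<tau>" "\<And>\<tau>. \<tau> \<le> s - \<epsilon> \<or> t + \<epsilon> \<le> \<tau> \<Longrightarrow> \<psi> \<tau> = 0"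
    "\<And>\<tau>. deriv \<psi> \<tau> = mollifier \<epsilon> (\<tau> - s) - mollifier \<epsilon> (\<tau> - t)"
    using smooth_plateau[OF \<epsilon>(1), of s t] st by auto
  have "s - \<epsilon> \<le> \<tau> \<and> \<tau> \<le> t + \<epsilon>" if "\<psi> \<tau> \<noteq> 0" for \<tau> using \<psi>(3)[of \<tau>] that by linarith
  then have "{\<tau>. \<psi> \<tau> \<noteq> 0} \<subseteq> {s - \<epsilon>..t + \<epsilon>}" by auto
  then have sub: "closure {\<tau>. \<psi> \<tau> \<noteq> 0} \<subseteq> {s - \<epsilon>..t + \<epsilon>}" by (intro closure_minimal) auto
  moreover have "compact (closure {\<tau>. \<psi> \<tau> \<noteq> 0})"
    using sub by (meson bounded_closed_interval bounded_subset closed_closure compact_eq_bounded_closed)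
  moreover have "{s - \<epsilon>..t + \<epsilon>} \<subseteq> {0<..<r}" using \<epsilon> by auto
  ultimately have "test_function {0<..<r} \<psi>" using \<psi>(1) by (auto simp: test_function_def)
  from H[OF this \<psi>(2)] have "0 \<le> (LINT \<tau>|lebesgue_on {0<..<r}. deriv \<psi> \<tau> * W \<tau>)" .
  also have "\<dots> = (LINT \<tau>|lebesgue. indicator {0<..<r} \<tau> * (deriv \<psi> \<tau> * W \<tau>))"
    by (simp add: integral_restrict_space)
  also have "\<dots> = (LINT \<tau>|lebesgue. V \<tau> * mollifier \<epsilon> (\<tau> - s) - V \<tau> * mollifier \<epsilon> (\<tau> - t))"
  proof (rule Bochner_Integration.integral_cong[OF refl])
    fix \<tau>
    show "indicator {0<..<r} \<tau> * (deriv \<psi> \<tau> * W \<tau>) = V \<tau> * mollifier \<epsilon> (\<tau> - s) - V \<tau> * mollifier \<epsilon> (\<tau> - t)"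
    proof (cases "\<tau> \<in> {0<..<r}")
      case False
      then have "mollifier \<epsilon> (\<tau> - s) = 0" "mollifier \<epsilon> (\<tau> - t) = 0"
        using \<epsilon> st by (auto intro!: mollifier_eq_0)
      with False show ?thesis by simp
    qed (simp add: \<psi>(4) VW algebra_simps)
  qed
  also have "\<dots> = (LINT \<tau>|lborel. V \<tau> * mollifier \<epsilon> (\<tau> - s) - V \<tau> * mollifier \<epsilon> (\<tau> - t))"
    by (intro lebesgue_integral_lborel borel_measurable_continuous_onI continuous_intros V
          continuous_on_compose2[OF continuous_mollifier[of UNIV]]) auto
  also have "\<dots> = (LINT \<tau>|lborel. V \<tau> * mollifier \<epsilon> (\<tau> - s)) - (LINT \<tau>|lborel. V \<tau> * mollifier \<epsilon> (\<tau> - t))"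
  proof (rule Bochner_Integration.integral_diff)
    have "integrable lborel (\<lambda>\<tau>. V \<tau> * mollifier \<epsilon> (\<tau> - a))" for a :: real
    proof (rule integrable_compact_support[OF _ compact_cball[of a \<epsilon>]])
      show "continuous_on UNIV (\<lambda>\<tau>. V \<tau> * mollifier \<epsilon> (\<tau> - a))"
        by (intro continuous_intros V continuous_on_compose2[OF continuous_mollifier[of UNIV]]) auto
    qed (auto simp: dist_real_def abs_minus_commute intro!: mollifier_eq_0[OF \<epsilon>(1)])
    then show "integrable lborel (\<lambda>\<tau>. V \<tau> * mollifier \<epsilon> (\<tau> - s))" "integrable lborel (\<lambda>\<tau>. V \<tau> * mollifier \<epsilon> (\<tau> - t))" by auto
  qed
  finally have *: "0 \<le> (LINT \<tau>|lborel. V \<tau> * mollifier \<epsilon> (\<tau> - s)) - (LINT \<tau>|lborel. V \<tau> * mollifier \<epsilon> (\<tau> - t))" .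
  have near: "\<bar>(LINT \<tau>|lborel. V \<tau> * mollifier \<epsilon> (\<tau> - a)) - V a\<bar> \<le> e / 2" if "\<epsilon> < d a" for a
  proof -
    have "(\<lambda>\<tau>. V \<tau> * mollifier \<epsilon> (\<tau> - a)) \<in> borel_measurable borel"
      by (intro borel_measurable_continuous_onI continuous_intros V
            continuous_on_compose2[OF continuous_mollifier[of UNIV]]) auto
    from lborel_integral_affine[OF this, of 1 a]
    have "(LINT \<tau>|lborel. V \<tau> * mollifier \<epsilon> (\<tau> - a)) = (LINT z|lborel. V (a + z) * mollifier \<epsilon> z)" by simp
    moreover have "\<bar>(LINT z|lborel. V (a + z) * mollifier \<epsilon> z) - V a\<bar> \<le> e / 2"
    proof (rule mollified_mean_bound[OF \<epsilon>(1)])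
      show "continuous_on UNIV (\<lambda>z. V (a + z))"
        by (intro continuous_on_compose2[OF V] continuous_intros) auto
    qed (use that d(2) in auto)
    ultimately show ?thesis by simp
  qed
  have "V s = W s" "V t = W t" using s st t by (auto simp: VW)
  with * near[OF \<epsilon>(2)] near[OF \<epsilon>(3)] show "W t \<le> W s + e" by linarith
qed

lemma linear_decay_unbounded_below:
  fixes E v :: "real \<Rightarrow> real"
  assumes der: "\<And>t. a \<le> t \<Longrightarrow> (E has_real_derivative v t) (at t)"
    and v: "\<And>t. a \<le> t \<Longrightarrow> v t \<le> - k" and k: "0 < k" and E: "\<And>t. a \<le> t \<Longrightarrow> - 1 \<le> E t"
  shows False
proof -
  \<comment> \<open>the time at which the line through \<open>(a, E a)\<close> with slope \<open>- k\<close> reaches the value \<open>- 2\<close>\<close>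
  define b where "b = a + (E a + 2) / k"
  have ab: "a \<le> b" using E[of a] k by (simp add: b_def)
  have "E b + k * b \<le> E a + k * a"
  proof (rule DERIV_nonpos_imp_nonincreasing[OF ab])
    fix t assume "a \<le> t" "t \<le> b"
    then have "((\<lambda>t. E t + k * t) has_real_derivative v t + k) (at t)" "v t + k \<le> 0"
      using der[of t] v[of t] by (auto intro!: derivative_eq_intros)
    then show "\<exists>y. ((\<lambda>t. E t + k * t) has_real_derivative y) (at t) \<and> y \<le> 0" by blast
  qed
  moreover have "k * b = k * a + (E a + 2)" unfolding b_def distrib_left using k by simp
  ultimately show False using E[OF ab] by simp
qed

lemma integral_open_interval_continuous:
  fixes f :: "real \<Rightarrow> real"
  assumes f: "continuous_on {0..r} f"
  shows "integrable (lebesgue_on {0<..<r}) f" "(LINT t|lebesgue_on {0<..<r}. f t) = integral {0..r} f"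
proof -
  interpret finite_measure "lebesgue_on {0<..<r}" by (rule finite_measure_lebesgue_on) simp
  have "bounded (f ` {0..r})" using f by (simp add: compact_continuous_image compact_imp_bounded)
  then obtain M where M: "\<forall>y\<in>f ` {0..r}. norm y \<le> M" unfolding bounded_iff by blast
  show i: "integrable (lebesgue_on {0<..<r}) f"
  proof (rule integrable_const_bound)
    show "AE t in lebesgue_on {0<..<r}. norm (f t) \<le> M" using M by (intro AE_I2) auto
    show "f \<in> borel_measurable (lebesgue_on {0<..<r})"
      by (intro continuous_imp_measurable_on_sets_lebesgue continuous_on_subset[OF f]) auto
  qed
  show "(LINT t|lebesgue_on {0<..<r}. f t) = integral {0..r} f"
    using lebesgue_integral_eq_integral[OF i] by (simp add: integral_open_interval_real)
qed

text \<open>The hypothesis is the distributional form of \<open>\<gamma>\<^sup>2 E'' + E' \<le> - c\<close>. It says that \<open>\<gamma>\<^sup>2 E' + E + c t\<close> is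
  nonincreasing; with \<open>E \<ge> - 1\<close> this forces \<open>E' \<le> - 1\<close> from some time on.\<close>

lemma damped_inequality_unbounded_below:
  fixes E v :: "real \<Rightarrow> real"
  assumes \<gamma>: "0 < \<gamma>" and c: "0 < c" and der: "\<And>t. 0 < t \<Longrightarrow> (E has_real_derivative v t) (at t)"
    and cE: "continuous_on {0..} E" and cv: "continuous_on {0..} v" and lower: "\<And>t. 0 \<le> t \<Longrightarrow> - 1 \<le> E t"
    and H: "\<And>r \<psi>. 0 < r \<Longrightarrow> test_function {0<..<r} \<psi> \<Longrightarrow> (\<And>\<tau>. 0 \<le> \<psi> \<tau>) \<Longrightarrow>
      (LINT \<tau>|lebesgue_on {0<..<r}. \<psi> \<tau> * (c + v \<tau>)) \<le> \<gamma>\<^sup>2 * (LINT \<tau>|lebesgue_on {0<..<r}. deriv \<psi> \<tau> * v \<tau>)"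
  shows False
proof -
  define W where "W t = \<gamma>\<^sup>2 * v t + (E t + c * t)" for t
  have cs: "continuous_on {0..r} E" "continuous_on {0..r} v" for r
    using cE cv by (auto intro: continuous_on_subset)
  have mono: "W t \<le> W s" if st: "0 < s" "s < t" for s t
  proof (rule nonincreasing_if_weakly[of s t "t + 1" W])
    show "continuous_on {0..t + 1} W" unfolding W_def by (intro continuous_intros cs)
    fix \<psi> assume \<psi>: "test_function {0<..<t + 1} \<psi>" "\<And>\<tau>. 0 \<le> \<psi> \<tau>"
    let ?r = "t + 1"
    let ?T = "lebesgue_on {0<..<?r}"
    have sm: "smooth \<psi>" using \<psi>(1) by (simp add: test_function_def)
    have cp: "continuous_on S \<psi>" "continuous_on S (deriv \<psi>)" for S
      using smooth_continuous[OF sm] smooth_continuous[OF smooth_partial_at[OF sm, of 1]] by (auto simp: deriv_smooth[OF sm])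
    have "\<psi> 0 = 0" "\<psi> ?r = 0"
      using \<psi>(1) closure_subset[of "{x. \<psi> x \<noteq> 0}"] unfolding test_function_def by force+
    note ic = integral_open_interval_continuous
    have parts: "((\<lambda>\<tau>. deriv \<psi> \<tau> * (E \<tau> + c * \<tau>) + \<psi> \<tau> * (c + v \<tau>)) has_integral
        \<psi> ?r * (E ?r + c * ?r) - \<psi> 0 * (E 0 + c * 0)) {0..?r}"
    proof (rule fundamental_theorem_of_calculus_interior)
      show "continuous_on {0..?r} (\<lambda>\<tau>. \<psi> \<tau> * (E \<tau> + c * \<tau>))" by (intro continuous_intros cs cp)
      fix \<tau> assume \<tau>: "\<tau> \<in> {0<..<?r}"
      have "(\<psi> has_real_derivative deriv \<psi> \<tau>) (at \<tau>)"
        unfolding deriv_smooth[OF sm] by (rule smooth_has_real_derivative[OF sm])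
      then have "((\<lambda>\<tau>. \<psi> \<tau> * (E \<tau> + c * \<tau>)) has_real_derivative deriv \<psi> \<tau> * (E \<tau> + c * \<tau>) + \<psi> \<tau> * (c + v \<tau>)) (at \<tau>)"
        using der[of \<tau>] \<tau> by (auto intro!: derivative_eq_intros)
      then show "((\<lambda>\<tau>. \<psi> \<tau> * (E \<tau> + c * \<tau>)) has_vector_derivative deriv \<psi> \<tau> * (E \<tau> + c * \<tau>) + \<psi> \<tau> * (c + v \<tau>)) (at \<tau>)"
        by (simp add: has_real_derivative_iff_has_vector_derivative)
    qed (use st in auto)
    have i1: "integrable ?T (\<lambda>\<tau>. deriv \<psi> \<tau> * (E \<tau> + c * \<tau>))" and i2: "integrable ?T (\<lambda>\<tau>. \<psi> \<tau> * (c + v \<tau>))"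
      and i3: "integrable ?T (\<lambda>\<tau>. deriv \<psi> \<tau> * v \<tau>)"
      by (intro ic(1) continuous_intros cs cp)+
    have "(LINT \<tau>|?T. deriv \<psi> \<tau> * (E \<tau> + c * \<tau>) + \<psi> \<tau> * (c + v \<tau>)) =
        integral {0..?r} (\<lambda>\<tau>. deriv \<psi> \<tau> * (E \<tau> + c * \<tau>) + \<psi> \<tau> * (c + v \<tau>))"
      by (intro ic(2) continuous_intros cs cp)
    also have "\<dots> = 0" using integral_unique[OF parts] \<open>\<psi> 0 = 0\<close> \<open>\<psi> ?r = 0\<close> by simp
    finally have "(LINT \<tau>|?T. deriv \<psi> \<tau> * (E \<tau> + c * \<tau>)) = - (LINT \<tau>|?T. \<psi> \<tau> * (c + v \<tau>))"
      using Bochner_Integration.integral_add[OF i1 i2] by simp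
    moreover have "(LINT \<tau>|?T. deriv \<psi> \<tau> * W \<tau>) = (LINT \<tau>|?T. \<gamma>\<^sup>2 * (deriv \<psi> \<tau> * v \<tau>) + deriv \<psi> \<tau> * (E \<tau> + c * \<tau>))"
      by (simp add: W_def algebra_simps)
    moreover have "\<dots> = \<gamma>\<^sup>2 * (LINT \<tau>|?T. deriv \<psi> \<tau> * v \<tau>) + (LINT \<tau>|?T. deriv \<psi> \<tau> * (E \<tau> + c * \<tau>))"
      using i1 i3 by simp
    ultimately show "0 \<le> (LINT \<tau>|?T. deriv \<psi> \<tau> * W \<tau>)"
      using H[OF _ \<psi>] st by simp
  qed (use st in auto)
  \<comment> \<open>from this time on \<open>W \<le> W 1\<close> and \<open>E \<ge> - 1\<close> give \<open>E' \<le> - 1\<close>\<close>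
  define a where "a = max 2 ((W 1 + 1 + \<gamma>\<^sup>2) / c)"
  have a: "2 \<le> a" "(W 1 + 1 + \<gamma>\<^sup>2) / c \<le> a" by (auto simp: a_def)
  show False
  proof (rule linear_decay_unbounded_below[of a E v 1])
    fix t assume t: "a \<le> t"
    then show "(E has_real_derivative v t) (at t)" "- 1 \<le> E t" using a(1) by (auto intro: der lower)
    have "(W 1 + 1 + \<gamma>\<^sup>2) / c \<le> t" using a(2) t by linarith
    then have "W 1 + 1 + \<gamma>\<^sup>2 \<le> c * t" using c by (simp add: field_simps)
    moreover have "W t \<le> W 1" using mono[of 1 t] a(1) t by simp
    ultimately have "\<gamma>\<^sup>2 * v t \<le> \<gamma>\<^sup>2 * (- 1)" using lower[of t] a(1) t unfolding W_def by simp
    then show "v t \<le> - 1" using \<gamma> by (simp only: mult_le_cancel_left_pos zero_less_power)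
  qed simp
qed

section \<open>Testing the equation with the first eigenfunction\<close>

lemma first_eigenpair_clamped:
  fixes \<phi> :: "'a::euclidean_space \<Rightarrow> real"
  assumes "first_eigenpair B T m \<phi>"
  shows "clamped_C4_function \<phi>"
proof
  show "Ck_closure 4 (ball 0 1) \<phi>" using assms by (simp add: first_eigenpair_def)
  then have \<phi>: "Ck_closure (Suc 3) (ball 0 1) \<phi>" by (simp add: numeral_eq_Suc)
  show "\<phi> x = 0" if "x \<in> sphere 0 1" for x using assms that by (simp add: first_eigenpair_def)
  fix b x :: 'a and g
  assume b: "b \<in> Basis" and g: "continuous_on (cball 0 1) g" "\<And>y. y \<in> ball 0 1 \<Longrightarrow> g y = partial_at b \<phi> y"
    and x: "x \<in> sphere 0 1"
  obtain D where "\<phi> x = 0" "(\<phi> has_derivative D) (at x within cball 0 1)" "D x = 0"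
    using assms x unfolding first_eigenpair_def by blast
  then show "g x = 0"
  proof (rule radial_clamped_gradient_zero[OF \<phi> x _ _ _ _ b g])
    show "\<phi> y = \<phi> z" if "y \<in> cball 0 1" "z \<in> cball 0 1" "norm y = norm z" for y z
      using assms that unfolding first_eigenpair_def by blast
  qed
qed

text \<open>With \<open>y = 1 + z\<close> and \<open>l = lam - 4 m / 27\<close>, the excess over the critical value, one has
  \<open>m z + lam / y\<^sup>2 = m (y - 2/3)\<^sup>2 (y + 1/3) / y\<^sup>2 + l / y\<^sup>2\<close>. For \<open>y \<le> 2\<close> the last term is at least \<open>l / 4\<close>; for
  \<open>y > 2\<close> already \<open>m z \<ge> m\<close>.\<close>

lemma touchdown_source_bound:
  fixes lam m :: real
  assumes m: "0 < m" and lam: "4 * m / 27 < lam"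
  obtains c where "0 < c" "\<And>z. - 1 < z \<Longrightarrow> c \<le> m * z + lam / (1 + z)\<^sup>2"
proof
  define l where "l = lam - 4 * m / 27"
  define c where "c = min (l / 4) m"
  have l: "0 < l" using lam by (simp add: l_def)
  then show "0 < c" using m by (simp add: c_def)
  fix z :: real assume z: "- 1 < z"
  define y where "y = 1 + z"
  have y: "0 < y" using z by (simp add: y_def)
  have eq: "m * z + lam / (1 + z)\<^sup>2 = m * (y - 2 / 3)\<^sup>2 * (y + 1 / 3) / y\<^sup>2 + l / y\<^sup>2"
  proof -
    have "m * z * y\<^sup>2 + lam = m * (y - 2 / 3)\<^sup>2 * (y + 1 / 3) + l"
      by (simp add: l_def y_def power2_eq_square field_simps)
    then have "(m * z * y\<^sup>2 + lam) / y\<^sup>2 = (m * (y - 2 / 3)\<^sup>2 * (y + 1 / 3) + l) / y\<^sup>2" by simp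
    then show ?thesis using y by (simp add: add_divide_distrib y_def)
  qed
  show "c \<le> m * z + lam / (1 + z)\<^sup>2"
  proof (cases "y \<le> 2")
    case True
    then have "y\<^sup>2 \<le> 2\<^sup>2" using y by (intro power_mono) auto
    then have "l / 4 \<le> l / y\<^sup>2" using l y by (intro divide_left_mono) auto
    moreover have "0 \<le> m * (y - 2 / 3)\<^sup>2 * (y + 1 / 3) / y\<^sup>2" using m y by simp
    ultimately show ?thesis unfolding eq c_def by linarith
  next
    case False
    then have "m * 1 \<le> m * z" using m by (intro mult_left_mono) (auto simp: y_def)
    moreover have "0 \<le> lam / (1 + z)\<^sup>2" using lam m by simp
    ultimately show ?thesis unfolding c_def by linarith
  qed
qed

context
  fixes B T m :: real and \<phi> :: "'a::euclidean_space \<Rightarrow> real"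
  assumes eig: "first_eigenpair B T m \<phi>"
begin

interpretation clamped_C4_function \<phi> using eig by (rule first_eigenpair_clamped)

lemma eigenfunction_pos: "x \<in> ball 0 1 \<Longrightarrow> 0 < \<phi> x"
  using eig by (simp add: first_eigenpair_def)

lemma integrable_continuous_mult_eigenfunction:
  "continuous_on (cball 0 1) f \<Longrightarrow> integrable (lebesgue_on (ball 0 1)) (\<lambda>x. f x * \<phi> x)"
  by (intro integrable_L2_mult continuous L2_space_continuous)

lemma integral_eigenfunction: "(LINT x|lebesgue_on (ball 0 1). \<phi> x) = 1"
proof -
  have "(LINT x|lebesgue_on (ball 0 1). \<phi> x) = (LINT x|lebesgue_on (ball 0 1). \<bar>\<phi> x\<bar>)"
    using eigenfunction_pos by (intro Bochner_Integration.integral_cong) (auto simp: less_imp_le)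
  then show ?thesis using eig by (simp add: first_eigenpair_def)
qed

lemma eigenfunction_mean_ge:
  assumes f: "continuous_on (cball 0 1) f" and le: "\<And>x. x \<in> cball 0 1 \<Longrightarrow> k \<le> f x"
  shows "k \<le> (LINT x|lebesgue_on (ball 0 1). f x * \<phi> x)"
proof -
  have "(LINT x|lebesgue_on (ball 0 1). k * \<phi> x) \<le> (LINT x|lebesgue_on (ball 0 1). f x * \<phi> x)"
  proof (rule integral_mono)
    fix x assume "x \<in> space (lebesgue_on (ball (0::'a) 1))"
    then show "k * \<phi> x \<le> f x * \<phi> x" using le[of x] eigenfunction_pos[of x] by (intro mult_right_mono) auto
  qed (intro integrable_continuous_mult_eigenfunction continuous_on_const f)+
  then show ?thesis by (simp add: integral_eigenfunction)
qed

text \<open>Multiply the equation at a fixed time by \<open>\<phi>\<close> and integrate; \<open>R\<close> stands for the terms with time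
  derivatives. Green's formula replaces the operator by the eigenvalue \<open>m\<close>, and \<open>\<phi>\<close> is a probability density.\<close>

lemma eigenfunction_functional_decreases:
  assumes c: "\<And>z. - 1 < z \<Longrightarrow> c \<le> m * z + lam / (1 + z)\<^sup>2"
    and u: "u \<in> sobolev 4 (ball 0 1)" "clamped u" "continuous_on (cball 0 1) u"
    and gt: "\<And>x. x \<in> cball 0 1 \<Longrightarrow> - 1 < u x" and R: "R \<in> L2_space (ball 0 1)"
    and eq: "AE x in lebesgue_on (ball 0 1).
      R x + B * weak_bilaplacian (ball 0 1) u x - T * weak_laplacian (ball 0 1) u x = - lam / (1 + u x)\<^sup>2"
  shows "(LINT x|lebesgue_on (ball 0 1). R x * \<phi> x) \<le> - c"
proof -
  let ?L = "lebesgue_on (ball (0::'a) 1)" and ?I = "\<lambda>f. LINT x|lebesgue_on (ball (0::'a) 1). f x"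
  let ?bi = "weak_bilaplacian (ball 0 1) u" and ?la = "weak_laplacian (ball 0 1) u"
  have bi: "?bi \<in> L2_space (ball 0 1)" and la: "?la \<in> L2_space (ball 0 1)"
    unfolding weak_bilaplacian_def[abs_def] weak_laplacian_def[abs_def]
    by (intro L2_space_sum finite_Basis weak_deriv_sobolev[OF u(1)]; auto simp: multi_indices_def)+
  have s: "continuous_on (cball 0 1) (\<lambda>x. - lam / (1 + u x)\<^sup>2)"
    using gt by (intro continuous_intros u) force
  have s': "continuous_on (cball 0 1) (\<lambda>x. m * u x + lam / (1 + u x)\<^sup>2)"
    using gt by (intro continuous_intros u) force
  note int = integrable_L2_mult[OF _ continuous]
  note u2 = sobolev_L2_space[OF u(1)]
  have mi: "[b, b] \<in> multi_indices 4" "[b, b, c, c] \<in> multi_indices 4" if "b \<in> Basis" "c \<in> Basis" for b c :: 'a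
    using that by (auto simp: multi_indices_def)
  have iub: "integrable ?L (\<lambda>x. u x * bilaplacian \<phi> x)" and iul: "integrable ?L (\<lambda>x. u x * laplacian \<phi> x)"
    unfolding bilaplacian_def laplacian_def sum_distrib_left
    by (intro Bochner_Integration.integrable_sum integrable_L2_mult_partials u2 mi; assumption)+
  have "?I (\<lambda>x. R x * \<phi> x) + B * ?I (\<lambda>x. ?bi x * \<phi> x) - T * ?I (\<lambda>x. ?la x * \<phi> x) =
      ?I (\<lambda>x. R x * \<phi> x + B * (?bi x * \<phi> x) - T * (?la x * \<phi> x))"
    using int[OF R] int[OF bi] int[OF la] by simp
  also have "\<dots> = ?I (\<lambda>x. (- lam / (1 + u x)\<^sup>2) * \<phi> x)"
  proof (rule integral_cong_AE)
    show "AE x in ?L. R x * \<phi> x + B * (?bi x * \<phi> x) - T * (?la x * \<phi> x) = (- lam / (1 + u x)\<^sup>2) * \<phi> x"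
      using eq by eventually_elim (metis (no_types, opaque_lifting) left_diff_distrib distrib_right mult.assoc)
  qed (use int[OF R] int[OF bi] int[OF la] integrable_continuous_mult_eigenfunction[OF s] in
        \<open>auto intro!: borel_measurable_integrable\<close>)
  finally have 1: "?I (\<lambda>x. R x * \<phi> x) + B * ?I (\<lambda>x. u x * bilaplacian \<phi> x) - T * ?I (\<lambda>x. u x * laplacian \<phi> x) =
      ?I (\<lambda>x. (- lam / (1 + u x)\<^sup>2) * \<phi> x)"
    by (simp only: integral_weak_bilaplacian[OF u(1,2)] integral_weak_laplacian[OF u(1)])
  have "B * ?I (\<lambda>x. u x * bilaplacian \<phi> x) - T * ?I (\<lambda>x. u x * laplacian \<phi> x) =
      ?I (\<lambda>x. B * (u x * bilaplacian \<phi> x) - T * (u x * laplacian \<phi> x))"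
    using iub iul by simp
  also have "\<dots> = ?I (\<lambda>x. m * (u x * \<phi> x))"
  proof (rule Bochner_Integration.integral_cong[OF refl])
    fix x assume "x \<in> space ?L"
    then have "B * bilaplacian \<phi> x - T * laplacian \<phi> x = m * \<phi> x"
      using eig by (simp add: first_eigenpair_def)
    then have "u x * (B * bilaplacian \<phi> x - T * laplacian \<phi> x) = u x * (m * \<phi> x)" by simp
    then show "B * (u x * bilaplacian \<phi> x) - T * (u x * laplacian \<phi> x) = m * (u x * \<phi> x)"
      by (simp add: algebra_simps)
  qed
  finally have 2: "B * ?I (\<lambda>x. u x * bilaplacian \<phi> x) - T * ?I (\<lambda>x. u x * laplacian \<phi> x) = ?I (\<lambda>x. m * (u x * \<phi> x))" .
  have "c \<le> ?I (\<lambda>x. (m * u x + lam / (1 + u x)\<^sup>2) * \<phi> x)"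
    by (rule eigenfunction_mean_ge[OF s']) (use c gt in auto)
  also have "\<dots> = ?I (\<lambda>x. m * (u x * \<phi> x) - (- lam / (1 + u x)\<^sup>2) * \<phi> x)"
    by (simp add: algebra_simps)
  also have "\<dots> = ?I (\<lambda>x. m * (u x * \<phi> x)) - ?I (\<lambda>x. (- lam / (1 + u x)\<^sup>2) * \<phi> x)"
    by (intro Bochner_Integration.integral_diff integrable_continuous_mult_eigenfunction[OF s]
          integrable_mult_right int[OF u2])
  finally show ?thesis using 1 2 by linarith
qed

end

section \<open>Finite existence time\<close>

text \<open>For a test function \<open>\<psi>\<close> of time, the vector \<open>F\<close> is the common value of \<open>\<integral> \<psi>' u\<^sub>t\<close> and \<open>- \<integral> \<psi> u\<^sub>t\<^sub>t\<close>. Its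
  pairing with \<open>\<phi>\<close> is bounded below through the second integral, by the inequality at
  almost every time, and above through the first, by \<open>\<integral> \<psi>' E'\<close>.\<close>

lemma hyperbolic_solution_not_global:
  fixes u :: "real \<Rightarrow> 'a::euclidean_space \<Rightarrow> real" and \<phi> :: "'a \<Rightarrow> real"
  assumes eig: "first_eigenpair B T m \<phi>" and \<gamma>: "0 < \<gamma>"
    and c0: "0 < c" and c: "\<And>z. - 1 < z \<Longrightarrow> c \<le> m * z + lam / (1 + z)\<^sup>2"
    and sol: "hyperbolic_solution \<gamma> B T lam u0 u1 \<infinity> u"
  shows False
proof -
  interpret clamped_C4_function \<phi> using eig by (rule first_eigenpair_clamped)
  let ?B = "ball (0::'a) 1" and ?I = "\<lambda>f. LINT x|lebesgue_on (ball (0::'a) 1). f x * \<phi> x"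
  have I: "time_ivl \<infinity> = {0..}" by (auto simp: time_ivl_def)
  obtain ut utt where above: "above_minus_one {0..} u" and C1: "C1_in_L2 {0..} u ut"
    and L1': "\<forall>r. 0 < r \<and> ereal r < \<infinity> \<longrightarrow>
        L1_in_sobolev r 4 u \<and> L1_in_sobolev r 2 ut \<and> L1_in_sobolev r 0 utt \<and> weak_time_deriv r ut utt"
    and eq: "AE t in lebesgue_on {0..}. AE x in lebesgue_on ?B.
           \<gamma>\<^sup>2 * utt t x + ut t x + B * weak_bilaplacian ?B (u t) x
             - T * weak_laplacian ?B (u t) x = - lam / (1 + u t x)\<^sup>2"
    and cl': "\<forall>t\<in>{0..}. 0 < t \<longrightarrow> clamped (u t)"
    using sol unfolding hyperbolic_solution_def I by blast
  have L1: "L1_in_sobolev r 4 u" "L1_in_sobolev r 0 utt" "weak_time_deriv r ut utt" if "0 < r" for r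
    using L1' that by auto
  have cl: "clamped (u t)" if "0 < t" for t using cl' that by simp
  define E where "E t = ?I (u t)" for t
  define v where "v t = ?I (ut t)" for t
  have uc: "continuous_on (cball 0 1) (u t)" and ug: "\<And>x. x \<in> cball 0 1 \<Longrightarrow> - 1 < u t x" if "0 \<le> t" for t
    using above that by (auto simp: above_minus_one_def)
  have ut2: "ut t \<in> L2_space ?B" if "0 \<le> t" for t
    using C1 that by (auto simp: C1_in_L2_def cont_in_sobolev_def intro: sobolev_L2_space[of _ 0])
  note pair = C1_in_L2_pairing[OF C1 continuous]
  have dE: "(E has_real_derivative v t) (at t within {0..})" if "0 \<le> t" for t
    using pair(1)[of t] that by (simp add: E_def[abs_def] v_def)
  have cv: "continuous_on {0..} v" using pair(2) by (simp add: v_def[abs_def])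
  show False
  proof (rule damped_inequality_unbounded_below[OF \<gamma> c0])
    show "(E has_real_derivative v t) (at t)" if "0 < t" for t
      using has_field_derivative_subset[OF dE[of t], of "{0<..}"] that
      by (simp add: at_within_open[of t "{0<..}"] subset_eq)
    show "continuous_on {0..} E"
      using dE by (intro DERIV_continuous_on) auto
    show "- 1 \<le> E t" if "0 \<le> t" for t
      unfolding E_def by (rule eigenfunction_mean_ge[OF eig uc[OF that] less_imp_le[OF ug[OF that]]])
    fix r :: real and \<psi>
    assume r: "0 < r" and \<psi>: "test_function {0<..<r} \<psi>" "\<And>\<tau>. 0 \<le> \<psi> \<tau>"
    let ?T = "lebesgue_on {0<..<r}"
    have sm: "smooth \<psi>" using \<psi>(1) by (simp add: test_function_def)
    have cp: "continuous_on S \<psi>" "continuous_on S (deriv \<psi>)" for S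
      using smooth_continuous[OF sm] smooth_continuous[OF smooth_partial_at[OF sm, of 1]] by (auto simp: deriv_smooth[OF sm])
    have cv': "continuous_on {0..r} v" using cv by (rule continuous_on_subset) auto
    obtain F where F: "has_L2_bochner_integral r (\<lambda>t x. deriv \<psi> t * ut t x) F"
        "has_L2_bochner_integral r (\<lambda>t x. - (\<psi> t * utt t x)) F"
      using L1(3)[OF r] \<psi>(1) unfolding weak_time_deriv_def by blast
    have "AE t in lebesgue. t \<in> {0..} \<longrightarrow> (AE x in lebesgue_on ?B.
           \<gamma>\<^sup>2 * utt t x + ut t x + B * weak_bilaplacian ?B (u t) x
             - T * weak_laplacian ?B (u t) x = - lam / (1 + u t x)\<^sup>2)"
      using eq by (subst (asm) AE_restrict_space_iff) auto
    then have eq': "AE t in ?T. AE x in lebesgue_on ?B.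
           \<gamma>\<^sup>2 * utt t x + ut t x + B * weak_bilaplacian ?B (u t) x
             - T * weak_laplacian ?B (u t) x = - lam / (1 + u t x)\<^sup>2"
      by (subst AE_restrict_space_iff) (auto elim: eventually_mono)
    have u4: "AE t in ?T. u t \<in> sobolev 4 ?B" and utt2: "AE t in ?T. utt t \<in> sobolev 0 ?B"
      using L1[OF r] by (auto simp: L1_in_sobolev_def bochner_approx_def)
    have "(LINT t|?T. \<psi> t * (c + v t) / \<gamma>\<^sup>2) \<le> ?I F"
    proof (rule bochner_integral_pairing_ge[OF F(2) continuous])
      show "integrable ?T (\<lambda>t. \<psi> t * (c + v t) / \<gamma>\<^sup>2)"
        by (intro integrable_divide integral_open_interval_continuous(1) continuous_intros cp cv')
      show "AE t in ?T. \<psi> t * (c + v t) / \<gamma>\<^sup>2 \<le> (LINT x|lebesgue_on ?B. - (\<psi> t * utt t x) * \<phi> x)"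
        using eq' u4 utt2 AE_space
      proof eventually_elim
        case (elim t)
        then have t: "0 < t" by simp
        have utt: "utt t \<in> L2_space ?B" using elim(3) by (rule sobolev_L2_space)
        have R: "(\<lambda>x. \<gamma>\<^sup>2 * utt t x + ut t x) \<in> L2_space ?B"
          using L2_space_lincomb[OF utt ut2[of t], of "\<gamma>\<^sup>2" 1] t by simp
        have "?I (\<lambda>x. \<gamma>\<^sup>2 * utt t x + ut t x) \<le> - c"
          by (rule eigenfunction_functional_decreases[OF eig c elim(2) cl[OF t] uc ug R elim(1)]) (use t in auto)
        also have "?I (\<lambda>x. \<gamma>\<^sup>2 * utt t x + ut t x) = \<gamma>\<^sup>2 * ?I (utt t) + v t"
          using integrable_L2_mult[OF utt continuous] integrable_L2_mult[OF ut2[of t] continuous] t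
          by (simp add: v_def distrib_right mult.assoc)
        finally have "c + v t \<le> \<gamma>\<^sup>2 * (- ?I (utt t))" by simp
        then have "(c + v t) / \<gamma>\<^sup>2 \<le> - ?I (utt t)" using \<gamma> by (simp add: divide_le_eq mult.commute)
        from mult_left_mono[OF this \<psi>(2)[of t]] show ?case by (simp add: mult.assoc)
      qed
    qed
    \<comment> \<open>an upper bound for the pairing with \<open>\<phi>\<close> is a lower bound for the pairing with \<open>- \<phi>\<close>\<close>
    moreover have "(LINT t|?T. - (deriv \<psi> t * v t)) \<le> (LINT x|lebesgue_on ?B. F x * - \<phi> x)"
    proof (rule bochner_integral_pairing_ge[OF F(1)])
      show "continuous_on (cball 0 1) (\<lambda>x. - \<phi> x)" by (intro continuous_intros continuous)
      show "integrable ?T (\<lambda>t. - (deriv \<psi> t * v t))"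
        by (intro integral_open_interval_continuous(1) continuous_intros cp cv')
      show "AE t in ?T. - (deriv \<psi> t * v t) \<le> (LINT x|lebesgue_on ?B. deriv \<psi> t * ut t x * - \<phi> x)"
        by (rule AE_I2) (simp add: v_def mult.assoc)
    qed
    ultimately have "(LINT t|?T. \<psi> t * (c + v t)) / \<gamma>\<^sup>2 \<le> (LINT t|?T. deriv \<psi> t * v t)" by simp
    then show "(LINT \<tau>|?T. \<psi> \<tau> * (c + v \<tau>)) \<le> \<gamma>\<^sup>2 * (LINT \<tau>|?T. deriv \<psi> \<tau> * v \<tau>)"
      using \<gamma> by (simp add: divide_le_eq mult.commute)
  qed (rule cv)
qed

lemma parabolic_solution_not_global:
  fixes u :: "real \<Rightarrow> 'a::euclidean_space \<Rightarrow> real" and \<phi> :: "'a \<Rightarrow> real"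
  assumes eig: "first_eigenpair B T m \<phi>"
    and c0: "0 < c" and c: "\<And>z. - 1 < z \<Longrightarrow> c \<le> m * z + lam / (1 + z)\<^sup>2"
    and sol: "parabolic_solution B T lam u0 \<infinity> u"
  shows False
proof -
  interpret clamped_C4_function \<phi> using eig by (rule first_eigenpair_clamped)
  let ?B = "ball (0::'a) 1" and ?I = "\<lambda>f. LINT x|lebesgue_on (ball (0::'a) 1). f x * \<phi> x"
  have I: "time_ivl \<infinity> = {0..}" "{0..} - {0} = {0::real<..}" by (auto simp: time_ivl_def)
  obtain ut where above: "above_minus_one {0..} u" and C1: "C1_in_L2 {0<..} u ut"
    and u4: "\<And>t. 0 < t \<Longrightarrow> u t \<in> sobolev 4 ?B"
    and eq: "\<And>t. 0 < t \<Longrightarrow> AE x in lebesgue_on ?B.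
           ut t x + B * weak_bilaplacian ?B (u t) x
             - T * weak_laplacian ?B (u t) x = - lam / (1 + u t x)\<^sup>2"
    and cl: "\<And>t. 0 < t \<Longrightarrow> clamped (u t)"
    using sol unfolding parabolic_solution_def I by (auto simp: cont_in_sobolev_def)
  have uc: "continuous_on (cball 0 1) (u t)" and ug: "\<And>x. x \<in> cball 0 1 \<Longrightarrow> - 1 < u t x" if "0 < t" for t
    using above that by (auto simp: above_minus_one_def)
  have ut2: "ut t \<in> L2_space ?B" if "0 < t" for t
    using C1 that by (auto simp: C1_in_L2_def cont_in_sobolev_def intro: sobolev_L2_space[of _ 0])
  show False
  proof (rule linear_decay_unbounded_below[of 1 "\<lambda>t. ?I (u t)" "\<lambda>t. ?I (ut t)" c])
    fix t :: real assume "1 \<le> t"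
    then have t: "0 < t" by simp
    show "((\<lambda>t. ?I (u t)) has_real_derivative ?I (ut t)) (at t)"
      using C1_in_L2_pairing(1)[OF C1 continuous, of t] t by (simp add: at_within_open[of t "{0<..}"])
    show "?I (ut t) \<le> - c"
      by (rule eigenfunction_functional_decreases[OF eig c u4[OF t] cl[OF t] uc[OF t] ug[OF t] ut2[OF t] eq[OF t]])
    show "- 1 \<le> ?I (u t)"
      by (rule eigenfunction_mean_ge[OF eig uc[OF t] less_imp_le[OF ug[OF t]]])
  qed (rule c0)
qed

theorem proposition1p5:
  fixes B T \<gamma> lam m1 :: real
    and \<phi>1 u0 u1 :: "real ^ 'n \<Rightarrow> real"
    and u :: "real \<Rightarrow> real ^ 'n \<Rightarrow> real"
    and \<tau>m :: ereal
  assumes "CARD('n) \<in> {1, 2}"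
    and "lam > 0" and "B > 0" and "T \<ge> 0"
    and "u0 \<in> sobolev 4 (ball 0 1)" and "u1 \<in> sobolev 2 (ball 0 1)"
    and "\<forall>x\<in>ball 0 1. u0 x > - 1"
    and "clamped u0" and "clamped u1"
    and "first_eigenpair B T m1 \<phi>1"
    and "(\<gamma> > 0 \<and> maximal_solution (hyperbolic_solution \<gamma> B T lam u0 u1) \<tau>m u)
         \<or> maximal_solution (parabolic_solution B T lam u0) \<tau>m u"
    and "lam > 4 * m1 / 27"
  shows "\<tau>m < \<infinity>"
proof (rule ccontr)
  assume "\<not> \<tau>m < \<infinity>"
  then have [simp]: "\<tau>m = \<infinity>" by simp
  have "0 < m1" using assms(10) by (simp add: first_eigenpair_def)
  then obtain c where c: "0 < c" "\<And>z. - 1 < z \<Longrightarrow> c \<le> m1 * z + lam / (1 + z)\<^sup>2"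
    using touchdown_source_bound assms(12) by blast
  show False
    using assms(11) hyperbolic_solution_not_global[OF assms(10) _ c, of \<gamma> u0 u1 u]
      parabolic_solution_not_global[OF assms(10) c, of u0 u]
    unfolding maximal_solution_def by auto
qed

end
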